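(* Let $d\ge 1$ and $M\ge 3$ be integers and let $\mathcal C_M\subset[0,1]$ be a generalized Cantor-type set with base $M$. Let $\gamma:[0,1]\to\{1\}\times[-1,1]^d\subset\mathbb R^{d+1}$ be an injective map satisfying, for some absolute constants $0<c<1<C<\infty$, the bi-Lipschitz condition $$c|x-y|\le|\gamma(x)-\gamma(y)|\le C|x-y|\qquad\text{for all }x,y\in[0,1].$$ Set $\Omega=\{\gamma(t):t\in\mathcal C_M\}$. Then: (a) the set $\Omega$ admits Kakeya-type sets; (b) the operators $D_\Omega$ and $M_\Omega$ are unbounded on $L^p(\mathbb R^{d+1})$ for all $1\le p<\infty$.
   Context: Generalized Cantor-type set with base $M$: partition $[0,1]$ into $M$ closed subintervals of equal length $M^{-1}$; choose any two that are not adjacent (do not share an endpoint), and let $\mathcal C_M^{[1]}$ be the union of these two "first stage basic intervals". Given $\mathcal C_M^{[k]}$, a union of $2^k$ $k$-th stage basic intervals of length $M^{-k}$, partition each of them into $M$ closed subintervals of length $M^{-k-1}$, choose from each any two non-adjacent ones, and let $\mathcal C_M^{[k+1]}$ be the union of the $2^{k+1}$ chosen intervals. Any set $\mathcal C_M=\bigcap_{k\ge1}\mathcal C_M^{[k]}$ arising this way (for any choices) is a generalized Cantor-type set. A $\delta$-tube in $\mathbb R^{d+1}$ is a cylinder of unit axial length and spherical cross-section of radius $\delta$. A tube has orientation $\omega$ if its axis is parallel to $\omega$. For a tube $P$ and $C_0\ge1$, $C_0P$ denotes the tube with the same centre, orientation and cross-sectional radius as $P$ but $C_0$ times its length. $|\cdot|$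 is $(d+1)$-dimensional Lebesgue measure. A compact set $\Omega\subset\mathbb R^{d+1}$ (a set of directions) admits Kakeya-type sets if there is a constant $C_0\ge1$ such that for every $N\ge1$ there exist $\delta_N>0$, with $\delta_N\to0$ as $N\to\infty$, and a collection of $\delta_N$-tubes $\{P^{(N)}_t\}$ in $\mathbb R^{d+1}$ with orientations in $\Omega$, such that with $E_N=\bigcup_tP_t^{(N)}$ and $E_N^*(C_0)=\bigcup_tC_0P_t^{(N)}$ one has $\lim_{N\to\infty}|E_N^*(C_0)|/|E_N|=\infty$. Directional maximal operator: $D_\Omega f(x)=\sup_{\omega\in\Omega}\sup_{h>0}\frac1{2h}\int_{-h}^h|f(x+\omega t)|\,dt$, for $f:\mathbb R^{d+1}\to\mathbb C$ locally integrable along lines. Kakeya–Nikodym maximal operator: $M_\Omega f(x)=\sup_{\omega\in\Omega}\sup_{P\ni x,\,P\parallel\omega}\frac1{|P|}\int_P|f(y)|\,dy$ for $f$ locally integrable, where the inner supremum is over all cylindrical tubes $P$ containing $x$, oriented in direction $\omega$, of arbitrary length $l$ and circular cross-section of arbitrary radius $r$ with $r\le l$. Unbounded on $L^p$ means there is no finite constant $A$ with $\|Tf\|_p\le A\|f\|_p$ for all admissible $f\in L^p$. *)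

theory Defs
  imports "HOL-Analysis.Analysis"
begin

definition basic_interval :: "nat \<Rightarrow> nat \<Rightarrow> nat \<Rightarrow> real set" where
  "basic_interval M k j = {real j / real M ^ k .. (real j + 1) / real M ^ k}"

text \<open>
  \<open>J k\<close> is the set of indices \<open>j\<close> of the basic intervals of stage \<open>k\<close>, the unit interval being
  stage \<open>0\<close>. The \<open>M\<close> equal parts of \<open>basic_interval M k j\<close> are the intervals
  \<open>basic_interval M (Suc k) (M * j + a)\<close> with \<open>a < M\<close>; two of them share no endpoint iff their
  indices differ by at least two. The choice may be different in every interval.
\<close>

definition cantor_stages :: "nat \<Rightarrow> (nat \<Rightarrow> nat set) \<Rightarrow> bool" where
  "cantor_stages M J \<longleftrightarrow> J 0 = {0} \<and>
     (\<forall>k. \<exists>a b. (\<forall>j\<in>J k. a j < M \<and> b j < M \<and> a j + 1 < b j) \<and>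
        J (Suc k) = (\<Union>j\<in>J k. {M * j + a j, M * j + b j}))"

definition generalized_cantor_set :: "nat \<Rightarrow> real set \<Rightarrow> bool" where
  "generalized_cantor_set M \<C> \<longleftrightarrow>
     (\<exists>J. cantor_stages M J \<and> \<C> = (\<Inter>k\<in>{1..}. \<Union>j\<in>J k. basic_interval M k j))"

text \<open>
  The closed cylinder with centre \<open>x\<close>, axis parallel to \<open>\<omega>\<close> (a nonzero vector, not necessarily of
  norm one), axial length \<open>l\<close> and cross-sectional radius \<open>r\<close>.
\<close>

definition tube :: "'a::euclidean_space \<Rightarrow> 'a \<Rightarrow> real \<Rightarrow> real \<Rightarrow> 'a set" where
  "tube x \<omega> l r =
     {x + s *\<^sub>R sgn \<omega> + v | s v. \<bar>s\<bar> \<le> l / 2 \<and> v \<bullet> \<omega> = 0 \<and> norm v \<le> r}"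

text \<open>
  A collection of \<open>\<delta>\<close>-tubes is given by the set of pairs (centre, orientation) of its members. It
  may be infinite, even uncountable; such a union need not be a Borel set, so its measure is taken
  in the completed measure \<^const>\<open>lebesgue\<close>. The ratio of measures is formed in
  \<^typ>\<open>ennreal\<close>, where \<open>0 / 0 = 0\<close> and \<open>\<infinity> / \<infinity> = 0\<close>, so
  neither an empty collection nor one of infinite total measure helps the ratio to become large.
\<close>

definition tube_union :: "('a::euclidean_space \<times> 'a) set \<Rightarrow> real \<Rightarrow> real \<Rightarrow> 'a set" where
  "tube_union P l r = (\<Union>(x, \<omega>)\<in>P. tube x \<omega> l r)"

definition admits_kakeya_type_sets :: "'a::euclidean_space set \<Rightarrow> bool" where
  "admits_kakeya_type_sets \<Omega> \<longleftrightarrow> compact \<Omega> \<and>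
     (\<exists>C0\<ge>1. \<exists>(\<delta> :: nat \<Rightarrow> real) (P :: nat \<Rightarrow> ('a \<times> 'a) set).
        (\<forall>N\<ge>1. \<delta> N > 0 \<and> (\<forall>(x, \<omega>)\<in>P N. \<omega> \<in> \<Omega>)) \<and>
        \<delta> \<longlonglongrightarrow> 0 \<and>
        (\<lambda>N. emeasure lebesgue (tube_union (P N) C0 (\<delta> N)) /
              emeasure lebesgue (tube_union (P N) 1 (\<delta> N))) \<longlonglongrightarrow> \<infinity>)"

definition directional_maximal ::
  "'a::euclidean_space set \<Rightarrow> ('a \<Rightarrow> complex) \<Rightarrow> 'a \<Rightarrow> ennreal" where
  "directional_maximal \<Omega> f x =
     (SUP \<omega>\<in>\<Omega>. SUP h\<in>{0<..}.
        (\<integral>\<^sup>+t\<in>{-h..h}. ennreal (cmod (f (x + t *\<^sub>R \<omega>))) \<partial>lebesgue) / ennreal (2 * h))"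

definition kakeya_nikodym_maximal ::
  "'a::euclidean_space set \<Rightarrow> ('a \<Rightarrow> complex) \<Rightarrow> 'a \<Rightarrow> ennreal" where
  "kakeya_nikodym_maximal \<Omega> f x =
     (SUP \<omega>\<in>\<Omega>. SUP (z, l, r)\<in>{(z, l, r). 0 < r \<and> r \<le> l \<and> x \<in> tube z \<omega> l r}.
        (\<integral>\<^sup>+y\<in>tube z \<omega> l r. ennreal (cmod (f y)) \<partial>lebesgue) /
          emeasure lebesgue (tube z \<omega> l r))"

definition locally_integrable_along_lines :: "('a::euclidean_space \<Rightarrow> complex) \<Rightarrow> bool" where
  "locally_integrable_along_lines f \<longleftrightarrow>
     (\<forall>x u a b. u \<noteq> 0 \<longrightarrow> (\<lambda>t. f (x + t *\<^sub>R u)) absolutely_integrable_on {a..b})"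

definition locally_integrable :: "('a::euclidean_space \<Rightarrow> complex) \<Rightarrow> bool" where
  "locally_integrable f \<longleftrightarrow> (\<forall>K. compact K \<longrightarrow> f absolutely_integrable_on K)"

text \<open>The power of an extended nonnegative real, for exponents \<open>p > 0\<close>.\<close>

definition ennpowr :: "ennreal \<Rightarrow> real \<Rightarrow> ennreal" where
  "ennpowr y p = (if y = \<infinity> then \<infinity> else ennreal (enn2real y powr p))"

definition Lp_norm :: "real \<Rightarrow> ('a::euclidean_space \<Rightarrow> ennreal) \<Rightarrow> ennreal" where
  "Lp_norm p g = ennpowr (\<integral>\<^sup>+x. ennpowr (g x) p \<partial>lebesgue) (1 / p)"

definition in_Lp :: "real \<Rightarrow> ('a::euclidean_space \<Rightarrow> complex) \<Rightarrow> bool" where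
  "in_Lp p f \<longleftrightarrow> f \<in> borel_measurable lebesgue \<and> Lp_norm p (\<lambda>x. ennreal (cmod (f x))) < \<infinity>"

text \<open>
  \<open>adm\<close> describes the functions on which the operator \<open>T\<close> is defined. If \<open>T f\<close> is not
  measurable, its norm is given by the lower integral; the upper integral would only make
  unboundedness easier.
\<close>

definition unbounded_on_Lp ::
  "(('a::euclidean_space \<Rightarrow> complex) \<Rightarrow> bool) \<Rightarrow> (('a \<Rightarrow> complex) \<Rightarrow> 'a \<Rightarrow> ennreal) \<Rightarrow> real \<Rightarrow> bool"
where
  "unbounded_on_Lp adm T p \<longleftrightarrow>
     \<not> (\<exists>A\<ge>0::real. \<forall>f. adm f \<and> in_Lp p f \<longrightarrow>
           Lp_norm p (T f) \<le> ennreal A * Lp_norm p (\<lambda>x. ennreal (cmod (f x))))"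

end

theory Submission
  imports Defs
begin

text \<open>
  Everything follows from finite families of thin tubes with axes in \<open>\<Omega>\<close>, for which lengthening all
  tubes by a fixed factor multiplies the measure of their union by as much as one likes
  (\<open>concentrating_tubes\<close>). Such families are Kakeya-type sets by definition. They also defeat the
  maximal operators: let \<open>E\<close> be the union of the short tubes and \<open>E'\<close> that of the long ones. Through
  every point of \<open>E'\<close> goes a long segment, and a long tube, a fixed proportion of which lies in \<open>E\<close>.
  So the operators applied to the indicator of \<open>E\<close> are bounded below on \<open>E'\<close>, and a bound
  on \<open>L\<^sup>p\<close> would control the measure of \<open>E'\<close> by a constant times that of \<open>E\<close>.
  
  The families are found by averaging. Cut the cube \<open>{0} \<times> [0,1]\<^sup>d\<close> into cubes of side \<open>M\<^sup>-\<^sup>N\<close> and let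
  one line of slope \<open>\<sigma>(z) \<in> \<Omega>\<close> start from each of them. The map \<open>\<sigma>\<close> is \<^emph>\<open>sticky\<close>: cubes with the same
  ancestor at level \<open>k\<close> receive slopes from the same basic interval of stage \<open>k\<close>, and otherwise the two
  children of that interval are chosen freely, cube by cube. Count over all sticky maps.
  
  \<^item> At large height \<open>h\<close> the lines concentrate. The pairs (cube, basic interval) of level \<open>k\<close> whose
    lines can reach a given point form a tree with \<open>O(2\<^sup>k)\<close> nodes at level \<open>k\<close>: a basic interval
    determines the slope, and so the foot of the line, up to \<open>O(M\<^sup>-\<^sup>k)\<close>. Since the two intervals chosen in
    each basic interval are not adjacent and \<open>\<gamma>\<close> is bi-Lipschitz, sibling intervals have feet in
    different cubes if \<open>h\<close> is large, so that the choices along the tree are independent. The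
    point is reached iff some path is chosen in full, which is critical percolation: this happens for a
    proportion \<open>O(1/N)\<close> of the sticky maps (\<open>percolation_card_le\<close>, \<open>card_sticky_hitting\<close>).
  
  \<^item> At height \<open>h \<le> 1\<close> they do not. Two lines of slopes that agree to stage \<open>k\<close> and whose cubes separate
    at level \<open>k + 1\<close> only come close if the cubes lie within \<open>O(h M\<^sup>-\<^sup>k)\<close> of the boundary of their
    ancestor. For each \<open>k\<close> this is a proportion \<open>O(h)\<close> of all cubes, up to rounding. Hence a line
    meets \<open>O(1 + N h)\<close> others on average (\<open>sum_card_touching_le\<close>), and by Cauchy and Schwarz the slice at
    height \<open>h\<close> has mean measure at least a constant times \<open>1 / (1 + N h)\<close>. The integral over
    \<open>0 \<le> h \<le> 1\<close> is of order \<open>ln N / N\<close>.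
  
  On average the part near the ground is thus larger than the part at large height by a factor of
  order \<open>ln N\<close>, so some sticky map does as well (\<open>exists_concentrating_sticky_map\<close>). The
  short tubes are centred at the large height \<open>H\<close>; lengthened by a constant factor they reach the ground.
\<close>

section \<open>Critical percolation on a pair of trees\<close>

text \<open>
  The gain over the linear bound \<open>x / 2\<close> is what makes critical percolation die out.
\<close>

lemma neg_ln_half_one_plus_exp_le:
  fixes x :: real
  assumes "0 \<le> x"
  shows "- ln ((1 + exp (- x)) / 2) \<le> x / (2 + x / 4)"
proof -
  define f where "f = (\<lambda>x::real. x / (2 + x / 4) + ln ((1 + exp (- x)) / 2))"
  have "f 0 \<le> f x"
  proof (rule DERIV_nonneg_imp_nondecreasing[OF assms])
    fix t :: real assume t: "0 \<le> t" "t \<le> x"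
    have pos: "1 + exp (- t) > 0" "2 + t / 4 > 0" using t by (auto intro: add_pos_pos)
    have d1: "((\<lambda>x. x / (2 + x / 4)) has_real_derivative (2 / (2 + t / 4)^2)) (at t)"
      by (rule DERIV_cong, (rule derivative_intros | use pos in force)+) (use pos in \<open>simp add: power2_eq_square\<close>)
    have d2: "((\<lambda>x. ln ((1 + exp (- x)) / 2)) has_real_derivative (- (exp (- t) / (1 + exp (- t))))) (at t)"
      using pos by (auto intro!: derivative_eq_intros simp: field_simps)
    \<comment> \<open>The derivative is nonnegative iff \<open>(2 + t/4)\<^sup>2 \<le> 2 (1 + exp t)\<close>,
        for which the quadratic Taylor bound suffices.\<close>
    have e: "exp t \<ge> 1 + t + t\<^sup>2 / 2" using exp_lower_Taylor_quadratic[of t] t by simp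
    have "0 \<le> t + 15 / 16 * t\<^sup>2" using t by simp
    hence "(2 + t / 4)^2 \<le> 2 * (1 + exp t)"
      using e by (simp add: power2_eq_square algebra_simps)
    hence "1 / (1 + exp t) \<le> 2 / (2 + t / 4)^2"
      using pos by (simp add: divide_simps add_pos_pos mult.commute)
    moreover have "exp (- t) / (1 + exp (- t)) = 1 / (1 + exp t)"
      by (simp add: exp_minus divide_simps add_pos_pos)
    ultimately show "\<exists>y. (f has_real_derivative y) (at t) \<and> 0 \<le> y" 
      using DERIV_add[OF d1 d2] unfolding f_def by (intro exI[of _ "2 / (2 + t / 4)^2 + - (exp (- t) / (1 + exp (- t)))"]) auto
  qed
  thus ?thesis by (simp add: f_def)
qed

text \<open>
  Two rooted trees given by their levels: the positions \<open>Z\<close> with parent map \<open>up\<close>, of any branching,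
  and the binary tree of slopes \<open>J\<close> with parent map \<open>dn\<close>.
\<close>

locale sticky_trees =
  fixes Z :: "nat \<Rightarrow> 'z set" and up :: "'z \<Rightarrow> 'z"
    and J :: "nat \<Rightarrow> 's set" and dn :: "'s \<Rightarrow> 's"
  assumes finZ: "finite (Z k)" and finJ: "finite (J k)"
    and Z0: "card (Z 0) = 1" and J0: "card (J 0) = 1"
    and upZ: "up ` Z (Suc k) = Z k"
    and dnJ: "s \<in> J (Suc k) \<Longrightarrow> dn s \<in> J k"
    and chJ: "s \<in> J k \<Longrightarrow> card {s' \<in> J (Suc k). dn s' = s} = 2"
begin

definition children :: "nat \<Rightarrow> 's \<Rightarrow> 's set" where
  "children k s = {s' \<in> J (Suc k). dn s' = s}"

text \<open>
  The maps from positions to slopes of level \<open>k\<close> that are induced by level-preserving tree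
  homomorphisms. Counting them plays the part of a uniform random choice: the step from level \<open>k\<close> to
  \<open>k + 1\<close> chooses one of the two child slopes independently for every position.
\<close>

primrec sticky_maps :: "nat \<Rightarrow> ('z \<Rightarrow> 's) set" where
  "sticky_maps 0 = PiE (Z 0) (\<lambda>_. J 0)"
| "sticky_maps (Suc k) = (\<Union>\<sigma>\<in>sticky_maps k. PiE (Z (Suc k)) (\<lambda>z. children k (\<sigma> (up z))))"

declare sticky_maps.simps(2)[simp del]

lemma finite_children: "finite (children k s)" and card_children: "s \<in> J k \<Longrightarrow> card (children k s) = 2"
  using finJ chJ by (auto simp: children_def)

lemma sticky_maps_PiE: "\<sigma> \<in> sticky_maps k \<Longrightarrow> \<sigma> \<in> PiE (Z k) (\<lambda>_. J k)"
  by (cases k) (auto simp: children_def PiE_iff sticky_maps.simps(2))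

lemma sticky_maps_in_J: "\<sigma> \<in> sticky_maps k \<Longrightarrow> z \<in> Z k \<Longrightarrow> \<sigma> z \<in> J k"
  using sticky_maps_PiE by fastforce

lemma up_in: "z \<in> Z (Suc k) \<Longrightarrow> up z \<in> Z k"
  using upZ by blast

lemma finite_sticky_maps: "finite (sticky_maps k)"
  by (rule finite_subset[of _ "PiE (Z k) (\<lambda>_. J k)"]) (use sticky_maps_PiE finZ finJ in \<open>auto intro!: finite_PiE\<close>)

lemma extension_parent: "\<tau> \<in> PiE (Z (Suc k)) (\<lambda>z. children k (\<sigma> (up z))) \<Longrightarrow> z \<in> Z (Suc k) \<Longrightarrow> dn (\<tau> z) = \<sigma> (up z)"
  by (auto simp: children_def PiE_iff)

text \<open>
  A sticky map determines the coarser map that it extends, because every position has children.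
\<close>

lemma sum_sticky_maps_Suc:
  "(\<Sum>\<tau>\<in>sticky_maps (Suc k). F \<tau>) = (\<Sum>\<sigma>\<in>sticky_maps k. \<Sum>\<tau>\<in>PiE (Z (Suc k)) (\<lambda>z. children k (\<sigma> (up z))). F \<tau>)"
proof -
  have "PiE (Z (Suc k)) (\<lambda>z. children k (\<sigma> (up z))) \<inter> PiE (Z (Suc k)) (\<lambda>z. children k (\<sigma>' (up z))) = {}"
    if "\<sigma> \<in> sticky_maps k" "\<sigma>' \<in> sticky_maps k" "\<sigma> \<noteq> \<sigma>'" for \<sigma> \<sigma>'
  proof (rule equals0I)
    fix \<tau> assume t0: "\<tau> \<in> PiE (Z (Suc k)) (\<lambda>z. children k (\<sigma> (up z))) \<inter> PiE (Z (Suc k)) (\<lambda>z. children k (\<sigma>' (up z)))"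
    note t = IntD1[OF t0] IntD2[OF t0]
    have "\<sigma> w = \<sigma>' w" if w: "w \<in> Z k" for w
    proof -
      obtain z where z: "z \<in> Z (Suc k)" "w = up z" using w upZ[of k] by blast
      show ?thesis using extension_parent[OF t(1) z(1)] extension_parent[OF t(2) z(1)] z by simp
    qed
    hence "\<sigma> = \<sigma>'" using sticky_maps_PiE[OF that(1)] sticky_maps_PiE[OF that(2)] by (meson PiE_ext)
    thus False using that by simp
  qed
  thus ?thesis
    unfolding sticky_maps.simps(2)
    by (intro sum.UNION_disjoint) (simp_all add: finite_sticky_maps finite_PiE finZ finite_children)
qed

lemma sum_prod_sticky_maps_Suc:
  fixes u :: "'z \<Rightarrow> 's \<Rightarrow> real"
  shows "(\<Sum>\<tau>\<in>sticky_maps (Suc k). \<Prod>z\<in>Z (Suc k). u z (\<tau> z)) =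
    (\<Sum>\<sigma>\<in>sticky_maps k. \<Prod>w\<in>Z k. \<Prod>z\<in>{z\<in>Z (Suc k). up z = w}. \<Sum>s\<in>children k (\<sigma> w). u z s)"
proof -
  have "(\<Sum>\<tau>\<in>PiE (Z (Suc k)) (\<lambda>z. children k (\<sigma> (up z))). \<Prod>z\<in>Z (Suc k). u z (\<tau> z)) =
     (\<Prod>w\<in>Z k. \<Prod>z\<in>{z\<in>Z (Suc k). up z = w}. \<Sum>s\<in>children k (\<sigma> w). u z s)" for \<sigma>
  proof -
    have "(\<Sum>\<tau>\<in>PiE (Z (Suc k)) (\<lambda>z. children k (\<sigma> (up z))). \<Prod>z\<in>Z (Suc k). u z (\<tau> z)) =
      (\<Prod>z\<in>Z (Suc k). \<Sum>s\<in>children k (\<sigma> (up z)). u z s)"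
      by (rule prod_sum_PiE[symmetric]) (auto intro: finZ finite_children)
    also have "\<dots> = (\<Prod>w\<in>Z k. \<Prod>z\<in>{z\<in>Z (Suc k). up z = w}. \<Sum>s\<in>children k (\<sigma> (up z)). u z s)"
      by (rule prod.group[symmetric]) (use upZ[of k] finZ in auto)
    finally show ?thesis by simp
  qed
  thus ?thesis by (simp add: sum_sticky_maps_Suc)
qed

lemma card_sticky_maps_Suc: "card (sticky_maps (Suc k)) = card (sticky_maps k) * 2 ^ card (Z (Suc k))"
proof -
  have "card (sticky_maps (Suc k)) = (\<Sum>\<tau>\<in>sticky_maps (Suc k). 1)" by simp
  also have "\<dots> = (\<Sum>\<sigma>\<in>sticky_maps k. 2 ^ card (Z (Suc k)))"
    unfolding sum_sticky_maps_Suc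
  proof (rule sum.cong[OF refl])
    fix \<sigma> assume s: "\<sigma> \<in> sticky_maps k"
    have "card (PiE (Z (Suc k)) (\<lambda>z. children k (\<sigma> (up z)))) = (\<Prod>z\<in>Z (Suc k). 2)"
      unfolding card_PiE[OF finZ]
      by (rule prod.cong) (auto intro!: card_children sticky_maps_in_J[OF s] up_in)
    thus "(\<Sum>\<tau>\<in>PiE (Z (Suc k)) (\<lambda>z. children k (\<sigma> (up z))). 1) = (2::nat) ^ card (Z (Suc k))" by simp
  qed
  finally show ?thesis by simp
qed

lemma card_sticky_maps_0: "card (sticky_maps 0) = 1"
  using Z0 J0 finZ by (auto simp: card_PiE)

lemma card_sticky_maps_pos: "0 < card (sticky_maps k)"
  by (induction k) (use card_sticky_maps_0 card_sticky_maps_Suc in auto)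

lemma card_J: "card (J k) = 2 ^ k"
proof (induction k)
  case (Suc k)
  have "J (Suc k) = (\<Union>s\<in>J k. children k s)" using dnJ by (auto simp: children_def)
  hence "card (J (Suc k)) = (\<Sum>s\<in>J k. card (children k s))"
    by (simp, subst card_UN_disjoint) (auto simp: finJ finite_children, auto simp: children_def)
  also have "\<dots> = (\<Sum>s\<in>J k. 2)" by (rule sum.cong) (auto simp: card_children)
  finally show ?case using Suc by simp
qed (simp add: J0)

text \<open>
  If \<open>u z s\<close> is the probability that nothing bad happens below the position \<open>z\<close> of level \<open>k + 1\<close>, given
  that it has slope \<open>s\<close>, then \<open>avg k u\<close> is the same probability one level higher: the subtrees below the
  children of a position are independent, and each child slope has probability one half.
\<close>

definition avg :: "nat \<Rightarrow> ('z \<Rightarrow> 's \<Rightarrow> real) \<Rightarrow> 'z \<Rightarrow> 's \<Rightarrow> real" where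
  "avg k u w s = (\<Prod>z\<in>{z\<in>Z (Suc k). up z = w}. (\<Sum>s'\<in>children k s. u z s') / 2)"

lemma mean_prod_sticky_maps_Suc:
  "(\<Sum>\<tau>\<in>sticky_maps (Suc k). \<Prod>z\<in>Z (Suc k). u z (\<tau> z)) / card (sticky_maps (Suc k)) =
   (\<Sum>\<sigma>\<in>sticky_maps k. \<Prod>w\<in>Z k. avg k u w (\<sigma> w)) / card (sticky_maps k)"
proof -
  have "(\<Prod>w\<in>Z k. avg k u w (\<sigma> w)) =
     (\<Prod>w\<in>Z k. \<Prod>z\<in>{z\<in>Z (Suc k). up z = w}. \<Sum>s\<in>children k (\<sigma> w). u z s) / 2 ^ card (Z (Suc k))" for \<sigma>
  proof -
    have "(\<Prod>w\<in>Z k. \<Prod>z\<in>{z\<in>Z (Suc k). up z = w}. (2::real)) = (\<Prod>z\<in>Z (Suc k). 2)"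
      by (rule prod.group) (use upZ[of k] finZ in auto)
    thus ?thesis by (simp add: avg_def prod_dividef)
  qed
  thus ?thesis
    by (simp add: sum_prod_sticky_maps_Suc card_sticky_maps_Suc sum_divide_distrib mult.commute)
qed

text \<open>
  The total negative logarithm of the probabilities \<open>(1 + u z s) / 2\<close> that nothing bad happens below
  \<open>z\<close> when \<open>z\<close> only has slope \<open>s\<close> with probability one half. The logarithm makes independent subtrees
  additive, and the weight \<open>2\<^sup>-\<^sup>k\<close> is the probability that a given slope is chosen at a given position.
\<close>

definition cost :: "nat \<Rightarrow> ('z \<Rightarrow> 's \<Rightarrow> real) \<Rightarrow> real" where
  "cost k u = (\<Sum>z\<in>Z k. \<Sum>s\<in>J k. - ln ((1 + u z s) / 2)) / 2 ^ k"


text \<open>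
  One step towards the root. By independence the negative logarithm \<open>X\<close> of \<open>avg\<close> is the sum of the edge
  costs to the children; exclusivity of siblings is used here, since for a given child position
  at most one of the two slopes is dangerous. An edge above such a node costs at most the concave function
  \<open>X / (2 + X / 4)\<close>. By Jensen's inequality the total is largest when spread evenly over all
  \<open>B * 2^k\<close> dangerous nodes, which gives the bound. In terms of reciprocals, the cost gains the
  constant \<open>1 / (4 * B)\<close> in every generation, like the resistance of an electrical network.
\<close>

lemma cost_avg_le:
  fixes B :: real and A :: "nat \<Rightarrow> 'z \<Rightarrow> 's \<Rightarrow> bool"
  assumes u01: "\<And>z s. z \<in> Z (Suc k) \<Longrightarrow> s \<in> J (Suc k) \<Longrightarrow> 0 \<le> u z s \<and> u z s \<le> 1"
    and live: "\<And>z s. z \<in> Z (Suc k) \<Longrightarrow> s \<in> J (Suc k) \<Longrightarrow> u z s \<noteq> 1 \<Longrightarrow> A (Suc k) z s"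
    and up: "\<And>z s. z \<in> Z (Suc k) \<Longrightarrow> s \<in> J (Suc k) \<Longrightarrow> A (Suc k) z s \<Longrightarrow> A k (up z) (dn s)"
    and uniq: "\<And>z s s'. z \<in> Z (Suc k) \<Longrightarrow> s \<in> J (Suc k) \<Longrightarrow> s' \<in> J (Suc k) \<Longrightarrow> dn s = dn s' \<Longrightarrow>
       A (Suc k) z s \<Longrightarrow> A (Suc k) z s' \<Longrightarrow> s = s'"
    and B: "0 < B" and count: "card {(w, s) \<in> Z k \<times> J k. A k w s} \<le> B * 2 ^ k"
  shows "0 \<le> cost (Suc k) u"
    and "\<And>w s. w \<in> Z k \<Longrightarrow> s \<in> J k \<Longrightarrow> 0 \<le> avg k u w s \<and> avg k u w s \<le> 1"
    and "\<And>w s. w \<in> Z k \<Longrightarrow> s \<in> J k \<Longrightarrow> avg k u w s \<noteq> 1 \<Longrightarrow> A k w s"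
    and "cost k (avg k u) \<le> cost (Suc k) u / (1 + cost (Suc k) u / (4 * B))"
proof -
  define y where "y = (\<lambda>z s. - ln ((1 + u z s) / 2))"
  define X where "X = (\<lambda>w s. \<Sum>z\<in>{z\<in>Z (Suc k). up z = w}. \<Sum>s'\<in>children k s. y z s')"
  have y0: "0 \<le> y z s" if "z \<in> Z (Suc k)" "s \<in> J (Suc k)" for z s
    using u01[OF that] by (simp add: y_def)
  have sub: "s' \<in> J (Suc k)" "dn s' = s" if "s' \<in> children k s" for s s' using that by (auto simp: children_def)
  have X0: "0 \<le> X w s" for w s
    unfolding X_def by (intro sum_nonneg y0) (auto simp: children_def)
  have avg_X: "avg k u w s = exp (- X w s)" if ws: "w \<in> Z k" "s \<in> J k" for w s
  proof -
    have "(\<Sum>s'\<in>children k s. u z s') / 2 = exp (- (\<Sum>s'\<in>children k s. y z s'))" if z: "z \<in> Z (Suc k)" for z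
    proof -
      obtain a b where ab: "children k s = {a, b}" "a \<noteq> b"
        using card_children[OF ws(2)] by (metis card_2_iff)
      have J: "a \<in> J (Suc k)" "b \<in> J (Suc k)" "dn a = dn b"
        using sub[of a s] sub[of b s] by (simp_all add: ab(1))
      have one: "u z a = 1 \<or> u z b = 1"
        using live[OF z J(1)] live[OF z J(2)] uniq[OF z J] ab(2) by blast
      have e: "exp (- y z x) = (1 + u z x) / 2" if "x \<in> J (Suc k)" for x
        using u01[OF z that] by (simp add: y_def)
      have "exp (- (y z a + y z b)) = ((1 + u z a) / 2) * ((1 + u z b) / 2)"
        by (simp only: e[OF J(1), symmetric] e[OF J(2), symmetric] exp_add[symmetric] minus_add_distrib)
      also have "\<dots> = (u z a + u z b) / 2" using one by auto
      finally show ?thesis using ab by simp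
    qed
    thus ?thesis unfolding avg_def X_def
      by (simp add: sum_negf[symmetric] exp_sum finZ)
  qed
  show "\<And>w s. w \<in> Z k \<Longrightarrow> s \<in> J k \<Longrightarrow> 0 \<le> avg k u w s \<and> avg k u w s \<le> 1"
    using avg_X X0 by simp
  have XA: "A k w s" if "w \<in> Z k" "s \<in> J k" and nz: "X w s \<noteq> 0" for w s
  proof -
    obtain z s' where z: "z \<in> Z (Suc k)" "up z = w" "s' \<in> children k s" "y z s' \<noteq> 0"
      using nz unfolding X_def by (metis (mono_tags, lifting) mem_Collect_eq sum.neutral)
    hence "u z s' \<noteq> 1" by (auto simp: y_def)
    thus ?thesis using live[OF z(1) sub(1)[OF z(3)]] up[OF z(1) sub(1)[OF z(3)]] sub(2)[OF z(3)] z by simp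
  qed
  show "\<And>w s. w \<in> Z k \<Longrightarrow> s \<in> J k \<Longrightarrow> avg k u w s \<noteq> 1 \<Longrightarrow> A k w s"
    using XA avg_X by force
  show S0: "0 \<le> cost (Suc k) u"
    unfolding cost_def by (intro divide_nonneg_nonneg sum_nonneg) (use y0 in \<open>auto simp: y_def\<close>)
  define S where "S = cost (Suc k) u"
  have T: "(\<Sum>w\<in>Z k. \<Sum>s\<in>J k. X w s) = 2 * 2 ^ k * S"
  proof -
    have "(\<Sum>w\<in>Z k. \<Sum>s\<in>J k. X w s) = (\<Sum>w\<in>Z k. \<Sum>z\<in>{z\<in>Z (Suc k). up z = w}. \<Sum>s\<in>J k. \<Sum>s'\<in>children k s. y z s')"
      unfolding X_def by (intro sum.cong refl sum.swap)
    also have "\<dots> = (\<Sum>z\<in>Z (Suc k). \<Sum>s\<in>J k. \<Sum>s'\<in>children k s. y z s')"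
      by (rule sum.group) (use upZ[of k] finZ in auto)
    also have "\<dots> = (\<Sum>z\<in>Z (Suc k). \<Sum>s\<in>J (Suc k). y z s)"
      unfolding children_def by (intro sum.cong refl sum.group) (use dnJ finJ in auto)
    finally show ?thesis by (simp add: S_def cost_def y_def)
  qed
  define m where "m = 2 * S / B"
  have m0: "0 \<le> m" using S0 B by (simp add: m_def S_def)
  define L where "L = {(w, s) \<in> Z k \<times> J k. A k w s}"
  have L: "finite L" "L \<subseteq> Z k \<times> J k" unfolding L_def by (auto intro: finite_subset[OF _ finite_cartesian_product[OF finZ finJ]])
  \<comment> \<open>Jensen's inequality in the form of the tangent line at \<open>m\<close>, the mean of \<open>X\<close> over \<open>B * 2^k\<close> nodes.\<close>
  have tangent: "x / (2 + x / 4) \<le> (x + m\<^sup>2 / 8) / (2 * (1 + m / 8)\<^sup>2)" if x: "0 \<le> x" for x :: real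
  proof -
    have "0 \<le> (x - m)\<^sup>2 / 4" by simp
    hence "x * (2 * (1 + m / 8)\<^sup>2) \<le> (x + m\<^sup>2 / 8) * (2 + x / 4)"
      by (simp add: power2_eq_square algebra_simps)
    thus ?thesis using x m0 by (subst frac_le_eq[symmetric] pos_divide_le_eq; simp add: field_simps)
  qed
  have "(\<Sum>w\<in>Z k. \<Sum>s\<in>J k. - ln ((1 + avg k u w s) / 2)) \<le> (\<Sum>w\<in>Z k. \<Sum>s\<in>J k. X w s / (2 + X w s / 4))"
    by (intro sum_mono) (use avg_X neg_ln_half_one_plus_exp_le[OF X0] in auto)
  also have "\<dots> = (\<Sum>(w, s)\<in>Z k \<times> J k. X w s / (2 + X w s / 4))"
    by (simp add: sum.cartesian_product)
  also have "\<dots> = (\<Sum>(w, s)\<in>L. X w s / (2 + X w s / 4))"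
    by (rule sum.mono_neutral_right) (use L finZ finJ XA in \<open>auto simp: L_def\<close>)
  also have "\<dots> \<le> (\<Sum>(w, s)\<in>L. (X w s + m\<^sup>2 / 8) / (2 * (1 + m / 8)\<^sup>2))"
    by (intro sum_mono) (use tangent[OF X0] in auto)
  also have "\<dots> = ((\<Sum>(w, s)\<in>L. X w s) + card L * (m\<^sup>2 / 8)) / (2 * (1 + m / 8)\<^sup>2)"
    by (simp add: sum_divide_distrib[symmetric] sum.distrib case_prod_unfold)
  also have "(\<Sum>(w, s)\<in>L. X w s) = (\<Sum>(w, s)\<in>Z k \<times> J k. X w s)"
    by (rule sum.mono_neutral_left) (use L finZ finJ XA in \<open>auto simp: L_def\<close>)
  also have "\<dots> = B * 2 ^ k * m"
    using T B by (simp add: sum.cartesian_product m_def)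
  also have "(B * 2 ^ k * m + card L * (m\<^sup>2 / 8)) / (2 * (1 + m / 8)\<^sup>2) \<le>
      (B * 2 ^ k * m + B * 2 ^ k * (m\<^sup>2 / 8)) / (2 * (1 + m / 8)\<^sup>2)"
    using count by (intro divide_right_mono add_left_mono mult_right_mono) (auto simp: L_def)
  also have "\<dots> = 2 ^ k * (B * m / (2 * (1 + m / 8)))"
    using m0 by (simp add: power2_eq_square divide_simps) (simp add: algebra_simps)
  also have "B * m / (2 * (1 + m / 8)) = S / (1 + S / (4 * B))"
  proof -
    have "B * m = 2 * S" "2 * (1 + m / 8) = 2 * (1 + S / (4 * B))" using B by (simp_all add: m_def)
    thus ?thesis by (simp only: mult_divide_mult_cancel_left_if) simp
  qed
  finally show "cost k (avg k u) \<le> cost (Suc k) u / (1 + cost (Suc k) u / (4 * B))"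
    by (simp add: cost_def S_def field_simps)
qed

text \<open>
  The reciprocal of the cost is at least \<open>i / (4 * B)\<close> at level \<open>n\<close> and grows by \<open>1 / (4 * B)\<close> per level, so
  at the root it is at least \<open>(i + n) / (4 * B)\<close>; there the cost dominates half the probability of
  the bad event. The counter \<open>i\<close> lets the induction on \<open>n\<close> run from the leaves to the root.
\<close>

lemma percolation_mean_ge:
  fixes B :: real and A :: "nat \<Rightarrow> 'z \<Rightarrow> 's \<Rightarrow> bool" and u :: "'z \<Rightarrow> 's \<Rightarrow> real"
  assumes up: "\<And>k z s. k < N \<Longrightarrow> z \<in> Z (Suc k) \<Longrightarrow> s \<in> J (Suc k) \<Longrightarrow> A (Suc k) z s \<Longrightarrow> A k (up z) (dn s)"
    and uniq: "\<And>k z s s'. k < N \<Longrightarrow> z \<in> Z (Suc k) \<Longrightarrow> s \<in> J (Suc k) \<Longrightarrow> s' \<in> J (Suc k) \<Longrightarrow> dn s = dn s' \<Longrightarrow>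
       A (Suc k) z s \<Longrightarrow> A (Suc k) z s' \<Longrightarrow> s = s'"
    and B: "0 < B" and count: "\<And>k. k \<le> N \<Longrightarrow> card {(w, s) \<in> Z k \<times> J k. A k w s} \<le> B * 2 ^ k"
  shows "n \<le> N \<Longrightarrow> (\<And>z s. z \<in> Z n \<Longrightarrow> s \<in> J n \<Longrightarrow> 0 \<le> u z s \<and> u z s \<le> 1) \<Longrightarrow>
    (\<And>z s. z \<in> Z n \<Longrightarrow> s \<in> J n \<Longrightarrow> u z s \<noteq> 1 \<Longrightarrow> A n z s) \<Longrightarrow> 0 < i \<Longrightarrow> cost n u \<le> 4 * B / real i \<Longrightarrow>
    1 - 8 * B / real (i + n) \<le> (\<Sum>\<sigma>\<in>sticky_maps n. \<Prod>z\<in>Z n. u z (\<sigma> z)) / card (sticky_maps n)"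
proof (induction n arbitrary: u i)
  case 0
  obtain z where z: "Z 0 = {z}" using Z0 by (meson card_1_singletonE)
  obtain s where s: "J 0 = {s}" using J0 by (meson card_1_singletonE)
  have sticky_maps: "sticky_maps 0 = {\<lambda>x\<in>{z}. s}" by (simp add: z s PiE_singleton restrict_def)
  have u: "0 \<le> u z s" "u z s \<le> 1" using 0(2)[of z s] z s by auto
  have "(1 + u z s) / 2 - 1 \<ge> ln ((1 + u z s) / 2)" using u by (intro ln_le_minus_one) auto
  hence "(1 - u z s) / 2 \<le> cost 0 u" by (simp add: cost_def z s field_simps)
  also have "\<dots> \<le> 4 * B / i" using 0 by simp
  finally show ?case using z s by (simp add: sticky_maps card_sticky_maps_0 del: sticky_maps.simps)
next
  case (Suc n)
  define S where "S = cost (Suc n) u"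
  have n: "n < N" using Suc.prems(1) by simp
  have c1: "0 \<le> cost (Suc n) u"
    by (rule cost_avg_le(1)[where A = A and B = B]) (fact Suc.prems(2,3) up[OF n] uniq[OF n] B count[OF less_imp_le[OF n]])+
  have c2: "0 \<le> avg n u w s \<and> avg n u w s \<le> 1" if "w \<in> Z n" "s \<in> J n" for w s
    by (rule cost_avg_le(2)[where A = A and B = B]) (fact Suc.prems(2,3) up[OF n] uniq[OF n] B count[OF less_imp_le[OF n]] that)+
  have c3: "A n w s" if "w \<in> Z n" "s \<in> J n" "avg n u w s \<noteq> 1" for w s
    by (rule cost_avg_le(3)[where A = A and B = B and u = u]) (fact Suc.prems(2,3) up[OF n] uniq[OF n] B count[OF less_imp_le[OF n]] that)+
  have c4: "cost n (avg n u) \<le> cost (Suc n) u / (1 + cost (Suc n) u / (4 * B))"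
    by (rule cost_avg_le(4)[where A = A and B = B]) (fact Suc.prems(2,3) up[OF n] uniq[OF n] B count[OF less_imp_le[OF n]])+
  have S: "0 \<le> S" "S \<le> 4 * B / i" using c1 Suc.prems by (auto simp: S_def)
  have "cost n (avg n u) \<le> S / (1 + S / (4 * B))" using c4 by (simp add: S_def)
  also have "\<dots> \<le> 4 * B / (Suc i)"
  proof -
    have "S * i \<le> 4 * B" using S(2) Suc.prems(4) by (simp add: field_simps)
    hence "S * (1 + real i) \<le> 4 * B * (1 + S / (4 * B))" using B by (simp add: field_simps)
    thus ?thesis using S(1) B by (simp add: divide_simps add_pos_nonneg split: if_splits)
  qed
  finally have "1 - 8 * B / real (Suc i + n) \<le> (\<Sum>\<sigma>\<in>sticky_maps n. \<Prod>z\<in>Z n. avg n u z (\<sigma> z)) / card (sticky_maps n)"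
    by (intro Suc.IH) (use n c2 c3 in auto)
  thus ?case unfolding mean_prod_sticky_maps_Suc[symmetric] by (simp add: add.commute)
qed

text \<open>
  \<open>A k z s\<close> says that a line through \<open>z\<close> with slope \<open>s\<close> is still dangerous at level \<open>k\<close>. The nodes
  carrying \<open>A\<close> form a tree of linear growth in units of \<open>2\<^sup>k\<close>, percolated with probability one half:
  the survival probability after \<open>N\<close> generations is of order \<open>1 / N\<close>, as for a critical branching process.
\<close>

lemma percolation_card_le:
  fixes B :: real and A :: "nat \<Rightarrow> 'z \<Rightarrow> 's \<Rightarrow> bool"
  assumes up: "\<And>k z s. k < N \<Longrightarrow> z \<in> Z (Suc k) \<Longrightarrow> s \<in> J (Suc k) \<Longrightarrow> A (Suc k) z s \<Longrightarrow> A k (up z) (dn s)"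
    and uniq: "\<And>k z s s'. k < N \<Longrightarrow> z \<in> Z (Suc k) \<Longrightarrow> s \<in> J (Suc k) \<Longrightarrow> s' \<in> J (Suc k) \<Longrightarrow> dn s = dn s' \<Longrightarrow>
       A (Suc k) z s \<Longrightarrow> A (Suc k) z s' \<Longrightarrow> s = s'"
    and B: "0 < B" and count: "\<And>k. k \<le> N \<Longrightarrow> card {(w, s) \<in> Z k \<times> J k. A k w s} \<le> B * 2 ^ k"
  shows "card {\<sigma> \<in> sticky_maps N. \<exists>z\<in>Z N. A N z (\<sigma> z)} \<le> card (sticky_maps N) * (8 * B / (N + 1))"
proof -
  define u where "u = (\<lambda>z s. if A N z s then 0 else 1 :: real)"
  have "cost N u = (\<Sum>(z, s)\<in>Z N \<times> J N. if A N z s then ln 2 else 0) / 2 ^ N"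
    by (simp add: cost_def u_def sum.cartesian_product if_distrib ln_div cong: if_cong)
      (rule sum.cong, auto simp: ln_div)
  also have "\<dots> = ln 2 * card {(w, s) \<in> Z N \<times> J N. A N w s} / 2 ^ N"
    by (simp add: case_prod_unfold sum.If_cases finZ finJ Int_def) (auto intro!: arg_cong[where f = card])
  also have "\<dots> \<le> ln 2 * B"
    using count[of N] by (simp add: divide_simps)
  also have "\<dots> \<le> 4 * B / real 1" using B ln_2_less_1 by simp
  finally have "1 - 8 * B / real (1 + N) \<le> (\<Sum>\<sigma>\<in>sticky_maps N. \<Prod>z\<in>Z N. u z (\<sigma> z)) / card (sticky_maps N)"
    by (intro percolation_mean_ge[where A = A and N = N and B = B and n = N and i = 1 and u = u, OF up uniq B count])
      (auto simp: u_def split: if_splits)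
  moreover have "(\<Sum>\<sigma>\<in>sticky_maps N. \<Prod>z\<in>Z N. u z (\<sigma> z)) =
      (\<Sum>\<sigma>\<in>sticky_maps N. if \<exists>z\<in>Z N. A N z (\<sigma> z) then 0 else 1)"
    by (rule sum.cong) (auto simp: u_def finZ prod_zero_iff)
  moreover have "\<dots> = real (card (sticky_maps N)) - card {\<sigma> \<in> sticky_maps N. \<exists>z\<in>Z N. A N z (\<sigma> z)}"
  proof -
    have "(\<Sum>\<sigma>\<in>sticky_maps N. if \<exists>z\<in>Z N. A N z (\<sigma> z) then 0 else 1 :: real) =
        (\<Sum>\<sigma>\<in>sticky_maps N. 1 - (if \<exists>z\<in>Z N. A N z (\<sigma> z) then 1 else 0))"
      by (rule sum.cong) auto
    also have "\<dots> = real (card (sticky_maps N)) - (\<Sum>\<sigma>\<in>sticky_maps N. if \<exists>z\<in>Z N. A N z (\<sigma> z) then 1 else 0)"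
      by (simp add: sum_subtractf)
    finally show ?thesis by (simp add: sum.If_cases finite_sticky_maps Int_def)
  qed
  ultimately show ?thesis using card_sticky_maps_pos[of N]
    by (simp add: field_simps)
qed


section \<open>Correlations of a sticky map at two positions\<close>

lemma sticky_maps_coarser:
  assumes "\<tau> \<in> sticky_maps (Suc n)"
  obtains \<sigma> where "\<sigma> \<in> sticky_maps n" "\<And>z. z \<in> Z (Suc n) \<Longrightarrow> dn (\<tau> z) = \<sigma> (up z)"
proof -
  obtain \<sigma> where "\<sigma> \<in> sticky_maps n" "\<tau> \<in> PiE (Z (Suc n)) (\<lambda>z. children n (\<sigma> (up z)))"
    using assms unfolding sticky_maps.simps(2) by (rule UN_E)
  thus ?thesis using that extension_parent by blast
qed

lemma sticky_maps_agree:
  "\<sigma> \<in> sticky_maps N \<Longrightarrow> m \<le> N \<Longrightarrow> z \<in> Z N \<Longrightarrow> z' \<in> Z N \<Longrightarrow> (up ^^ m) z = (up ^^ m) z' \<Longrightarrow>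
    (dn ^^ m) (\<sigma> z) = (dn ^^ m) (\<sigma> z')"
proof (induction m arbitrary: N \<sigma> z z')
  case (Suc m)
  then obtain n where N: "N = Suc n" by (cases N) auto
  obtain \<rho> where r: "\<rho> \<in> sticky_maps n" "\<And>z. z \<in> Z (Suc n) \<Longrightarrow> dn (\<sigma> z) = \<rho> (up z)"
    using sticky_maps_coarser Suc.prems(1) unfolding N by blast
  have "(dn ^^ m) (\<rho> (up z)) = (dn ^^ m) (\<rho> (up z'))"
    by (rule Suc.IH[OF r(1)]) (use Suc.prems up_in in \<open>auto simp: N funpow_swap1\<close>)
  thus ?case using r(2) Suc.prems by (simp add: funpow_swap1 N)
qed simp

lemma card_extensions:
  assumes s: "\<sigma> \<in> sticky_maps n" and S: "S \<subseteq> Z (Suc n)"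
  shows "card {\<tau> \<in> PiE (Z (Suc n)) (\<lambda>z. children n (\<sigma> (up z))). \<forall>x\<in>S. \<tau> x = f x} * 2 ^ card S \<le>
    (if \<forall>x\<in>S. \<sigma> (up x) = dn (f x) then 2 ^ card (Z (Suc n)) else 0)"
proof (cases "\<forall>x\<in>S. \<sigma> (up x) = dn (f x)")
  case True
  have fS: "finite S" using finite_subset[OF S finZ] .
  have "{\<tau> \<in> PiE (Z (Suc n)) (\<lambda>z. children n (\<sigma> (up z))). \<forall>x\<in>S. \<tau> x = f x} \<subseteq>
      PiE (Z (Suc n)) (\<lambda>z. if z \<in> S then {f z} else children n (\<sigma> (up z)))"
  proof (rule subsetI)
    fix \<tau> assume "\<tau> \<in> {\<tau> \<in> PiE (Z (Suc n)) (\<lambda>z. children n (\<sigma> (up z))). \<forall>x\<in>S. \<tau> x = f x}"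
    hence t: "\<tau> \<in> PiE (Z (Suc n)) (\<lambda>z. children n (\<sigma> (up z)))" and "\<forall>x\<in>S. \<tau> x = f x" by simp_all
    thus "\<tau> \<in> PiE (Z (Suc n)) (\<lambda>z. if z \<in> S then {f z} else children n (\<sigma> (up z)))"
      by (intro PiE_I) (simp_all add: PiE_mem[OF t] PiE_arb[OF t])
  qed
  hence "card {\<tau> \<in> PiE (Z (Suc n)) (\<lambda>z. children n (\<sigma> (up z))). \<forall>x\<in>S. \<tau> x = f x} \<le>
      card (PiE (Z (Suc n)) (\<lambda>z. if z \<in> S then {f z} else children n (\<sigma> (up z))))"
    by (rule card_mono[rotated]) (auto intro!: finite_PiE finZ finite_children)
  also have "\<dots> = (\<Prod>z\<in>Z (Suc n). if z \<in> S then 1 else 2)"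
    unfolding card_PiE[OF finZ] by (rule prod.cong) (auto intro!: card_children sticky_maps_in_J[OF s] up_in)
  also have "\<dots> = 2 ^ card (Z (Suc n) - S)"
    by (simp add: prod.If_cases finZ Diff_eq)
  finally have "card {\<tau> \<in> PiE (Z (Suc n)) (\<lambda>z. children n (\<sigma> (up z))). \<forall>x\<in>S. \<tau> x = f x} * 2 ^ card S
      \<le> 2 ^ card (Z (Suc n) - S) * 2 ^ card S" by simp
  also have "\<dots> = 2 ^ card (Z (Suc n))"
    using card_Diff_subset[OF fS S] card_mono[OF finZ S] by (simp add: power_add[symmetric])
  finally show ?thesis using True by simp
next
  case False
  then obtain x where x: "x \<in> S" "\<sigma> (up x) \<noteq> dn (f x)" by blast
  have "{\<tau> \<in> PiE (Z (Suc n)) (\<lambda>z. children n (\<sigma> (up z))). \<forall>x\<in>S. \<tau> x = f x} = {}"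
  proof (rule equals0I)
    fix \<tau> assume "\<tau> \<in> {\<tau> \<in> PiE (Z (Suc n)) (\<lambda>z. children n (\<sigma> (up z))). \<forall>x\<in>S. \<tau> x = f x}"
    hence t: "\<tau> \<in> PiE (Z (Suc n)) (\<lambda>z. children n (\<sigma> (up z)))" and "\<tau> x = f x" using x(1) by simp_all
    thus False using extension_parent[OF t, of x] x S by auto
  qed
  thus ?thesis using False by (simp only: card.empty)
qed

text \<open>
  Two positions that separate at level \<open>k\<close> share \<open>k\<close> binary choices and make \<open>N - k\<close> further
  choices each, independently, so a pair of values has probability at most
  \<open>2\<^sup>-\<^sup>(\<^sup>2\<^sup>N\<^sup>-\<^sup>k\<^sup>)\<close>.
\<close>

lemma card_prescribed_pair:
  assumes "z \<in> Z N" "z' \<in> Z N" "k \<le> N" "(up ^^ (N - k)) z = (up ^^ (N - k)) z'"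
    and "k < N \<Longrightarrow> (up ^^ (N - k - 1)) z \<noteq> (up ^^ (N - k - 1)) z'"
  shows "card {\<sigma> \<in> sticky_maps N. \<sigma> z = s \<and> \<sigma> z' = s'} * 2 ^ (2 * N - k) \<le> card (sticky_maps N)"
  using assms
proof (induction N arbitrary: k z z' s s')
  case 0
  thus ?case by (auto intro!: card_mono simp: finite_sticky_maps simp del: sticky_maps.simps)
next
  case (Suc n)
  define c where "c = card {\<sigma> \<in> sticky_maps n. \<sigma> (up z) = dn s \<and> \<sigma> (up z') = dn s'}"
  define f where "f = (\<lambda>x. if x = z then s else s')"
  define d where "d = card {z, z'}"
  define E where "E = (\<lambda>\<sigma>. {\<tau> \<in> PiE (Z (Suc n)) (\<lambda>x. children n (\<sigma> (up x))). \<tau> z = s \<and> \<tau> z' = s'})"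
  have E: "card (E \<sigma>) * 2 ^ d \<le> (if \<sigma> (up z) = dn s \<and> \<sigma> (up z') = dn s' then 2 ^ card (Z (Suc n)) else 0)"
    if "\<sigma> \<in> sticky_maps n" for \<sigma>
  proof (cases "z = z' \<and> s \<noteq> s'")
    case True
    hence "E \<sigma> = {}" by (auto simp only: E_def)
    thus ?thesis by (simp only: card.empty)
  next
    case False
    hence "E \<sigma> = {\<tau> \<in> PiE (Z (Suc n)) (\<lambda>z. children n (\<sigma> (up z))). \<forall>x\<in>{z, z'}. \<tau> x = f x}"
      and "(\<forall>x\<in>{z, z'}. \<sigma> (up x) = dn (f x)) = (\<sigma> (up z) = dn s \<and> \<sigma> (up z') = dn s')"
      by (auto simp: f_def E_def)
    thus ?thesis using card_extensions[OF that, of "{z, z'}" f] Suc.prems by (simp add: d_def)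
  qed
  have "card {\<tau> \<in> sticky_maps (Suc n). \<tau> z = s \<and> \<tau> z' = s'} = (\<Sum>\<tau>\<in>sticky_maps (Suc n). if \<tau> z = s \<and> \<tau> z' = s' then 1 else 0)"
    by (simp add: sum.If_cases finite_sticky_maps Int_def)
  also have "\<dots> = (\<Sum>\<sigma>\<in>sticky_maps n. card (E \<sigma>))"
    unfolding sum_sticky_maps_Suc E_def
    by (rule sum.cong[OF refl], subst sum.If_cases) (simp_all add: finite_PiE finZ finite_children Int_def)
  finally have "card {\<tau> \<in> sticky_maps (Suc n). \<tau> z = s \<and> \<tau> z' = s'} * 2 ^ d = (\<Sum>\<sigma>\<in>sticky_maps n. card (E \<sigma>) * 2 ^ d)"
    by (simp add: sum_distrib_right)
  also have "\<dots> \<le> (\<Sum>\<sigma>\<in>sticky_maps n. if \<sigma> (up z) = dn s \<and> \<sigma> (up z') = dn s' then 2 ^ card (Z (Suc n)) else 0)"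
    by (intro sum_mono E)
  also have "\<dots> = c * 2 ^ card (Z (Suc n))"
    by (simp add: sum.If_cases finite_sticky_maps Int_def c_def)
  finally have main: "card {\<tau> \<in> sticky_maps (Suc n). \<tau> z = s \<and> \<tau> z' = s'} * 2 ^ d \<le> c * 2 ^ card (Z (Suc n))" .
  \<comment> \<open>\<open>l\<close> is the level to which the parents of \<open>z\<close> and \<open>z'\<close> agree; it differs from \<open>k\<close> only if \<open>z = z'\<close>.\<close>
  define l where "l = min k n"
  have ih: "c * 2 ^ (2 * n - l) \<le> card (sticky_maps n)"
    unfolding c_def
  proof (rule Suc.IH)
    show "up z \<in> Z n" "up z' \<in> Z n" using Suc.prems up_in by auto
    show "l \<le> n" by (simp add: l_def)
    show "(up ^^ (n - l)) (up z) = (up ^^ (n - l)) (up z')"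
    proof (cases "k = Suc n")
      case True thus ?thesis using Suc.prems(4) by simp
    next
      case False
      hence "Suc n - k = Suc (n - l)" using Suc.prems(3) by (simp add: l_def)
      thus ?thesis using Suc.prems(4) by (simp add: funpow_swap1)
    qed
    assume l: "l < n"
    hence k: "k = l" by (simp add: l_def)
    have "Suc n - k - 1 = Suc (n - l - 1)" using l k by simp
    thus "(up ^^ (n - l - 1)) (up z) \<noteq> (up ^^ (n - l - 1)) (up z')"
      using Suc.prems(5) l k by (simp add: funpow_swap1)
  qed
  have "2 * Suc n - k = d + (2 * n - l)"
  proof (cases "k = Suc n")
    case True
    thus ?thesis using Suc.prems(4) by (simp add: d_def l_def)
  next
    case False
    hence k: "k \<le> n" using Suc.prems(3) by simp
    have "z \<noteq> z'" using Suc.prems(5) k by auto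
    thus ?thesis using k by (simp add: d_def l_def)
  qed
  hence "card {\<tau> \<in> sticky_maps (Suc n). \<tau> z = s \<and> \<tau> z' = s'} * 2 ^ (2 * Suc n - k) =
      (card {\<tau> \<in> sticky_maps (Suc n). \<tau> z = s \<and> \<tau> z' = s'} * 2 ^ d) * 2 ^ (2 * n - l)"
    by (simp add: power_add)
  also have "\<dots> \<le> (c * 2 ^ card (Z (Suc n))) * 2 ^ (2 * n - l)"
    using main by (rule mult_right_mono) simp
  also have "\<dots> = (c * 2 ^ (2 * n - l)) * 2 ^ card (Z (Suc n))" by simp
  also have "\<dots> \<le> card (sticky_maps n) * 2 ^ card (Z (Suc n))"
    using ih by (rule mult_right_mono) simp
  finally show ?case by (simp add: card_sticky_maps_Suc)
qed

lemma funpow_up_in: "z \<in> Z (k + m) \<Longrightarrow> (up ^^ m) z \<in> Z k"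
  by (induction m arbitrary: z) (simp_all add: funpow_swap1 up_in)

lemma funpow_dn_in: "s \<in> J (k + m) \<Longrightarrow> (dn ^^ m) s \<in> J k"
  by (induction m arbitrary: s) (simp_all add: funpow_swap1 dnJ)

lemma card_descendants:
  assumes "r \<in> J k"
  shows "card {s \<in> J (k + m). (dn ^^ m) s = r} \<le> 2 ^ m"
proof (induction m)
  case 0
  have "{s \<in> J k. s = r} \<subseteq> {r}" by auto
  hence "card {s \<in> J k. s = r} \<le> card {r}" by (rule card_mono[rotated]) simp
  thus ?case by simp
next
  case (Suc m)
  have "{s \<in> J (k + Suc m). (dn ^^ Suc m) s = r} \<subseteq> (\<Union>t\<in>{t \<in> J (k + m). (dn ^^ m) t = r}. children (k + m) t)"
    using dnJ by (auto simp: children_def funpow_swap1)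
  hence "card {s \<in> J (k + Suc m). (dn ^^ Suc m) s = r} \<le> card (\<Union>t\<in>{t \<in> J (k + m). (dn ^^ m) t = r}. children (k + m) t)"
    by (rule card_mono[rotated]) (auto simp: finJ finite_children)
  also have "\<dots> \<le> (\<Sum>t\<in>{t \<in> J (k + m). (dn ^^ m) t = r}. card (children (k + m) t))"
    by (rule card_UN_le) (simp add: finJ)
  also have "\<dots> = (\<Sum>t\<in>{t \<in> J (k + m). (dn ^^ m) t = r}. 2)"
    by (rule sum.cong) (auto intro: card_children)
  finally show ?case using Suc by simp
qed

text \<open>
  Sort the pairs of positions by the level \<open>k\<close> at which they separate. Their slopes agree up to level
  \<open>k\<close>, which leaves \<open>2\<^sup>N \<cdot> 2\<^sup>N\<^sup>-\<^sup>k\<close> pairs of slopes; this number cancels the probability of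
  each of them. What remains is the number \<open>B\<close> of positions \<open>z'\<close> that touch for given slopes,
  times the number of positions \<open>z\<close> that can touch anything across the separation.
\<close>

lemma sum_card_touching_pairs_le:
  fixes touch :: "'z \<Rightarrow> 's \<Rightarrow> 'z \<Rightarrow> 's \<Rightarrow> bool" and near :: "nat \<Rightarrow> 'z set" and B :: nat
  assumes cnt: "\<And>z s s'. z \<in> Z N \<Longrightarrow> s \<in> J N \<Longrightarrow> s' \<in> J N \<Longrightarrow> card {z' \<in> Z N. touch z s z' s'} \<le> B"
    and near: "\<And>k z z' s s'. k \<le> N \<Longrightarrow> z \<in> Z N \<Longrightarrow> z' \<in> Z N \<Longrightarrow> s \<in> J N \<Longrightarrow> s' \<in> J N \<Longrightarrow>
      (k < N \<Longrightarrow> (up ^^ (N - k - 1)) z \<noteq> (up ^^ (N - k - 1)) z') \<Longrightarrow>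
      (dn ^^ (N - k)) s = (dn ^^ (N - k)) s' \<Longrightarrow> touch z s z' s' \<Longrightarrow> z \<in> near k"
    and fin: "\<And>k. finite (near k)"
  shows "(\<Sum>\<sigma>\<in>sticky_maps N. card {(z, z') \<in> Z N \<times> Z N. touch z (\<sigma> z) z' (\<sigma> z')}) \<le>
    card (sticky_maps N) * (B * (\<Sum>k\<le>N. card (near k)))"
proof -
  define Q where "Q = (\<lambda>k. {(z, z') \<in> Z N \<times> Z N. (up ^^ (N - k)) z = (up ^^ (N - k)) z' \<and>
      (k < N \<longrightarrow> (up ^^ (N - k - 1)) z \<noteq> (up ^^ (N - k - 1)) z')})"
  define P where "P = (\<lambda>k. {(s, s') \<in> J N \<times> J N. (dn ^^ (N - k)) s = (dn ^^ (N - k)) s'})"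
  define T where "T = (\<lambda>k. {((z, z'), (s, s')) \<in> Q k \<times> P k. touch z s z' s'})"
  have finQ: "finite (Q k)" and finP: "finite (P k)" for k
    unfolding Q_def P_def
    by (rule finite_subset[of _ "Z N \<times> Z N"]; use finZ in auto)
      (rule finite_subset[of _ "J N \<times> J N"]; use finJ in auto)
  have finT: "finite (T k)" for k
    by (rule finite_subset[of _ "Q k \<times> P k"]) (auto simp: T_def finQ finP)
  have ex: "\<exists>k\<le>N. (z, z') \<in> Q k" if z: "z \<in> Z N" "z' \<in> Z N" for z z'
  proof -
    define m where "m = (LEAST m. (up ^^ m) z = (up ^^ m) z')"
    have "(up ^^ N) z \<in> Z 0" "(up ^^ N) z' \<in> Z 0" using funpow_up_in[of _ 0 N] z by auto
    hence N: "(up ^^ N) z = (up ^^ N) z'" using Z0 by (metis card_1_singletonE singletonD)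
    have m: "(up ^^ m) z = (up ^^ m) z'" "m \<le> N"
      unfolding m_def by (rule LeastI[of _ N], rule N) (rule Least_le, rule N)
    have "(up ^^ (m - 1)) z \<noteq> (up ^^ (m - 1)) z'" if "0 < m"
      using not_less_Least[of "m - 1" "\<lambda>m. (up ^^ m) z = (up ^^ m) z'"] that by (simp add: m_def[symmetric])
    thus ?thesis using m z by (intro exI[of _ "N - m"]) (auto simp: Q_def)
  qed
  have cardP: "card (P k) \<le> 2 ^ (2 * N - k)" if k: "k \<le> N" for k
  proof -
    have "P k = (SIGMA s:J N. {s' \<in> J N. (dn ^^ (N - k)) s' = (dn ^^ (N - k)) s})"
      by (auto simp: P_def)
    hence "card (P k) = (\<Sum>s\<in>J N. card {s' \<in> J N. (dn ^^ (N - k)) s' = (dn ^^ (N - k)) s})"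
      by (simp add: finJ)
    also have "\<dots> \<le> (\<Sum>s\<in>J N. 2 ^ (N - k))"
    proof (rule sum_mono)
      fix s assume "s \<in> J N"
      hence "(dn ^^ (N - k)) s \<in> J k" using funpow_dn_in[of s k "N - k"] k by simp
      from card_descendants[OF this, of "N - k"]
      show "card {s' \<in> J N. (dn ^^ (N - k)) s' = (dn ^^ (N - k)) s} \<le> 2 ^ (N - k)" using k by simp
    qed
    also have "\<dots> = 2 ^ (2 * N - k)" using k by (simp add: card_J power_add[symmetric])
    finally show ?thesis .
  qed
  have cardT: "card (T k) \<le> 2 ^ (2 * N - k) * (B * card (near k))" if k: "k \<le> N" for k
  proof -
    define g where "g = (\<lambda>((z, z'), (s, s')). ((s, s'), (z :: 'z, z' :: 'z)) :: ('s \<times> 's) \<times> ('z \<times> 'z))"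
    have "inj_on g (T k)" by (auto simp: inj_on_def g_def)
    moreover have "g ` T k \<subseteq> (SIGMA p:P k. SIGMA z:near k \<inter> Z N. {z' \<in> Z N. touch z (fst p) z' (snd p)})"
      using near[OF k] by (auto simp: g_def T_def P_def Q_def)
    ultimately have "card (T k) \<le> card (SIGMA p:P k. SIGMA z:near k \<inter> Z N. {z' \<in> Z N. touch z (fst p) z' (snd p)})"
      by (rule card_inj_on_le) (auto simp: finP fin finZ)
    also have "\<dots> = (\<Sum>p\<in>P k. \<Sum>z\<in>near k \<inter> Z N. card {z' \<in> Z N. touch z (fst p) z' (snd p)})"
      by (simp add: finP fin finZ)
    also have "\<dots> \<le> (\<Sum>p\<in>P k. \<Sum>z\<in>near k \<inter> Z N. B)"
      by (intro sum_mono cnt) (auto simp: P_def)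
    also have "\<dots> = card (P k) * (card (near k \<inter> Z N) * B)" by simp
    also have "\<dots> \<le> 2 ^ (2 * N - k) * (card (near k) * B)"
      by (intro mult_mono cardP k) (auto intro: card_mono fin)
    finally show ?thesis by (simp add: mult.commute)
  qed
  have "(\<Sum>\<sigma>\<in>sticky_maps N. card {(z, z') \<in> Z N \<times> Z N. touch z (\<sigma> z) z' (\<sigma> z')}) \<le>
     (\<Sum>\<sigma>\<in>sticky_maps N. \<Sum>k\<le>N. card {(p, q) \<in> T k. \<sigma> (fst p) = fst q \<and> \<sigma> (snd p) = snd q})"
  proof (rule sum_mono)
    fix \<sigma> assume s: "\<sigma> \<in> sticky_maps N"
    define h where "h = (\<lambda>(z, z'). ((z, z'), (\<sigma> z, \<sigma> z')))"
    have "inj_on h {(z, z') \<in> Z N \<times> Z N. touch z (\<sigma> z) z' (\<sigma> z')}" by (auto simp: inj_on_def h_def)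
    moreover have "h ` {(z, z') \<in> Z N \<times> Z N. touch z (\<sigma> z) z' (\<sigma> z')} \<subseteq>
        (\<Union>k\<le>N. {(p, q) \<in> T k. \<sigma> (fst p) = fst q \<and> \<sigma> (snd p) = snd q})"
    proof (rule image_subsetI, clarsimp simp: h_def)
      fix z z' assume z: "z \<in> Z N" "z' \<in> Z N" and t: "touch z (\<sigma> z) z' (\<sigma> z')"
      obtain k where k: "k \<le> N" "(z, z') \<in> Q k" using ex[OF z] by blast
      hence "(\<sigma> z, \<sigma> z') \<in> P k"
        using sticky_maps_agree[OF s, of "N - k" z z'] sticky_maps_in_J[OF s] z by (auto simp: P_def Q_def)
      thus "\<exists>k\<in>{..N}. ((z, z'), \<sigma> z, \<sigma> z') \<in> T k" using k t by (auto simp: T_def)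
    qed
    ultimately have "card {(z, z') \<in> Z N \<times> Z N. touch z (\<sigma> z) z' (\<sigma> z')} \<le>
       card (\<Union>k\<le>N. {(p, q) \<in> T k. \<sigma> (fst p) = fst q \<and> \<sigma> (snd p) = snd q})"
      by (rule card_inj_on_le) (auto intro: finite_subset[OF _ finT])
    also have "\<dots> \<le> (\<Sum>k\<le>N. card {(p, q) \<in> T k. \<sigma> (fst p) = fst q \<and> \<sigma> (snd p) = snd q})"
      by (rule card_UN_le) simp
    finally show "card {(z, z') \<in> Z N \<times> Z N. touch z (\<sigma> z) z' (\<sigma> z')} \<le> \<dots>" .
  qed
  also have "\<dots> = (\<Sum>k\<le>N. \<Sum>\<sigma>\<in>sticky_maps N. card {(p, q) \<in> T k. \<sigma> (fst p) = fst q \<and> \<sigma> (snd p) = snd q})"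
    by (rule sum.swap)
  also have "\<dots> \<le> (\<Sum>k\<le>N. card (sticky_maps N) * (B * card (near k)))"
  proof (rule sum_mono)
    fix k assume "k \<in> {..N}"
    hence k: "k \<le> N" by simp
    have "(\<Sum>\<sigma>\<in>sticky_maps N. card {(p, q) \<in> T k. \<sigma> (fst p) = fst q \<and> \<sigma> (snd p) = snd q}) =
      (\<Sum>\<sigma>\<in>sticky_maps N. \<Sum>t\<in>T k. if \<sigma> (fst (fst t)) = fst (snd t) \<and> \<sigma> (snd (fst t)) = snd (snd t) then 1 else 0)"
      by (simp add: sum.If_cases finT Int_def case_prod_unfold)
    also have "\<dots> = (\<Sum>t\<in>T k. card {\<sigma>\<in>sticky_maps N. \<sigma> (fst (fst t)) = fst (snd t) \<and> \<sigma> (snd (fst t)) = snd (snd t)})"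
      by (subst sum.swap) (simp add: sum.If_cases finite_sticky_maps Int_def)
    finally have "(\<Sum>\<sigma>\<in>sticky_maps N. card {(p, q) \<in> T k. \<sigma> (fst p) = fst q \<and> \<sigma> (snd p) = snd q}) * 2 ^ (2 * N - k) =
       (\<Sum>t\<in>T k. card {\<sigma>\<in>sticky_maps N. \<sigma> (fst (fst t)) = fst (snd t) \<and> \<sigma> (snd (fst t)) = snd (snd t)} * 2 ^ (2 * N - k))"
      by (simp add: sum_distrib_right)
    also have "\<dots> \<le> (\<Sum>t\<in>T k. card (sticky_maps N))"
      by (intro sum_mono card_prescribed_pair) (auto simp: T_def Q_def k)
    also have "\<dots> = card (sticky_maps N) * card (T k)" by simp
    also have "\<dots> \<le> card (sticky_maps N) * (2 ^ (2 * N - k) * (B * card (near k)))"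
      by (intro mult_left_mono cardT k) simp
    also have "\<dots> = card (sticky_maps N) * (B * card (near k)) * 2 ^ (2 * N - k)" by simp
    finally show "(\<Sum>\<sigma>\<in>sticky_maps N. card {(p, q) \<in> T k. \<sigma> (fst p) = fst q \<and> \<sigma> (snd p) = snd q}) \<le>
        card (sticky_maps N) * (B * card (near k))"
      by (rule mult_right_le_imp_le) simp
  qed
  finally show ?thesis by (simp add: sum_distrib_left)
qed

end


section \<open>Counting grid points\<close>

lemma card_box_le:
  fixes F :: "('d::finite \<Rightarrow> nat) set"
  assumes "\<And>z z' i. z \<in> F \<Longrightarrow> z' \<in> F \<Longrightarrow> real (z i) - real (z' i) \<le> real b"
  shows "card F \<le> (2 * b + 1) ^ CARD('d)"
proof (cases "F = {}")
  case False
  then obtain z0 where z0: "z0 \<in> F" by blast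
  have "F \<subseteq> PiE UNIV (\<lambda>i. {z0 i - b..z0 i + b})"
  proof
    fix z assume z: "z \<in> F"
    have "z i \<le> z0 i + b \<and> z0 i \<le> z i + b" for i
      using assms[OF z z0, of i] assms[OF z0 z, of i] by linarith
    thus "z \<in> PiE UNIV (\<lambda>i. {z0 i - b..z0 i + b})" by (auto simp: PiE_iff le_diff_conv)
  qed
  hence "card F \<le> card (PiE UNIV (\<lambda>i. {z0 i - b..z0 i + b}))"
    by (rule card_mono[rotated]) (auto intro: finite_PiE)
  also have "\<dots> = (\<Prod>i\<in>UNIV. card {z0 i - b..z0 i + b})" by (rule card_PiE) simp
  also have "\<dots> \<le> (\<Prod>i\<in>(UNIV::'d set). 2 * b + 1)" by (rule prod_mono) auto
  finally show ?thesis by simp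
qed simp

lemma real_div_bounds:
  fixes a L :: nat
  assumes "0 < L"
  shows "real (a div L) \<le> real a / real L" "real a / real L - 1 \<le> real (a div L)"
proof -
  show "real (a div L) \<le> real a / real L" by (rule of_nat_div_le_of_nat)
  have "a < L * (a div L) + L" using assms by (metis dividend_less_times_div mult.commute add.commute)
  hence "real a < real L * real (a div L) + real L" by (metis of_nat_add of_nat_less_iff of_nat_mult)
  thus "real a / real L - 1 \<le> real (a div L)" using assms by (simp add: field_simps)
qed

text \<open>
  A condition on one coordinate is fulfilled by the same proportion of the cube as of a single axis.
\<close>

lemma card_grid_slab:
  fixes P :: "nat \<Rightarrow> bool" and i :: "'d::finite" and K :: nat
  shows "card {z. (\<forall>j. z j < K) \<and> P (z i)} * K = card {x. x < K \<and> P x} * K ^ CARD('d)"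
proof -
  have "{z. (\<forall>j. z j < K) \<and> P (z i)} = PiE UNIV (\<lambda>j. if j = i then {x. x < K \<and> P x} else {..<K})"
    by (auto simp: PiE_iff split: if_splits)
  hence "card {z. (\<forall>j. z j < K) \<and> P (z i)} = (\<Prod>j\<in>UNIV. if j = i then card {x. x < K \<and> P x} else K)"
    by (simp add: card_PiE if_distrib cong: if_cong)
  also have "\<dots> = card {x. x < K \<and> P x} * K ^ (CARD('d) - 1)"
    by (subst prod.remove[of _ i]) (auto simp: prod.If_cases)
  finally show ?thesis by (simp add: power_eq_if)
qed

lemma card_near_multiples:
  fixes L Q m :: nat
  assumes L: "0 < L"
  shows "card {x. x < L * Q \<and> (x mod L < m \<or> L \<le> x mod L + m)} \<le> Q * (2 * m)"
proof -
  let ?R = "{r. r < L \<and> (r < m \<or> L \<le> r + m)}"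
  have "inj_on (\<lambda>x. (x div L, x mod L)) {x. x < L * Q \<and> (x mod L < m \<or> L \<le> x mod L + m)}"
    by (rule inj_onI) (metis div_mult_mod_eq prod.inject)
  moreover have "(\<lambda>x. (x div L, x mod L)) ` {x. x < L * Q \<and> (x mod L < m \<or> L \<le> x mod L + m)} \<subseteq> {..<Q} \<times> ?R"
    using L by (auto simp: div_less_iff_less_mult mult.commute)
  ultimately have "card {x. x < L * Q \<and> (x mod L < m \<or> L \<le> x mod L + m)} \<le> card ({..<Q} \<times> ?R)"
    by (rule card_inj_on_le) auto
  also have "\<dots> = Q * card ?R" by simp
  also have "card ?R \<le> card ({..<m} \<union> {L - m..<L})" by (intro card_mono) auto
  also have "\<dots> \<le> m + m" using card_Un_le[of "{..<m}" "{L - m..<L}"] by simp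
  finally show ?thesis by (simp add: mult_le_mono2 mult_2)
qed

section \<open>Lines with Cantor slopes over a grid\<close>

text \<open>
  The tree of basic intervals, with a slope \<open>g N s\<close> for each interval \<open>s\<close> of stage \<open>N\<close>. The
  integer \<open>s div M ^ m\<close> is the \<open>m\<close>-th ancestor of \<open>s\<close>, of length \<open>M\<^sup>m\<^sup>-\<^sup>N\<close>. For slopes on a
  bi-Lipschitz curve, the upper bound on their differences comes from the lengths of the intervals, and the
  lower bound, for intervals whose ancestors are distinct siblings, from the gap between these.
\<close>

locale cantor_slopes =
  fixes M :: nat and J :: "nat \<Rightarrow> nat set" and g :: "nat \<Rightarrow> nat \<Rightarrow> real ^ 'd" and c C :: real
  assumes M2: "2 \<le> M" and finJ: "finite (J k)" and J0: "J 0 = {0}"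
    and dnJ: "s \<in> J (Suc k) \<Longrightarrow> s div M \<in> J k"
    and chJ: "s \<in> J k \<Longrightarrow> card {s' \<in> J (Suc k). s' div M = s} = 2"
    and c0: "0 < c" and C0: "0 < C"
    and slope_le: "s \<in> J N \<Longrightarrow> s' \<in> J N \<Longrightarrow> m \<le> N \<Longrightarrow> s div M ^ m = s' div M ^ m \<Longrightarrow>
      norm (g N s - g N s') \<le> C * (M ^ m / M ^ N)"
    and slope_ge: "s \<in> J N \<Longrightarrow> s' \<in> J N \<Longrightarrow> m < N \<Longrightarrow> s div M ^ m \<noteq> s' div M ^ m \<Longrightarrow>
      s div M ^ Suc m = s' div M ^ Suc m \<Longrightarrow> c * (M ^ m / M ^ N) \<le> norm (g N s - g N s')"
    and slope_bound: "s \<in> J N \<Longrightarrow> \<bar>g N s $ i\<bar> \<le> 1"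
begin

definition grid :: "nat \<Rightarrow> ('d \<Rightarrow> nat) set" where
  "grid k = {z. \<forall>i. z i < M ^ k}"

definition coarsen :: "('d \<Rightarrow> nat) \<Rightarrow> 'd \<Rightarrow> nat" where
  "coarsen z = (\<lambda>i. z i div M)"

lemma grid_PiE: "grid k = PiE UNIV (\<lambda>_. {..<M ^ k})"
  by (auto simp: grid_def PiE_iff)

lemma finite_grid: "finite (grid k)"
  unfolding grid_PiE by (intro finite_PiE) auto

lemma card_grid: "card (grid k) = (M ^ k) ^ CARD('d)"
  unfolding grid_PiE by (subst card_PiE) auto

lemma coarsen_grid: "coarsen ` grid (Suc k) = grid k"
proof
  show "coarsen ` grid (Suc k) \<subseteq> grid k"
    by (auto simp: coarsen_def grid_def less_mult_imp_div_less mult.commute)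
  show "grid k \<subseteq> coarsen ` grid (Suc k)"
  proof
    fix z assume z: "z \<in> grid k"
    have "coarsen (\<lambda>i. M * z i) = z" using M2 by (auto simp: coarsen_def)
    moreover have "(\<lambda>i. M * z i) \<in> grid (Suc k)" using z M2 by (auto simp: grid_def)
    ultimately show "z \<in> coarsen ` grid (Suc k)" by (metis image_eqI)
  qed
qed

lemma coarsen_funpow: "(coarsen ^^ m) z = (\<lambda>i. z i div M ^ m)"
  by (induction m arbitrary: z) (auto simp: coarsen_def div_mult2_eq[symmetric] mult.commute)

lemma div_funpow: "((\<lambda>s. s div M) ^^ m) s = s div M ^ m"
  by (induction m arbitrary: s) (auto simp: div_mult2_eq[symmetric] mult.commute)

sublocale sticky_trees grid coarsen J "\<lambda>s. s div M"
  by unfold_locales (use finite_grid finJ coarsen_grid dnJ chJ J0 in \<open>auto simp: card_grid\<close>)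

definition pos :: "nat \<Rightarrow> ('d \<Rightarrow> nat) \<Rightarrow> real ^ 'd" where
  "pos N z = (\<chi> i. real (z i) / real M ^ N)"

lemma M_pow_pos: "0 < real M ^ k"
  using M2 by simp

lemma pos_coordinate_le:
  assumes "norm (pos N z - pos N z') \<le> r"
  shows "\<bar>real (z i) - real (z' i)\<bar> \<le> r * real M ^ N"
proof -
  have "\<bar>(pos N z - pos N z') $ i\<bar> \<le> r" using component_le_norm_cart assms order_trans by blast
  hence "\<bar>(real (z i) - real (z' i)) / real M ^ N\<bar> \<le> r" by (simp add: pos_def diff_divide_distrib)
  thus ?thesis using M_pow_pos[of N] by (simp add: abs_divide divide_le_eq)
qed

lemma pos_norm_le:
  assumes "\<And>i. z i div M ^ m = z' i div M ^ m"
  shows "norm (pos N z - pos N z') \<le> CARD('d) * (M ^ m / M ^ N)"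
proof -
  have "\<bar>real (z i) - real (z' i)\<bar> \<le> real M ^ m" for i
  proof -
    have "z i < (z i div M ^ m) * M ^ m + M ^ m" "(z i div M ^ m) * M ^ m \<le> z i"
      "z' i < (z' i div M ^ m) * M ^ m + M ^ m" "(z' i div M ^ m) * M ^ m \<le> z' i"
      using M2 by (auto simp: dividend_less_div_times add.commute)
    hence "z i \<le> z' i + M ^ m \<and> z' i \<le> z i + M ^ m" unfolding assms[of i] by linarith
    hence "real (z i) \<le> real (z' i + M ^ m)" "real (z' i) \<le> real (z i + M ^ m)" by (simp_all only: of_nat_le_iff)
    thus ?thesis by (simp add: abs_le_iff)
  qed
  hence "\<bar>(pos N z - pos N z') $ i\<bar> \<le> M ^ m / M ^ N" for i
    using M_pow_pos[of N] by (simp add: pos_def diff_divide_distrib[symmetric] abs_divide divide_right_mono)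
  hence "(\<Sum>i\<in>UNIV. \<bar>(pos N z - pos N z') $ i\<bar>) \<le> (\<Sum>i\<in>(UNIV::'d set). M ^ m / M ^ N)"
    by (intro sum_mono) auto
  thus ?thesis using norm_le_l1_cart[of "pos N z - pos N z'"] by simp
qed

definition hit :: "nat \<Rightarrow> real \<Rightarrow> real \<Rightarrow> real ^ 'd \<Rightarrow> ('d \<Rightarrow> nat) \<Rightarrow> nat \<Rightarrow> bool" where
  "hit N \<rho> h y z s \<longleftrightarrow> norm (y - (pos N z + h *\<^sub>R g N s)) \<le> \<rho> / real M ^ N"

lemma hit_both_imp_close:
  assumes "hit N \<rho> h y z s" "hit N \<rho> h y z' s'"
  shows "norm ((pos N z + h *\<^sub>R g N s) - (pos N z' + h *\<^sub>R g N s')) \<le> 2 * \<rho> / real M ^ N"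
proof -
  have "(pos N z + h *\<^sub>R g N s) - (pos N z' + h *\<^sub>R g N s') =
      (y - (pos N z' + h *\<^sub>R g N s')) - (y - (pos N z + h *\<^sub>R g N s))" by (simp add: algebra_simps)
  also have "norm \<dots> \<le> \<rho> / real M ^ N + \<rho> / real M ^ N"
    using assms norm_triangle_ineq4[of "y - (pos N z' + h *\<^sub>R g N s')" "y - (pos N z + h *\<^sub>R g N s)"]
    unfolding hit_def by linarith
  finally show ?thesis by simp
qed

lemma pos_diff_le:
  assumes "norm ((pos N z + h *\<^sub>R g N s) - (pos N z' + h *\<^sub>R g N s')) \<le> r" "0 \<le> h"
  shows "norm (pos N z - pos N z') \<le> r + h * norm (g N s - g N s')"
proof -
  have "pos N z - pos N z' = ((pos N z + h *\<^sub>R g N s) - (pos N z' + h *\<^sub>R g N s')) - h *\<^sub>R (g N s - g N s')"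
    by (simp add: algebra_simps)
  hence "norm (pos N z - pos N z') \<le> norm ((pos N z + h *\<^sub>R g N s) - (pos N z' + h *\<^sub>R g N s')) + norm (h *\<^sub>R (g N s - g N s'))"
    by (metis norm_triangle_ineq4)
  thus ?thesis using assms by simp
qed

lemma slope_diff_le:
  assumes "norm ((pos N z + h *\<^sub>R g N s) - (pos N z' + h *\<^sub>R g N s')) \<le> r" "0 \<le> h"
  shows "h * norm (g N s - g N s') \<le> r + norm (pos N z - pos N z')"
proof -
  have "h *\<^sub>R (g N s - g N s') = ((pos N z + h *\<^sub>R g N s) - (pos N z' + h *\<^sub>R g N s')) - (pos N z - pos N z')"
    by (simp add: algebra_simps)
  hence "norm (h *\<^sub>R (g N s - g N s')) \<le> norm ((pos N z + h *\<^sub>R g N s) - (pos N z' + h *\<^sub>R g N s')) + norm (pos N z - pos N z')"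
    by (metis norm_triangle_ineq4)
  thus ?thesis using assms by simp
qed

text \<open>
  Percolation on the tree of pairs (cube, basic interval) that are ancestors of a line hitting \<open>y\<close>.
  Siblings are exclusive: if lines from the same cube of level \<open>k + 1\<close> with sibling slopes both hit
  \<open>y\<close>, the slopes differ by at least \<open>c M\<^sup>-\<^sup>(\<^sup>k\<^sup>+\<^sup>1\<^sup>)\<close>, so \<open>h\<close> times this is
  bounded by the diameter of the cube, which the size of \<open>h\<close> forbids. The growth is bounded because a
  basic interval of length \<open>M\<^sup>-\<^sup>k\<close> moves the foot of the line by \<open>O(M\<^sup>-\<^sup>k)\<close>.
\<close>

lemma card_sticky_hitting:
  fixes b :: nat
  assumes h: "real CARD('d) + 2 * \<rho> < c * h" "h \<le> H" and \<rho>: "0 \<le> \<rho>" and b: "2 * \<rho> + H * C + 1 \<le> b"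
  shows "card {\<sigma> \<in> sticky_maps N. \<exists>z\<in>grid N. hit N \<rho> h y z (\<sigma> z)} \<le>
    card (sticky_maps N) * (8 * real ((2 * b + 1) ^ CARD('d)) / (real N + 1))"
proof -
  have h0: "0 < h" using h \<rho> c0 by (smt (verit) of_nat_0_le_iff zero_less_mult_pos)
  define A where "A = (\<lambda>k z s. \<exists>z'\<in>grid N. \<exists>s'\<in>J N. hit N \<rho> h y z' s' \<and>
      z = (\<lambda>i. z' i div M ^ (N - k)) \<and> s = s' div M ^ (N - k))"
  have "card {\<sigma> \<in> sticky_maps N. \<exists>z\<in>grid N. A N z (\<sigma> z)} \<le> card (sticky_maps N) * (8 * real ((2 * b + 1) ^ CARD('d)) / (real N + 1))"
  proof (rule percolation_card_le[where A = A and N = N and B = "real ((2 * b + 1) ^ CARD('d))"])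
    fix k z s assume k: "k < N" and "A (Suc k) z s"
    then obtain z' s' where z: "z' \<in> grid N" "s' \<in> J N" "hit N \<rho> h y z' s'"
      "z = (\<lambda>i. z' i div M ^ (N - Suc k))" "s = s' div M ^ (N - Suc k)" unfolding A_def by blast
    have "x div M ^ (N - Suc k) div M = x div M ^ (N - k)" for x
    proof -
      have "N - k = Suc (N - Suc k)" using k by simp
      thus ?thesis by (simp add: div_mult2_eq[symmetric] mult.commute)
    qed
    thus "A k (coarsen z) (s div M)" using z unfolding A_def coarsen_def by auto
  next
    fix k z s s' assume k: "k < N" and d: "s div M = s' div M" and A: "A (Suc k) z s" "A (Suc k) z s'"
    define m where "m = N - Suc k"
    obtain z1 s1 where z1: "z1 \<in> grid N" "s1 \<in> J N" "hit N \<rho> h y z1 s1"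
      "z = (\<lambda>i. z1 i div M ^ m)" "s = s1 div M ^ m" using A unfolding A_def m_def by blast
    obtain z2 s2 where z2: "z2 \<in> grid N" "s2 \<in> J N" "hit N \<rho> h y z2 s2"
      "z = (\<lambda>i. z2 i div M ^ m)" "s' = s2 div M ^ m" using A unfolding A_def m_def by blast
    show "s = s'"
    proof (rule ccontr)
      assume "s \<noteq> s'"
      hence ge: "c * (M ^ m / M ^ N) \<le> norm (g N s1 - g N s2)"
        using z1 z2 d k by (intro slope_ge) (auto simp: m_def div_mult2_eq mult.commute[of M])
      have "norm (pos N z1 - pos N z2) \<le> CARD('d) * (M ^ m / M ^ N)"
        using z1(4) z2(4) by (intro pos_norm_le) metis
      hence "h * norm (g N s1 - g N s2) \<le> 2 * \<rho> / real M ^ N + CARD('d) * (M ^ m / M ^ N)"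
        using slope_diff_le[OF hit_both_imp_close[OF z1(3) z2(3)]] h0 by linarith
      moreover have "2 * \<rho> / real M ^ N \<le> 2 * \<rho> * (M ^ m / M ^ N)"
        using \<rho> M2 by (simp add: divide_right_mono mult_le_cancel_left1)
      moreover have "h * (c * (M ^ m / M ^ N)) \<le> h * norm (g N s1 - g N s2)"
        by (rule mult_left_mono[OF ge]) (use h0 in simp)
      moreover have "(c * h) * (M ^ m / M ^ N) = h * (c * (M ^ m / M ^ N))" by simp
      moreover have "(CARD('d) + 2 * \<rho>) * (M ^ m / M ^ N) =
          CARD('d) * (M ^ m / M ^ N) + 2 * \<rho> * (M ^ m / M ^ N)" by (rule distrib_right)
      ultimately have "(c * h) * (M ^ m / M ^ N) \<le> (CARD('d) + 2 * \<rho>) * (M ^ m / M ^ N)"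
        by linarith
      moreover have "0 < real M ^ m / real M ^ N" using M2 by simp
      hence "(CARD('d) + 2 * \<rho>) * (M ^ m / M ^ N) < (c * h) * (M ^ m / M ^ N)"
        by (intro mult_strict_right_mono h(1)) simp
      ultimately show False by (meson leD)
    qed
  next
    fix k assume k: "k \<le> N"
    define m where "m = N - k"
    have one: "card {w \<in> grid k. A k w s} \<le> (2 * b + 1) ^ CARD('d)" for s
    proof (rule card_box_le)
      fix w1 w2 i assume w: "w1 \<in> {w \<in> grid k. A k w s}" "w2 \<in> {w \<in> grid k. A k w s}"
      obtain z1 s1 where z1: "z1 \<in> grid N" "s1 \<in> J N" "hit N \<rho> h y z1 s1"
        "w1 = (\<lambda>i. z1 i div M ^ m)" "s = s1 div M ^ m" using w unfolding A_def m_def by blast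
      obtain z2 s2 where z2: "z2 \<in> grid N" "s2 \<in> J N" "hit N \<rho> h y z2 s2"
        "w2 = (\<lambda>i. z2 i div M ^ m)" "s = s2 div M ^ m" using w unfolding A_def m_def by blast
      have "norm (g N s1 - g N s2) \<le> C * (M ^ m / M ^ N)"
        using z1 z2 by (intro slope_le) (auto simp: m_def)
      hence "h * norm (g N s1 - g N s2) \<le> H * (C * (M ^ m / M ^ N))"
        using h h0 by (intro mult_mono) auto
      hence "norm (pos N z1 - pos N z2) \<le> 2 * \<rho> / real M ^ N + H * (C * (M ^ m / M ^ N))"
        using pos_diff_le[OF hit_both_imp_close[OF z1(3) z2(3)]] h0 by linarith
      hence "\<bar>real (z1 i) - real (z2 i)\<bar> \<le> (2 * \<rho> / real M ^ N + H * (C * (M ^ m / M ^ N))) * real M ^ N"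
        by (rule pos_coordinate_le)
      also have "\<dots> = 2 * \<rho> + H * C * M ^ m" using M2 by (simp add: field_simps)
      also have "\<dots> \<le> 2 * \<rho> * M ^ m + H * C * M ^ m"
        using \<rho> M2 by (simp add: mult_le_cancel_left1)
      finally have "real (z1 i) / M ^ m - real (z2 i) / M ^ m \<le> 2 * \<rho> + H * C"
        using M_pow_pos[of m] by (simp add: diff_divide_distrib[symmetric] divide_le_eq algebra_simps)
      moreover have "real (w1 i) \<le> real (z1 i) / M ^ m" "real (z2 i) / M ^ m - 1 \<le> real (w2 i)"
        using real_div_bounds[of "M ^ m"] M2 z1(4) z2(4) by auto
      ultimately show "real (w1 i) - real (w2 i) \<le> real b" using b by linarith
    qed
    have "{(w, s) \<in> grid k \<times> J k. A k w s} = (\<Union>s\<in>J k. (\<lambda>w. (w, s)) ` {w \<in> grid k. A k w s})" by auto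
    hence "card {(w, s) \<in> grid k \<times> J k. A k w s} \<le> (\<Sum>s\<in>J k. card ((\<lambda>w. (w, s)) ` {w \<in> grid k. A k w s}))"
      using card_UN_le[OF finJ] by metis
    also have "\<dots> \<le> (\<Sum>s\<in>J k. (2 * b + 1) ^ CARD('d))"
    proof (rule sum_mono)
      fix s
      have "card ((\<lambda>w. (w, s)) ` {w \<in> grid k. A k w s}) \<le> card {w \<in> grid k. A k w s}"
        by (rule card_image_le) (simp add: finite_grid)
      thus "card ((\<lambda>w. (w, s)) ` {w \<in> grid k. A k w s}) \<le> (2 * b + 1) ^ CARD('d)"
        using one[of s] by linarith
    qed
    also have "\<dots> = (2 * b + 1) ^ CARD('d) * 2 ^ k" by (simp add: card_J)
    finally have "real (card {(w, s) \<in> grid k \<times> J k. A k w s}) \<le> real ((2 * b + 1) ^ CARD('d) * 2 ^ k)"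
      by (simp only: of_nat_le_iff)
    thus "real (card {(w, s) \<in> grid k \<times> J k. A k w s}) \<le> real ((2 * b + 1) ^ CARD('d)) * 2 ^ k"
      by simp
  qed simp
  moreover have "{\<sigma> \<in> sticky_maps N. \<exists>z\<in>grid N. A N z (\<sigma> z)} = {\<sigma> \<in> sticky_maps N. \<exists>z\<in>grid N. hit N \<rho> h y z (\<sigma> z)}"
    using sticky_maps_in_J by (auto simp: A_def)
  ultimately show ?thesis by simp
qed

text \<open>
  The balls of radius \<open>M\<^sup>-\<^sup>N\<close> around the points of two lines at height \<open>h\<close> may intersect.
\<close>

definition touching :: "nat \<Rightarrow> real \<Rightarrow> ('d \<Rightarrow> nat) \<Rightarrow> nat \<Rightarrow> ('d \<Rightarrow> nat) \<Rightarrow> nat \<Rightarrow> bool" where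
  "touching N h z s z' s' \<longleftrightarrow>
    norm ((pos N z + h *\<^sub>R g N s) - (pos N z' + h *\<^sub>R g N s')) \<le> 2 / real M ^ N"

lemma card_touching_le:
  "card {z' \<in> grid N. touching N h z s z' s'} \<le> 9 ^ CARD('d)"
proof -
  have "card {z' \<in> grid N. touching N h z s z' s'} \<le> (2 * 4 + 1) ^ CARD('d)"
  proof (rule card_box_le)
    fix z1 z2 i assume z: "z1 \<in> {z' \<in> grid N. touching N h z s z' s'}" "z2 \<in> {z' \<in> grid N. touching N h z s z' s'}"
    have "pos N z1 - pos N z2 = ((pos N z + h *\<^sub>R g N s) - (pos N z2 + h *\<^sub>R g N s')) -
       ((pos N z + h *\<^sub>R g N s) - (pos N z1 + h *\<^sub>R g N s'))" by simp
    also have "norm \<dots> \<le> 2 / real M ^ N + 2 / real M ^ N"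
      by (rule order_trans[OF norm_triangle_ineq4 add_mono]) (use z in \<open>auto simp: touching_def\<close>)
    finally have "\<bar>real (z1 i) - real (z2 i)\<bar> \<le> (2 / real M ^ N + 2 / real M ^ N) * real M ^ N"
      by (rule pos_coordinate_le)
    thus "real (z1 i) - real (z2 i) \<le> real 4" using M2 by (auto simp: field_simps split: if_splits)
  qed
  thus ?thesis by simp
qed

text \<open>
  For \<open>k < N\<close>, the grid points within \<open>m\<close> steps of the boundary of their ancestor cube of level
  \<open>k + 1\<close>, whose side has \<open>L\<close> steps. Two touching lines whose slopes agree to level \<open>k\<close> start at most \<open>m\<close>
  steps apart. For \<open>k = N\<close> the two lines are the same, and there is no restriction.
\<close>

definition near_boundary :: "nat \<Rightarrow> real \<Rightarrow> nat \<Rightarrow> ('d \<Rightarrow> nat) set" where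
  "near_boundary N h k = (if k < N then
     (let L = M ^ (N - k - 1); m = nat \<lceil>2 + h * C * real (M ^ (N - k))\<rceil>
      in {z \<in> grid N. \<exists>i. z i mod L < m \<or> L \<le> z i mod L + m}) else grid N)"

text \<open>
  The feet of the two lines are close to each other but lie in different cubes of level \<open>k + 1\<close>.
\<close>

lemma touching_near_boundary:
  assumes h: "0 \<le> h" and k: "k \<le> N" and z: "z \<in> grid N" "z' \<in> grid N" and s: "s \<in> J N" "s' \<in> J N"
    and ne: "k < N \<Longrightarrow> (coarsen ^^ (N - k - 1)) z \<noteq> (coarsen ^^ (N - k - 1)) z'"
    and eq: "s div M ^ (N - k) = s' div M ^ (N - k)" and t: "touching N h z s z' s'"
  shows "z \<in> near_boundary N h k"
proof (cases "k < N")
  case True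
  define L where "L = M ^ (N - k - 1)"
  define m where "m = nat \<lceil>2 + h * C * real (M ^ (N - k))\<rceil>"
  have L: "0 < L" using M2 by (simp add: L_def)
  obtain i where i: "z i div L \<noteq> z' i div L"
    using ne[OF True] by (auto simp: coarsen_funpow L_def)
  have "h * norm (g N s - g N s') \<le> h * (C * (M ^ (N - k) / M ^ N))"
    using slope_le[OF s _ eq] k h by (intro mult_left_mono) auto
  hence "norm (pos N z - pos N z') \<le> 2 / real M ^ N + h * (C * (M ^ (N - k) / M ^ N))"
    using pos_diff_le[OF t[unfolded touching_def] h] by linarith
  hence "\<bar>real (z i) - real (z' i)\<bar> \<le> (2 / real M ^ N + h * (C * (M ^ (N - k) / M ^ N))) * real M ^ N"
    by (rule pos_coordinate_le)
  also have "\<dots> = 2 + h * C * real (M ^ (N - k))" using M_pow_pos[of N] by (simp add: field_simps)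
  also have "\<dots> \<le> real m" unfolding m_def by linarith
  finally have d: "z i \<le> z' i + m" "z' i \<le> z i + m" by linarith+
  have "z i mod L < m \<or> L \<le> z i mod L + m"
  proof (cases "z i div L < z' i div L")
    case True
    hence "L * (z i div L + 1) \<le> L * (z' i div L)" by (intro mult_le_mono2) simp
    hence "L * (z i div L) + L \<le> L * (z' i div L)" by (simp add: distrib_left)
    also have "\<dots> \<le> z' i" by simp
    also have "\<dots> \<le> z i + m" by (rule d)
    also have "\<dots> = L * (z i div L) + z i mod L + m" by simp
    finally have "L \<le> z i mod L + m" by linarith
    thus ?thesis ..
  next
    case False
    hence "z' i div L + 1 \<le> z i div L" using i by simp
    hence "L * (z' i div L + 1) \<le> L * (z i div L)" by (rule mult_le_mono2)
    hence "L * (z' i div L + 1) + z i mod L \<le> L * (z i div L) + z i mod L" by (rule add_right_mono)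
    hence le: "L * (z' i div L + 1) + z i mod L \<le> z i" by (simp only: mult_div_mod_eq)
    have "z' i < L * (z' i div L + 1)"
      using dividend_less_times_div[OF L, of "z' i"] by (simp only: distrib_left mult_1_right add.commute)
    moreover have "x + r \<le> y \<Longrightarrow> x' < x \<Longrightarrow> y \<le> x' + m \<Longrightarrow> r < m" for x r y x' :: nat
      by linarith
    ultimately have "z i mod L < m" using le d(1) by blast
    thus ?thesis ..
  qed
  thus ?thesis using z(1) True by (auto simp: near_boundary_def Let_def L_def m_def)
qed (use z k in \<open>auto simp: near_boundary_def\<close>)

lemma finite_near_boundary: "finite (near_boundary N h k)"
  by (rule finite_subset[OF _ finite_grid[of N]]) (auto simp: near_boundary_def Let_def split: if_splits)

lemma card_near_boundary:
  assumes h: "0 \<le> h" and k: "k < N"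
  shows "card (near_boundary N h k) \<le> card (grid N) * (CARD('d) * (6 / M ^ (N - Suc k) + 2 * h * C * M))"
proof -
  define L where "L = M ^ (N - k - 1)"
  define m where "m = nat \<lceil>2 + h * C * real (M ^ (N - k))\<rceil>"
  define P where "P = (\<lambda>x. x mod L < m \<or> L \<le> x mod L + m)"
  have L: "0 < L" using M2 by (simp add: L_def)
  have e: "N - k = Suc (N - Suc k)" "N = (N - Suc k) + Suc k" using k by simp_all
  have MN: "M ^ N = L * M ^ Suc k" "M ^ (N - k) = M * L"
    by (subst e(2), simp only: power_add L_def diff_Suc_eq_diff_pred) (simp_all add: L_def e(1))
  have slab: "real (card {z :: 'd \<Rightarrow> nat. z \<in> grid N \<and> P (z i)}) \<le> card (grid N) * (2 * m / L)" for i
  proof -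
    have "card {z :: 'd \<Rightarrow> nat. z \<in> grid N \<and> P (z i)} * M ^ N = card {x. x < M ^ N \<and> P x} * card (grid N)"
      using card_grid_slab[of "M ^ N" P i] by (simp add: grid_def card_grid[unfolded grid_def])
    also have "\<dots> \<le> (M ^ Suc k * (2 * m)) * card (grid N)"
      unfolding MN(1) P_def by (intro mult_right_mono card_near_multiples L) simp
    finally have "card {z :: 'd \<Rightarrow> nat. z \<in> grid N \<and> P (z i)} * L * M ^ Suc k \<le> (2 * m * card (grid N)) * M ^ Suc k"
      unfolding MN(1) by (simp add: ac_simps)
    hence "card {z :: 'd \<Rightarrow> nat. z \<in> grid N \<and> P (z i)} * L \<le> 2 * m * card (grid N)"
      using M2 by simp
    hence "real (card {z :: 'd \<Rightarrow> nat. z \<in> grid N \<and> P (z i)} * L) \<le> real (2 * m * card (grid N))"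
      by (simp only: of_nat_le_iff)
    thus ?thesis using L by (simp add: field_simps)
  qed
  have "near_boundary N h k = (\<Union>i\<in>UNIV. {z \<in> grid N. P (z i)})"
    using k by (auto simp: near_boundary_def Let_def L_def m_def P_def)
  hence "card (near_boundary N h k) \<le> (\<Sum>i\<in>UNIV. card {z \<in> grid N. P (z (i :: 'd))})"
    by (simp only:) (rule card_UN_le, simp)
  hence "real (card (near_boundary N h k)) \<le> real (\<Sum>i\<in>UNIV. card {z \<in> grid N. P (z (i :: 'd))})"
    by (simp only: of_nat_le_iff)
  also have "\<dots> = (\<Sum>i\<in>UNIV. real (card {z \<in> grid N. P (z (i :: 'd))}))" by simp
  also have "\<dots> \<le> (\<Sum>i\<in>(UNIV :: 'd set). card (grid N) * (2 * m / L))"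
    by (intro sum_mono slab)
  also have "\<dots> = card (grid N) * (CARD('d) * (2 * m / L))" by simp
  also have "2 * m / L \<le> 6 / M ^ (N - Suc k) + 2 * h * C * M"
  proof -
    have "0 \<le> h * C * real (M ^ (N - k))" using h C0 by simp
    hence "real m \<le> 3 + h * C * (M * L)"
      unfolding m_def MN(2)[symmetric] by linarith
    hence "2 * m / L \<le> 2 * (3 + h * C * (M * L)) / L"
      by (intro divide_right_mono) auto
    also have "\<dots> = 6 / L + 2 * h * C * M" using L by (simp add: field_simps)
    finally show ?thesis by (simp add: L_def)
  qed
  finally show ?thesis by (simp add: mult_left_mono)
qed

definition overlap_const :: real where
  "overlap_const = 9 ^ CARD('d) * (1 + 12 * CARD('d) + 2 * CARD('d) * C * M)"

text \<open>
  Each of the \<open>N\<close> levels of separation contributes a proportion \<open>O(h)\<close> of the grid points, from the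
  boundary layers. The rounding of their width adds a geometric series, and the
  pairs of equal lines add one.
\<close>

lemma sum_card_touching_le:
  assumes h: "0 \<le> h"
  shows "real (\<Sum>\<sigma>\<in>sticky_maps N. card {(z, z') \<in> grid N \<times> grid N. touching N h z (\<sigma> z) z' (\<sigma> z')}) \<le>
    card (sticky_maps N) * (card (grid N) * (overlap_const * (1 + N * h)))"
proof -
  define d where "d = real CARD('d)"
  have d: "0 \<le> d" by (simp add: d_def)
  have "(\<Sum>k<N. 1 / real M ^ (N - Suc k)) = (\<Sum>k<N. (1 / real M) ^ k)"
    by (subst sum.nat_diff_reindex[of "\<lambda>k. 1 / real M ^ k"]) (simp add: power_one_over)
  also have "\<dots> \<le> (\<Sum>k<N. (1 / 2) ^ k)"
    using M2 by (intro sum_mono power_mono) (auto simp: field_simps)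
  also have "\<dots> \<le> 2" by (simp add: sum_gp_strict)
  finally have geo: "(\<Sum>k<N. 1 / real M ^ (N - Suc k)) \<le> 2" .
  have "(\<Sum>k<N. real (card (near_boundary N h k))) \<le>
      (\<Sum>k<N. card (grid N) * (d * (6 / M ^ (N - Suc k) + 2 * h * C * M)))"
    by (intro sum_mono) (use card_near_boundary[OF h] in \<open>auto simp: d_def\<close>)
  also have "\<dots> = card (grid N) * (d * (6 * (\<Sum>k<N. 1 / M ^ (N - Suc k)) + N * (2 * h * C * M)))"
    by (simp add: sum_distrib_left[symmetric] sum.distrib sum_distrib_left)
  also have "\<dots> \<le> card (grid N) * (d * (6 * 2 + N * (2 * h * C * M)))"
    using geo d h C0 by (intro mult_left_mono add_mono) auto
  finally have near: "(\<Sum>k<N. real (card (near_boundary N h k))) \<le> card (grid N) * (d * (6 * 2 + N * (2 * h * C * M)))" .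
  have "real (\<Sum>\<sigma>\<in>sticky_maps N. card {(z, z') \<in> grid N \<times> grid N. touching N h z (\<sigma> z) z' (\<sigma> z')}) \<le>
     real (card (sticky_maps N) * (9 ^ CARD('d) * (\<Sum>k\<le>N. card (near_boundary N h k))))"
    unfolding of_nat_le_iff
  proof (rule sum_card_touching_pairs_le)
    fix k z z' s s'
    assume a: "k \<le> N" "z \<in> grid N" "z' \<in> grid N" "s \<in> J N" "s' \<in> J N"
      and ne: "k < N \<Longrightarrow> (coarsen ^^ (N - k - 1)) z \<noteq> (coarsen ^^ (N - k - 1)) z'"
      and eq: "((\<lambda>s. s div M) ^^ (N - k)) s = ((\<lambda>s. s div M) ^^ (N - k)) s'"
      and t: "touching N h z s z' s'"
    show "z \<in> near_boundary N h k"
      by (rule touching_near_boundary[OF h a ne eq[unfolded div_funpow] t])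
  qed (rule card_touching_le finite_near_boundary)+
  also have "\<dots> = card (sticky_maps N) * (9 ^ CARD('d) * ((\<Sum>k<N. real (card (near_boundary N h k))) + card (grid N)))"
    by (simp only: lessThan_Suc_atMost[symmetric] sum.lessThan_Suc of_nat_mult of_nat_add of_nat_sum)
      (simp add: near_boundary_def)
  also have "\<dots> \<le> card (sticky_maps N) * (9 ^ CARD('d) * (card (grid N) * (d * (6 * 2 + N * (2 * h * C * M))) + card (grid N)))"
    using near by (intro mult_left_mono add_mono) auto
  finally have *: "real (\<Sum>\<sigma>\<in>sticky_maps N. card {(z, z') \<in> grid N \<times> grid N. touching N h z (\<sigma> z) z' (\<sigma> z')}) \<le>
     card (sticky_maps N) * (9 ^ CARD('d) * (card (grid N) * (d * (6 * 2 + N * (2 * h * C * M))) + card (grid N)))" .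
  define X where "X = d * (6 * 2 + N * (2 * h * C * M))"
  define Y where "Y = 1 + 12 * d + 2 * d * C * M"
  have "0 \<le> (1 + 12 * d) * (N * h) + 2 * d * C * M" using d h C0 by simp
  hence XY: "X + 1 \<le> Y * (1 + N * h)" by (simp add: X_def Y_def algebra_simps)
  have "card (sticky_maps N) * (9 ^ CARD('d) * (card (grid N) * X + card (grid N))) =
      card (sticky_maps N) * (9 ^ CARD('d) * card (grid N)) * (X + 1)" by (simp add: distrib_left)
  also have "\<dots> \<le> card (sticky_maps N) * (9 ^ CARD('d) * card (grid N)) * (Y * (1 + N * h))"
    by (rule mult_left_mono[OF XY]) simp
  also have "\<dots> = card (sticky_maps N) * (card (grid N) * (overlap_const * (1 + N * h)))"
    by (simp add: overlap_const_def Y_def d_def)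
  finally show ?thesis using * unfolding X_def by linarith
qed

end


section \<open>Slices of the union of lines\<close>

text \<open>
  A linear form of the Cauchy-Schwarz bound for the measure of a union in terms of overlaps: if \<open>X\<close>
  counts the sets that contain a point, then \<open>2 * a * X - a\<^sup>2 * X\<^sup>2 = 1 - (1 - a * X)\<^sup>2\<close> is
  at most the indicator of the union. Being linear in the number of overlaps, it can be averaged, unlike the
  quotient that one gets from the best choice of \<open>a\<close>.
\<close>

lemma measure_UN_ge:
  fixes A :: "'i \<Rightarrow> 'a::euclidean_space set" and a V :: real
  assumes I: "finite I" and A: "\<And>i. i \<in> I \<Longrightarrow> A i \<in> lmeasurable"
    and V: "\<And>i. i \<in> I \<Longrightarrow> measure lebesgue (A i) = V"
  shows "V * (2 * a * card I - a\<^sup>2 * card {(i, j) \<in> I \<times> I. A i \<inter> A j \<noteq> {}}) \<le> measure lebesgue (\<Union>i\<in>I. A i)"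
proof -
  define T where "T = {(i, j) \<in> I \<times> I. A i \<inter> A j \<noteq> {}}"
  have T: "finite T" "T \<subseteq> I \<times> I" using I by (auto simp: T_def intro: finite_subset[of _ "I \<times> I"])
  define X where "X = (\<lambda>x. \<Sum>i\<in>I. indicat_real (A i) x)"
  have int: "integrable lebesgue (indicat_real (A i))" if "i \<in> I" for i
    using A[OF that] by (auto simp: fmeasurable_def)
  have intX: "integrable lebesgue X" unfolding X_def by (intro Bochner_Integration.integrable_sum int)
  have iX: "(\<integral>x. X x \<partial>lebesgue) = V * card I"
  proof -
    have "(\<integral>x. X x \<partial>lebesgue) = (\<Sum>i\<in>I. (\<integral>x. indicat_real (A i) x \<partial>lebesgue))"
      unfolding X_def by (rule Bochner_Integration.integral_sum) (rule int)
    also have "\<dots> = (\<Sum>i\<in>I. V)" by (rule sum.cong) (auto simp: V)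
    finally show ?thesis by simp
  qed
  have X2: "(X x)\<^sup>2 = (\<Sum>p\<in>T. indicat_real (A (fst p) \<inter> A (snd p)) x)" for x
  proof -
    have "(X x)\<^sup>2 = (\<Sum>i\<in>I. \<Sum>j\<in>I. indicat_real (A i) x * indicat_real (A j) x)"
      by (simp add: X_def power2_eq_square sum_product)
    also have "\<dots> = (\<Sum>p\<in>I \<times> I. indicat_real (A (fst p) \<inter> A (snd p)) x)"
      by (simp add: sum.cartesian_product case_prod_unfold indicator_inter_arith)
    also have "\<dots> = (\<Sum>p\<in>T. indicat_real (A (fst p) \<inter> A (snd p)) x)"
      by (rule sum.mono_neutral_right) (use T I in \<open>auto simp: T_def\<close>)
    finally show ?thesis .
  qed
  have meas: "A (fst p) \<inter> A (snd p) \<in> lmeasurable" if "p \<in> T" for p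
    using that T A by (intro fmeasurable_Int_fmeasurable) (auto dest: fmeasurableD)
  have int2: "integrable lebesgue (indicat_real (A (fst p) \<inter> A (snd p)))" if "p \<in> T" for p
    using meas[OF that] by (auto simp: fmeasurable_def)
  have intX2: "integrable lebesgue (\<lambda>x. (X x)\<^sup>2)"
    unfolding X2 by (intro Bochner_Integration.integrable_sum int2)
  have iX2: "(\<integral>x. (X x)\<^sup>2 \<partial>lebesgue) \<le> card T * V"
  proof -
    have "(\<integral>x. (X x)\<^sup>2 \<partial>lebesgue) = (\<Sum>p\<in>T. measure lebesgue (A (fst p) \<inter> A (snd p)))"
      unfolding X2 by (subst Bochner_Integration.integral_sum) (auto simp: int2)
    also have "\<dots> \<le> (\<Sum>p\<in>T. V)"
    proof (rule sum_mono)
      fix p assume p: "p \<in> T"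
      hence i: "fst p \<in> I" using T by auto
      have "measure lebesgue (A (fst p) \<inter> A (snd p)) \<le> measure lebesgue (A (fst p))"
        using meas[OF p] A[OF i] by (intro measure_mono_fmeasurable) (auto dest: fmeasurableD)
      thus "measure lebesgue (A (fst p) \<inter> A (snd p)) \<le> V" using V[OF i] by simp
    qed
    finally show ?thesis by simp
  qed
  have U: "(\<Union>i\<in>I. A i) \<in> lmeasurable" using I A by (intro fmeasurable.finite_UN) auto
  hence intU: "integrable lebesgue (indicat_real (\<Union>i\<in>I. A i))" by (auto simp: fmeasurable_def)
  have "2 * a * X x - a\<^sup>2 * (X x)\<^sup>2 \<le> indicat_real (\<Union>i\<in>I. A i) x" for x
  proof (cases "x \<in> (\<Union>i\<in>I. A i)")
    case True
    have "0 \<le> (1 - a * X x)\<^sup>2" by simp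
    thus ?thesis using True by (simp add: power2_eq_square algebra_simps)
  next
    case False
    hence "X x = 0" by (simp add: X_def)
    thus ?thesis by simp
  qed
  hence "(\<integral>x. 2 * a * X x - a\<^sup>2 * (X x)\<^sup>2 \<partial>lebesgue) \<le> (\<integral>x. indicat_real (\<Union>i\<in>I. A i) x \<partial>lebesgue)"
    by (intro integral_mono intU Bochner_Integration.integrable_diff integrable_mult_right intX intX2)
  also have "(\<integral>x. 2 * a * X x - a\<^sup>2 * (X x)\<^sup>2 \<partial>lebesgue) = 2 * a * (V * card I) - a\<^sup>2 * (\<integral>x. (X x)\<^sup>2 \<partial>lebesgue)"
    by (subst Bochner_Integration.integral_diff) (use intX intX2 iX in auto)
  also have "(\<integral>x. indicat_real (\<Union>i\<in>I. A i) x \<partial>lebesgue) = measure lebesgue (\<Union>i\<in>I. A i)" by simp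
  finally have "2 * a * (V * card I) - a\<^sup>2 * (\<integral>x. (X x)\<^sup>2 \<partial>lebesgue) \<le> measure lebesgue (\<Union>i\<in>I. A i)" .
  moreover have "a\<^sup>2 * (\<integral>x. (X x)\<^sup>2 \<partial>lebesgue) \<le> a\<^sup>2 * (card T * V)"
    using iX2 by (intro mult_left_mono) auto
  ultimately show ?thesis unfolding T_def[symmetric] by (simp add: algebra_simps)
qed

context cantor_slopes begin

definition swept :: "nat \<Rightarrow> real \<Rightarrow> real set \<Rightarrow> (('d \<Rightarrow> nat) \<Rightarrow> nat) \<Rightarrow> (real \<times> (real ^ 'd)) set" where
  "swept N \<rho> I \<sigma> = {(h, y). h \<in> I \<and> (\<exists>z\<in>grid N. hit N \<rho> h y z (\<sigma> z))}"

lemma closed_swept: "closed I \<Longrightarrow> closed (swept N \<rho> I \<sigma>)"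
proof -
  assume I: "closed I"
  have "swept N \<rho> I \<sigma> = (fst -` I) \<inter> (\<Union>z\<in>grid N. {p. norm (snd p - (pos N z + fst p *\<^sub>R g N (\<sigma> z))) \<le> \<rho> / real M ^ N})"
    by (auto simp: swept_def hit_def)
  also have "closed \<dots>"
    by (intro closed_Int closed_vimage_fst I closed_UN finite_grid ballI closed_Collect_le continuous_intros)
  finally show ?thesis .
qed

lemma norm_slope_le: "s \<in> J N \<Longrightarrow> norm (g N s) \<le> CARD('d)"
proof -
  assume s: "s \<in> J N"
  have "(\<Sum>i\<in>UNIV. \<bar>g N s $ i\<bar>) \<le> (\<Sum>i\<in>(UNIV :: 'd set). 1)"
    by (intro sum_mono slope_bound s)
  thus ?thesis using norm_le_l1_cart[of "g N s"] by simp
qed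

lemma norm_pos_le: "z \<in> grid N \<Longrightarrow> norm (pos N z) \<le> CARD('d)"
proof -
  assume z: "z \<in> grid N"
  have "\<bar>pos N z $ i\<bar> \<le> 1" for i
  proof -
    have "real (z i) \<le> real (M ^ N)" using z by (simp only: of_nat_le_iff) (simp add: grid_def less_imp_le)
    thus ?thesis using M_pow_pos[of N] by (simp add: pos_def divide_le_eq)
  qed
  hence "(\<Sum>i\<in>UNIV. \<bar>pos N z $ i\<bar>) \<le> (\<Sum>i\<in>(UNIV :: 'd set). 1)"
    by (intro sum_mono)
  thus ?thesis using norm_le_l1_cart[of "pos N z"] by simp
qed

lemma overlap_const_pos: "0 < overlap_const"
  using C0 by (auto simp: overlap_const_def intro!: mult_pos_pos add_pos_nonneg)

text \<open>
  The bound of \<open>measure_UN_ge\<close> with \<open>a\<close> equal to the reciprocal of the bound for the mean number of lines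
  that touch a given one.
\<close>

lemma sum_slice_ge:
  assumes h: "h \<in> {0..1}"
  shows "card (sticky_maps N) * (unit_ball_vol CARD('d) / (overlap_const * (1 + N * h))) \<le>
    (\<Sum>\<sigma>\<in>sticky_maps N. measure lebesgue (Pair h -` swept N 1 {0..1} \<sigma>))"
proof -
  define D where "D = overlap_const * (1 + N * h)"
  define n where "n = real (card (grid N))"
  define V where "V = unit_ball_vol CARD('d) * (1 / real M ^ N) ^ CARD('d)"
  define ctr where "ctr = (\<lambda>\<sigma> z. pos N z + h *\<^sub>R g N (\<sigma> z))"
  have D: "0 < D" using overlap_const_pos h by (auto simp: D_def intro!: mult_pos_pos add_pos_nonneg)
  have V0: "0 \<le> V" using M_pow_pos by (simp add: V_def)
  have nV: "n * V = unit_ball_vol CARD('d)"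
    using M_pow_pos[of N] by (simp add: n_def V_def card_grid power_one_over)
  have slice: "Pair h -` swept N 1 {0..1} \<sigma> = (\<Union>z\<in>grid N. cball (ctr \<sigma> z) (1 / real M ^ N))" for \<sigma>
    using h by (auto simp: swept_def hit_def ctr_def dist_norm norm_minus_commute)
  have one: "V * (2 * (1 / D) * n - (1 / D)\<^sup>2 * card {(z, z') \<in> grid N \<times> grid N. touching N h z (\<sigma> z) z' (\<sigma> z')})
      \<le> measure lebesgue (Pair h -` swept N 1 {0..1} \<sigma>)" for \<sigma>
  proof -
    have "{(z, z') \<in> grid N \<times> grid N. cball (ctr \<sigma> z) (1 / real M ^ N) \<inter> cball (ctr \<sigma> z') (1 / real M ^ N) \<noteq> {}} \<subseteq>
        {(z, z') \<in> grid N \<times> grid N. touching N h z (\<sigma> z) z' (\<sigma> z')}"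
    proof (clarsimp)
      fix z z' assume ne: "cball (ctr \<sigma> z) (1 / real M ^ N) \<inter> cball (ctr \<sigma> z') (1 / real M ^ N) \<noteq> {}"
      then obtain y where "dist (ctr \<sigma> z) y \<le> 1 / real M ^ N" "dist (ctr \<sigma> z') y \<le> 1 / real M ^ N" by auto
      hence "dist (ctr \<sigma> z) (ctr \<sigma> z') \<le> 1 / real M ^ N + 1 / real M ^ N"
        using dist_triangle2[of "ctr \<sigma> z" "ctr \<sigma> z'" y] by linarith
      thus "touching N h z (\<sigma> z) z' (\<sigma> z')" by (simp add: touching_def ctr_def dist_norm)
    qed
    hence "card {(z, z') \<in> grid N \<times> grid N. cball (ctr \<sigma> z) (1 / real M ^ N) \<inter> cball (ctr \<sigma> z') (1 / real M ^ N) \<noteq> {}} \<le>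
        card {(z, z') \<in> grid N \<times> grid N. touching N h z (\<sigma> z) z' (\<sigma> z')}"
      by (rule card_mono[rotated]) (rule finite_subset[of _ "grid N \<times> grid N"], auto simp: finite_grid)
    hence "V * (2 * (1 / D) * n - (1 / D)\<^sup>2 * card {(z, z') \<in> grid N \<times> grid N. touching N h z (\<sigma> z) z' (\<sigma> z')}) \<le>
      V * (2 * (1 / D) * n - (1 / D)\<^sup>2 * card {(z, z') \<in> grid N \<times> grid N. cball (ctr \<sigma> z) (1 / real M ^ N) \<inter> cball (ctr \<sigma> z') (1 / real M ^ N) \<noteq> {}})"
      by (intro mult_left_mono V0 diff_left_mono) auto
    also have "\<dots> \<le> measure lebesgue (\<Union>z\<in>grid N. cball (ctr \<sigma> z) (1 / real M ^ N))"
      unfolding n_def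
      by (rule measure_UN_ge[OF finite_grid]) (use M_pow_pos[of N] in \<open>auto simp: V_def content_cball\<close>)
    finally show ?thesis unfolding slice .
  qed
  have "card (sticky_maps N) * (unit_ball_vol CARD('d) / D) = V * (2 * (1 / D) * n * card (sticky_maps N) - (1 / D)\<^sup>2 * (card (sticky_maps N) * (n * D)))"
    unfolding nV[symmetric] using D by (simp add: field_simps power2_eq_square)
  also have "\<dots> \<le> V * (2 * (1 / D) * n * card (sticky_maps N) - (1 / D)\<^sup>2 *
      real (\<Sum>\<sigma>\<in>sticky_maps N. card {(z, z') \<in> grid N \<times> grid N. touching N h z (\<sigma> z) z' (\<sigma> z')}))"
    using sum_card_touching_le[of h N] h
    by (intro mult_left_mono V0 diff_left_mono) (auto simp: D_def n_def)
  also have "\<dots> = (\<Sum>\<sigma>\<in>sticky_maps N. V * (2 * (1 / D) * n - (1 / D)\<^sup>2 *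
      card {(z, z') \<in> grid N \<times> grid N. touching N h z (\<sigma> z) z' (\<sigma> z')}))"
    by (simp add: sum_distrib_left[symmetric] sum_subtractf)
  also have "\<dots> \<le> (\<Sum>\<sigma>\<in>sticky_maps N. measure lebesgue (Pair h -` swept N 1 {0..1} \<sigma>))"
    by (intro sum_mono one)
  finally show ?thesis by (simp add: D_def)
qed

text \<open>
  Integration of the slices over \<open>h\<close>; the antiderivative of \<open>1 / (1 + N h)\<close> provides the logarithm.
\<close>

lemma sum_emeasure_low_ge:
  assumes N: "0 < N"
  shows "ennreal (card (sticky_maps N) * (unit_ball_vol CARD('d) * ln (1 + real N) / (overlap_const * N))) \<le>
    (\<Sum>\<sigma>\<in>sticky_maps N. emeasure lborel (swept N 1 {0..1} \<sigma>))"
proof -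
  define K where "K = card (sticky_maps N) * unit_ball_vol CARD('d) / overlap_const"
  have K: "0 \<le> K" using overlap_const_pos by (simp add: K_def)
  have sets: "swept N 1 {0..1} \<sigma> \<in> sets (lborel \<Otimes>\<^sub>M lborel)" for \<sigma>
    unfolding lborel_prod by (simp add: closed_swept)
  have slice_meas: "emeasure lborel (Pair h -` swept N 1 {0..1} \<sigma>) = ennreal (measure lebesgue (Pair h -` swept N 1 {0..1} \<sigma>))"
    if "h \<in> {0..1}" for h \<sigma>
  proof -
    have eq: "Pair h -` swept N 1 {0..1} \<sigma> = (\<Union>z\<in>grid N. cball (pos N z + h *\<^sub>R g N (\<sigma> z)) (1 / real M ^ N))"
      using that by (auto simp: swept_def hit_def dist_norm norm_minus_commute)
    have c: "compact (Pair h -` swept N 1 {0..1} \<sigma>)" unfolding eq by (intro compact_UN finite_grid compact_cball)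
    hence "emeasure lborel (Pair h -` swept N 1 {0..1} \<sigma>) = emeasure lebesgue (Pair h -` swept N 1 {0..1} \<sigma>)"
      by (simp add: borel_compact)
    thus ?thesis using lmeasurable_compact[OF c] by (simp add: emeasure_eq_measure2)
  qed
  have deriv: "((\<lambda>h. K / N * ln (1 + N * h)) has_real_derivative K / (1 + N * h)) (at h)" if "0 \<le> h" for h :: real
  proof -
    have p: "0 < 1 + real N * h" using that by (simp add: add_pos_nonneg)
    have d: "((\<lambda>h. K / N * ln (1 + N * h)) has_real_derivative K / N * (inverse (1 + N * h) * N)) (at h)"
      by (rule derivative_eq_intros refl p | simp add: divide_inverse)+
    show ?thesis by (rule DERIV_cong[OF d]) (use N p in \<open>simp add: divide_simps\<close>)
  qed
  have "(\<integral>\<^sup>+h. ennreal (K / (1 + N * h)) * indicator {0..1} h \<partial>lborel) = K / N * ln (1 + real N * 1) - K / N * ln (1 + real N * 0)"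
    by (rule nn_integral_FTC_Icc) (use deriv K in \<open>auto intro!: divide_nonneg_nonneg\<close>)
  also have "K / N * ln (1 + real N * 1) - K / N * ln (1 + real N * 0) =
      card (sticky_maps N) * (unit_ball_vol CARD('d) * ln (1 + real N) / (overlap_const * N))" by (simp add: K_def)
  finally have "ennreal (card (sticky_maps N) * (unit_ball_vol CARD('d) * ln (1 + real N) / (overlap_const * N))) =
      (\<integral>\<^sup>+h. ennreal (K / (1 + N * h)) * indicator {0..1} h \<partial>lborel)" by simp
  also have "\<dots> \<le> (\<integral>\<^sup>+h. (\<Sum>\<sigma>\<in>sticky_maps N. emeasure lborel (Pair h -` swept N 1 {0..1} \<sigma>)) \<partial>lborel)"
  proof (rule nn_integral_mono)
    fix h :: real
    show "ennreal (K / (1 + N * h)) * indicator {0..1} h \<le> (\<Sum>\<sigma>\<in>sticky_maps N. emeasure lborel (Pair h -` swept N 1 {0..1} \<sigma>))"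
    proof (cases "h \<in> {0..1}")
      case True
      have "K / (1 + N * h) = card (sticky_maps N) * (unit_ball_vol CARD('d) / (overlap_const * (1 + N * h)))" by (simp add: K_def)
      hence "ennreal (K / (1 + N * h)) \<le> ennreal (\<Sum>\<sigma>\<in>sticky_maps N. measure lebesgue (Pair h -` swept N 1 {0..1} \<sigma>))"
        using sum_slice_ge[OF True, of N] by (intro ennreal_leI) simp
      also have "\<dots> = (\<Sum>\<sigma>\<in>sticky_maps N. emeasure lborel (Pair h -` swept N 1 {0..1} \<sigma>))"
        using True by (simp add: slice_meas sum_ennreal)
      finally show ?thesis using True by simp
    qed simp
  qed
  also have "\<dots> = (\<Sum>\<sigma>\<in>sticky_maps N. \<integral>\<^sup>+h. emeasure lborel (Pair h -` swept N 1 {0..1} \<sigma>) \<partial>lborel)"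
    by (rule nn_integral_sum) (rule lborel.measurable_emeasure_Pair[OF sets])
  also have "\<dots> = (\<Sum>\<sigma>\<in>sticky_maps N. emeasure lborel (swept N 1 {0..1} \<sigma>))"
    using lborel.emeasure_pair_measure_alt[OF sets] by (simp add: lborel_prod)
  finally show ?thesis .
qed

lemma sum_emeasure_high_le:
  assumes \<rho>: "0 \<le> \<rho>" and H: "real CARD('d) + 2 * \<rho> < c * (H - 1)"
  obtains K where "0 \<le> K"
    "\<And>N. (\<Sum>\<sigma>\<in>sticky_maps N. emeasure lborel (swept N \<rho> {H - 1..H + 1} \<sigma>)) \<le> ennreal (card (sticky_maps N) * (K / (real N + 1)))"
proof -
  have H1: "1 < H" using \<rho> H c0 by (smt (verit) of_nat_0_le_iff zero_less_mult_pos)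
  obtain b :: nat where b: "2 * \<rho> + (H + 1) * C + 1 \<le> b" using real_arch_simple by blast
  define R where "R = CARD('d) + (H + 1) * CARD('d) + \<rho>"
  define box where "box = {H - 1..H + 1} \<times> cball (0 :: real ^ 'd) R"
  have box: "box \<in> sets lborel" by (simp add: box_def borel_closed closed_Times)
  have fin: "emeasure lborel box < \<infinity>"
    by (rule emeasure_bounded_finite) (simp add: box_def bounded_Times)
  define B where "B = 8 * real ((2 * b + 1) ^ CARD('d))"
  have sub: "swept N \<rho> {H - 1..H + 1} \<sigma> \<subseteq> box" if s: "\<sigma> \<in> sticky_maps N" for N \<sigma>
  proof (clarsimp simp: swept_def box_def)
    fix h y z assume h: "H - 1 \<le> h" "h \<le> H + 1" and z: "z \<in> grid N" and hit: "hit N \<rho> h y z (\<sigma> z)"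
    have "norm y \<le> norm (y - (pos N z + h *\<^sub>R g N (\<sigma> z))) + norm (pos N z + h *\<^sub>R g N (\<sigma> z))"
      by (metis add.commute norm_triangle_sub)
    also have "norm (pos N z + h *\<^sub>R g N (\<sigma> z)) \<le> norm (pos N z) + h * norm (g N (\<sigma> z))"
      using norm_triangle_ineq[of "pos N z" "h *\<^sub>R g N (\<sigma> z)"] h H1 by simp
    also have "h * norm (g N (\<sigma> z)) \<le> (H + 1) * CARD('d)"
      using h H1 norm_slope_le[OF sticky_maps_in_J[OF s z]] by (intro mult_mono) auto
    also have "norm (pos N z) \<le> CARD('d)" by (rule norm_pos_le[OF z])
    also have "norm (y - (pos N z + h *\<^sub>R g N (\<sigma> z))) \<le> \<rho>"
    proof -
      have "1 \<le> real M ^ N" using M2 by simp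
      hence "\<rho> / real M ^ N \<le> \<rho> / 1" using \<rho> M2 by (intro divide_left_mono) auto
      thus ?thesis using hit by (simp add: hit_def)
    qed
    finally show "norm y \<le> R" by (simp add: R_def)
  qed
  show ?thesis
  proof (rule that)
    show "0 \<le> B * measure lborel box" by (simp add: B_def)
    fix N
    have sets: "swept N \<rho> {H - 1..H + 1} \<sigma> \<in> sets lborel" for \<sigma> by (simp add: closed_swept)
    have "(\<Sum>\<sigma>\<in>sticky_maps N. emeasure lborel (swept N \<rho> {H - 1..H + 1} \<sigma>)) =
      (\<Sum>\<sigma>\<in>sticky_maps N. \<integral>\<^sup>+p. indicator (swept N \<rho> {H - 1..H + 1} \<sigma>) p \<partial>lborel)"
      using sets by simp
    also have "\<dots> = (\<integral>\<^sup>+p. (\<Sum>\<sigma>\<in>sticky_maps N. indicator (swept N \<rho> {H - 1..H + 1} \<sigma>) p) \<partial>lborel)"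
      by (rule nn_integral_sum[symmetric]) (use sets in auto)
    also have "\<dots> \<le> (\<integral>\<^sup>+p. ennreal (card (sticky_maps N) * (B / (real N + 1))) * indicator box p \<partial>lborel)"
    proof (rule nn_integral_mono)
      fix p :: "real \<times> (real ^ 'd)"
      have "(\<Sum>\<sigma>\<in>sticky_maps N. indicator (swept N \<rho> {H - 1..H + 1} \<sigma>) p) =
          ennreal (card {\<sigma>\<in>sticky_maps N. p \<in> swept N \<rho> {H - 1..H + 1} \<sigma>})"
        by (simp add: indicator_def sum.If_cases finite_sticky_maps Int_def ennreal_of_nat_eq_real_of_nat)
      also have "\<dots> \<le> ennreal (card (sticky_maps N) * (B / (real N + 1))) * indicator box p"
      proof (cases "p \<in> box")
        case True
        obtain h y where p: "p = (h, y)" by force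
        have h: "H - 1 \<le> h" "h \<le> H + 1" using True by (auto simp: p box_def)
        have "c * (H - 1) \<le> c * h" using h c0 by simp
        hence "real CARD('d) + 2 * \<rho> < c * h" using H by linarith
        hence "card {\<sigma> \<in> sticky_maps N. \<exists>z\<in>grid N. hit N \<rho> h y z (\<sigma> z)} \<le> card (sticky_maps N) * (B / (real N + 1))"
          unfolding B_def using h b \<rho> by (intro card_sticky_hitting) auto
        moreover have "{\<sigma>\<in>sticky_maps N. p \<in> swept N \<rho> {H - 1..H + 1} \<sigma>} = {\<sigma> \<in> sticky_maps N. \<exists>z\<in>grid N. hit N \<rho> h y z (\<sigma> z)}"
          using h by (auto simp: p swept_def)
        ultimately show ?thesis using True by (simp add: ennreal_leI add.commute)
      next
        case False
        hence "{\<sigma>\<in>sticky_maps N. p \<in> swept N \<rho> {H - 1..H + 1} \<sigma>} = {}" using sub by blast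
        thus ?thesis by (simp only: card.empty) simp
      qed
      finally show "(\<Sum>\<sigma>\<in>sticky_maps N. indicator (swept N \<rho> {H - 1..H + 1} \<sigma>) p) \<le>
        ennreal (card (sticky_maps N) * (B / (real N + 1))) * indicator box p" .
    qed
    also have "\<dots> = ennreal (card (sticky_maps N) * (B / (real N + 1))) * emeasure lborel box"
      using box by (simp add: nn_integral_cmult)
    also have "\<dots> = ennreal (card (sticky_maps N) * (B / (real N + 1))) * ennreal (measure lborel box)"
      using fin by (simp add: emeasure_eq_ennreal_measure)
    also have "\<dots> = ennreal (card (sticky_maps N) * (B * measure lborel box / (real N + 1)))"
      by (subst ennreal_mult[symmetric]) (auto simp: B_def)
    finally show "(\<Sum>\<sigma>\<in>sticky_maps N. emeasure lborel (swept N \<rho> {H - 1..H + 1} \<sigma>)) \<le>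
      ennreal (card (sticky_maps N) * (B * measure lborel box / (real N + 1)))" .
  qed
qed

text \<open>
  Summed over all sticky maps, the low parts exceed the high parts by a factor of order \<open>ln N\<close>.
\<close>

lemma exists_concentrating_sticky_map:
  assumes \<rho>: "0 \<le> \<rho>" and H: "real CARD('d) + 2 * \<rho> < c * (H - 1)" and \<Lambda>: "0 < \<Lambda>"
  obtains N0 where "\<And>N. N0 \<le> N \<Longrightarrow> \<exists>\<sigma>\<in>sticky_maps N.
    ennreal \<Lambda> * emeasure lborel (swept N \<rho> {H - 1..H + 1} \<sigma>) < emeasure lborel (swept N 1 {0..1} \<sigma>)"
proof -
  obtain K where K: "0 \<le> K"
    "\<And>N. (\<Sum>\<sigma>\<in>sticky_maps N. emeasure lborel (swept N \<rho> {H - 1..H + 1} \<sigma>)) \<le> ennreal (card (sticky_maps N) * (K / (real N + 1)))"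
    using sum_emeasure_high_le[OF \<rho> H] by blast
  define v where "v = unit_ball_vol CARD('d)"
  have v: "0 < v" by (simp add: v_def)
  define Q where "Q = \<Lambda> * K * overlap_const / v"
  obtain N0 :: nat where N0: "exp Q \<le> N0" using real_arch_simple by blast
  show ?thesis
  proof (rule that[of "Suc N0"], rule ccontr)
    fix N assume N: "Suc N0 \<le> N"
      and no: "\<not> (\<exists>\<sigma>\<in>sticky_maps N. ennreal \<Lambda> * emeasure lborel (swept N \<rho> {H - 1..H + 1} \<sigma>) < emeasure lborel (swept N 1 {0..1} \<sigma>))"
    have "ennreal (card (sticky_maps N) * (v * ln (1 + real N) / (overlap_const * N))) \<le> (\<Sum>\<sigma>\<in>sticky_maps N. emeasure lborel (swept N 1 {0..1} \<sigma>))"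
      unfolding v_def by (rule sum_emeasure_low_ge) (use N in simp)
    also have "\<dots> \<le> (\<Sum>\<sigma>\<in>sticky_maps N. ennreal \<Lambda> * emeasure lborel (swept N \<rho> {H - 1..H + 1} \<sigma>))"
      by (rule sum_mono) (use no in \<open>auto simp: not_less\<close>)
    also have "\<dots> = ennreal \<Lambda> * (\<Sum>\<sigma>\<in>sticky_maps N. emeasure lborel (swept N \<rho> {H - 1..H + 1} \<sigma>))"
      by (simp add: sum_distrib_left)
    also have "\<dots> \<le> ennreal \<Lambda> * ennreal (card (sticky_maps N) * (K / (real N + 1)))"
      by (rule mult_left_mono[OF K(2)]) simp
    also have "\<dots> = ennreal (\<Lambda> * (card (sticky_maps N) * (K / (real N + 1))))"
      using \<Lambda> K by (subst ennreal_mult) auto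
    finally have "card (sticky_maps N) * (v * ln (1 + real N) / (overlap_const * N)) \<le> \<Lambda> * (card (sticky_maps N) * (K / (real N + 1)))"
      using \<Lambda> K by (subst (asm) ennreal_le_iff) auto
    hence "card (sticky_maps N) * (v * ln (1 + real N) / (overlap_const * N)) \<le> card (sticky_maps N) * (\<Lambda> * (K / (real N + 1)))"
      by (simp only: mult.left_commute)
    hence "v * ln (1 + real N) / (overlap_const * N) \<le> \<Lambda> * (K / (real N + 1))"
      using card_sticky_maps_pos[of N] by (simp only: mult_le_cancel_left_pos of_nat_0_less_iff)
    also have "\<dots> \<le> \<Lambda> * (K / N)" using \<Lambda> K N by (intro mult_left_mono divide_left_mono) auto
    finally have "v * ln (1 + real N) \<le> \<Lambda> * K * overlap_const"
      using N overlap_const_pos by (simp add: field_simps)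
    hence "ln (1 + real N) \<le> Q" using v by (simp add: Q_def field_simps)
    hence "exp (ln (1 + real N)) \<le> exp Q" by (simp only: exp_le_cancel_iff)
    thus False using N0 N by simp
  qed
qed

end


section \<open>Tubes and their maximal averages\<close>

lemma orthogonal_split:
  fixes w \<omega> :: "'a::euclidean_space"
  assumes "\<omega> \<noteq> 0"
  shows "(w - (w \<bullet> sgn \<omega>) *\<^sub>R sgn \<omega>) \<bullet> \<omega> = 0" "\<bar>w \<bullet> sgn \<omega>\<bar> \<le> norm w"
    "norm (w - (w \<bullet> sgn \<omega>) *\<^sub>R sgn \<omega>) \<le> norm w"
proof -
  have n: "norm (sgn \<omega>) = 1" "sgn \<omega> \<bullet> sgn \<omega> = 1" using assms by (auto simp: norm_sgn dot_square_norm)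
  have o: "norm \<omega> *\<^sub>R sgn \<omega> = \<omega>" using assms by (simp add: sgn_div_norm)
  have "(w - (w \<bullet> sgn \<omega>) *\<^sub>R sgn \<omega>) \<bullet> sgn \<omega> = 0" using n by (simp add: inner_diff_left)
  thus "(w - (w \<bullet> sgn \<omega>) *\<^sub>R sgn \<omega>) \<bullet> \<omega> = 0" by (metis o inner_scaleR_right mult_zero_right)
  show "\<bar>w \<bullet> sgn \<omega>\<bar> \<le> norm w" using Cauchy_Schwarz_ineq2[of w "sgn \<omega>"] n by simp
  have "(norm (w - (w \<bullet> sgn \<omega>) *\<^sub>R sgn \<omega>))\<^sup>2 = (norm w)\<^sup>2 - (w \<bullet> sgn \<omega>)\<^sup>2"
    unfolding power2_norm_eq_inner
    by (simp only: inner_diff_left inner_diff_right inner_scaleR_left inner_scaleR_right n(2) inner_commute[of "sgn \<omega>" w])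
      (simp add: power2_eq_square)
  also have "\<dots> \<le> (norm w)\<^sup>2" by simp
  finally show "norm (w - (w \<bullet> sgn \<omega>) *\<^sub>R sgn \<omega>) \<le> norm w" by (rule power2_le_imp_le) simp
qed

lemma tubeI:
  "y = x + s *\<^sub>R sgn \<omega> + v \<Longrightarrow> \<bar>s\<bar> \<le> l / 2 \<Longrightarrow> v \<bullet> \<omega> = 0 \<Longrightarrow> norm v \<le> r \<Longrightarrow> y \<in> tube x \<omega> l r"
  unfolding tube_def by blast

lemma compact_tube: "compact (tube x \<omega> l r)"
proof -
  have "tube x \<omega> l r = (\<lambda>p. x + fst p *\<^sub>R sgn \<omega> + snd p) ` ({- (l / 2)..l / 2} \<times> ({v. v \<bullet> \<omega> = 0} \<inter> cball 0 r))"
  proof (rule set_eqI, rule iffI)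
    fix y assume "y \<in> tube x \<omega> l r"
    then obtain s v where "y = x + s *\<^sub>R sgn \<omega> + v" "\<bar>s\<bar> \<le> l / 2" "v \<bullet> \<omega> = 0" "norm v \<le> r"
      unfolding tube_def by blast
    thus "y \<in> (\<lambda>p. x + fst p *\<^sub>R sgn \<omega> + snd p) ` ({- (l / 2)..l / 2} \<times> ({v. v \<bullet> \<omega> = 0} \<inter> cball 0 r))"
      by (intro image_eqI[of _ _ "(s, v)"]) (auto simp: abs_le_iff)
  qed (auto intro!: tubeI simp: abs_le_iff)
  also have "compact \<dots>"
    by (intro compact_continuous_image compact_Times closed_Int_compact closed_Collect_eq compact_cball)
      (auto intro!: continuous_intros)
  finally show ?thesis .
qed

lemma tube_measure_pos:
  assumes "\<omega> \<noteq> 0" "0 < l" "0 < r"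
  shows "0 < emeasure lebesgue (tube x \<omega> l r)"
proof -
  have "ball x (min r (l / 2)) \<subseteq> tube x \<omega> l r"
  proof
    fix y assume "y \<in> ball x (min r (l / 2))"
    hence "norm (y - x) < min r (l / 2)" by (simp add: dist_norm norm_minus_commute)
    thus "y \<in> tube x \<omega> l r"
      using orthogonal_split[OF assms(1), of "y - x"]
      by (intro tubeI[where s = "(y - x) \<bullet> sgn \<omega>" and v = "y - x - ((y - x) \<bullet> sgn \<omega>) *\<^sub>R sgn \<omega>"]) auto
  qed
  hence "emeasure lebesgue (ball x (min r (l / 2))) \<le> emeasure lebesgue (tube x \<omega> l r)"
    by (intro emeasure_mono) (auto simp: compact_tube borel_compact)
  moreover have "unit_ball_vol (real DIM('a)) \<noteq> 0"
    using unit_ball_vol_pos[of "real DIM('a)", OF of_nat_0_le_iff] by (rule less_imp_neq[symmetric])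
  hence "emeasure lebesgue (ball x (min r (l / 2))) \<noteq> 0"
    using assms by (auto simp: emeasure_ball min_def)
  ultimately show ?thesis by (metis le_zero_eq zero_less_iff_neq_zero)
qed

lemma tube_measure_finite: "emeasure lebesgue (tube x \<omega> l r) < \<infinity>"
  using lmeasurable_compact[OF compact_tube] by (auto simp: fmeasurable_def)

lemma tube_translate: "tube (x + a) \<omega> l r = (\<lambda>y. 1 *\<^sub>R y + a) ` tube x \<omega> l r"
proof (rule set_eqI, rule iffI)
  fix y assume "y \<in> tube (x + a) \<omega> l r"
  then obtain s v where "y = x + a + s *\<^sub>R sgn \<omega> + v" "\<bar>s\<bar> \<le> l / 2" "v \<bullet> \<omega> = 0" "norm v \<le> r"
    unfolding tube_def by blast
  thus "y \<in> (\<lambda>y. 1 *\<^sub>R y + a) ` tube x \<omega> l r"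
    by (intro image_eqI[of _ _ "x + s *\<^sub>R sgn \<omega> + v"] tubeI) simp_all
next
  fix y assume "y \<in> (\<lambda>y. 1 *\<^sub>R y + a) ` tube x \<omega> l r"
  then obtain s v where "y = x + s *\<^sub>R sgn \<omega> + v + a" "\<bar>s\<bar> \<le> l / 2" "v \<bullet> \<omega> = 0" "norm v \<le> r"
    unfolding tube_def by force
  thus "y \<in> tube (x + a) \<omega> l r" by (intro tubeI[where s = s and v = v]) simp_all
qed

text \<open>
  A tube of length \<open>n\<close> is covered by \<open>n\<close> translates of the tube of length one.
\<close>

lemma tube_measure_le:
  fixes x :: "'a::euclidean_space"
  assumes n: "1 \<le> n"
  shows "emeasure lebesgue (tube x \<omega> (real n) r) \<le> of_nat n * emeasure lebesgue (tube x \<omega> 1 r)"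
proof -
  define a where "a = (\<lambda>i::nat. (real i + 1 / 2 - real n / 2) *\<^sub>R sgn \<omega>)"
  have "tube x \<omega> (real n) r \<subseteq> (\<Union>i<n. tube (x + a i) \<omega> 1 r)"
  proof
    fix y assume "y \<in> tube x \<omega> (real n) r"
    then obtain s v where y: "y = x + s *\<^sub>R sgn \<omega> + v" "\<bar>s\<bar> \<le> real n / 2" "v \<bullet> \<omega> = 0" "norm v \<le> r"
      unfolding tube_def by blast
    \<comment> \<open>The minimum is attained by its second argument only at the far end of the tube.\<close>
    define i where "i = min (nat \<lfloor>s + real n / 2\<rfloor>) (n - 1)"
    have s: "0 \<le> s + real n / 2" "s + real n / 2 \<le> n" using y(2) by (auto simp: abs_le_iff)
    have i: "i < n" using n by (simp add: i_def)
    have "\<bar>s - (real i + 1 / 2 - real n / 2)\<bar> \<le> 1 / 2"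
    proof (cases "nat \<lfloor>s + real n / 2\<rfloor> \<le> n - 1")
      case True
      hence "real i = of_int \<lfloor>s + real n / 2\<rfloor>" using s by (simp add: i_def)
      thus ?thesis using floor_correct[of "s + real n / 2"] unfolding abs_le_iff by linarith
    next
      case False
      hence "real i = real n - 1" "real n \<le> s + real n / 2"
        using n s by (auto simp: i_def) linarith+
      thus ?thesis using s by (simp add: abs_le_iff)
    qed
    moreover have "y = (x + a i) + (s - (real i + 1 / 2 - real n / 2)) *\<^sub>R sgn \<omega> + v"
      by (simp add: y a_def algebra_simps)
    ultimately have "y \<in> tube (x + a i) \<omega> 1 r" using y by (intro tubeI) auto
    thus "y \<in> (\<Union>i<n. tube (x + a i) \<omega> 1 r)" using i by blast
  qed
  hence "emeasure lebesgue (tube x \<omega> (real n) r) \<le> emeasure lebesgue (\<Union>i<n. tube (x + a i) \<omega> 1 r)"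
    by (intro emeasure_mono) (auto simp: compact_tube borel_compact)
  also have "\<dots> \<le> (\<Sum>i<n. emeasure lebesgue (tube (x + a i) \<omega> 1 r))"
    by (intro emeasure_subadditive_finite) (auto simp: compact_tube borel_compact)
  also have "\<dots> = (\<Sum>i<n. emeasure lebesgue (tube x \<omega> 1 r))"
    unfolding tube_translate emeasure_lebesgue_affine by simp
  finally show ?thesis by simp
qed

lemma compact_tube_union: "finite P \<Longrightarrow> compact (tube_union P l r)"
  unfolding tube_union_def by (intro compact_UN) (auto simp: compact_tube)

text \<open>
  Kakeya-type sets with two additions that the maximal operators need: the collections are finite, so
  that the unions are compact, and the factor \<open>n\<close> is an integer, so that tubes can be divided evenly.
\<close>

definition concentrating_tubes :: "'a::euclidean_space set \<Rightarrow> nat \<Rightarrow> bool" where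
  "concentrating_tubes \<Omega> n \<longleftrightarrow> (\<forall>\<Lambda>>0. \<forall>\<epsilon>>0. \<exists>\<delta> P. 0 < \<delta> \<and> \<delta> < \<epsilon> \<and> finite P \<and> (\<forall>(x, \<omega>)\<in>P. \<omega> \<in> \<Omega>) \<and>
     ennreal \<Lambda> * emeasure lebesgue (tube_union P 1 \<delta>) < emeasure lebesgue (tube_union P (real n) \<delta>))"

lemma concentrating_imp_kakeya:
  assumes c: "compact \<Omega>" and n: "1 \<le> n" and T: "concentrating_tubes \<Omega> n"
  shows "admits_kakeya_type_sets \<Omega>"
proof -
  have "\<exists>\<delta> P. 0 < \<delta> \<and> \<delta> < 1 / (real N + 1) \<and> finite P \<and> (\<forall>(x, \<omega>)\<in>P. \<omega> \<in> \<Omega>) \<and>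
     ennreal (real N + 1) * emeasure lebesgue (tube_union P 1 \<delta>) < emeasure lebesgue (tube_union P (real n) \<delta>)" for N
  proof -
    have "0 < real N + 1" "0 < 1 / (real N + 1)" by simp_all
    thus ?thesis using T unfolding concentrating_tubes_def by blast
  qed
  then obtain \<delta> P where *: "\<And>N. 0 < \<delta> N \<and> \<delta> N < 1 / (real N + 1) \<and> finite (P N) \<and> (\<forall>(x, \<omega>)\<in>P N. \<omega> \<in> \<Omega>) \<and>
     ennreal (real N + 1) * emeasure lebesgue (tube_union (P N) 1 (\<delta> N)) < emeasure lebesgue (tube_union (P N) (real n) (\<delta> N))"
    by metis
  have d: "\<delta> \<longlonglongrightarrow> 0"
  proof (rule tendsto_sandwich)
    show "\<forall>\<^sub>F N in sequentially. 0 \<le> \<delta> N" "\<forall>\<^sub>F N in sequentially. \<delta> N \<le> 1 / (real N + 1)"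
      using * by (auto intro!: always_eventually less_imp_le)
    show "(\<lambda>N. 1 / (real N + 1)) \<longlonglongrightarrow> 0" using LIMSEQ_inverse_real_of_nat by (simp add: inverse_eq_divide add.commute)
  qed simp
  have ge: "of_nat N \<le> emeasure lebesgue (tube_union (P N) (real n) (\<delta> N)) / emeasure lebesgue (tube_union (P N) 1 (\<delta> N))" for N
  proof -
    define e where "e = emeasure lebesgue (tube_union (P N) 1 (\<delta> N))"
    define e' where "e' = emeasure lebesgue (tube_union (P N) (real n) (\<delta> N))"
    have lt: "ennreal (real N + 1) * e < e'" using * by (simp add: e_def e'_def)
    have fP: "finite (P N)" using * by blast
    have fin: "e \<noteq> \<infinity>" unfolding e_def infinity_ennreal_def
      by (rule fmeasurableD2[OF lmeasurable_compact[OF compact_tube_union[OF fP]]])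
    have "of_nat N \<le> e' / e"
    proof (cases "e = 0")
      case True
      thus ?thesis using lt by (simp add: ennreal_divide_zero[THEN sym] divide_ennreal_def zero_less_iff_neq_zero)
    next
      case False
      have "of_nat N \<le> ennreal (real N + 1)" by (simp add: ennreal_of_nat_eq_real_of_nat ennreal_leI)
      also have "\<dots> = ennreal (real N + 1) * e / e" using False fin by (simp add: ennreal_mult_divide_eq)
      also have "\<dots> \<le> e' / e" using lt by (intro divide_right_mono_ennreal) simp
      finally show ?thesis .
    qed
    thus ?thesis by (simp add: e_def e'_def)
  qed
  have "(\<lambda>N. emeasure lebesgue (tube_union (P N) (real n) (\<delta> N)) / emeasure lebesgue (tube_union (P N) 1 (\<delta> N))) \<longlonglongrightarrow> \<infinity>"
    by (rule tendsto_sandwich[OF always_eventually always_eventually of_nat_tendsto_top_ennreal[folded infinity_ennreal_def] tendsto_const])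
      (use ge in auto)
  moreover have "\<forall>N\<ge>1. 0 < \<delta> N \<and> (\<forall>(x, \<omega>)\<in>P N. \<omega> \<in> \<Omega>)" using * by blast
  moreover have "1 \<le> real n" using n by simp
  ultimately show ?thesis unfolding admits_kakeya_type_sets_def using c d by blast
qed

lemma ennpowr_mono: "x \<le> y \<Longrightarrow> 0 \<le> p \<Longrightarrow> ennpowr x p \<le> ennpowr y p"
  by (cases x; cases y) (auto simp: ennpowr_def powr_mono2 ennreal_leI top_unique)

lemma ennpowr_ennreal: "0 \<le> x \<Longrightarrow> ennpowr (ennreal x) p = ennreal (x powr p)"
  by (simp add: ennpowr_def)

lemma Lp_norm_indicator:
  assumes "1 \<le> p" "E \<in> sets lebesgue"
  shows "Lp_norm p (\<lambda>x. ennreal (cmod (indicator E x))) = ennpowr (emeasure lebesgue E) (1 / p)"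
proof -
  have "ennpowr (ennreal (cmod (indicator E x))) p = indicator E x" for x :: 'a
    using assms(1) by (auto simp: indicator_def ennpowr_def)
  thus ?thesis using assms(2) by (simp add: Lp_norm_def)
qed

text \<open>
  If \<open>T\<close> is at least \<open>\<kappa>\<close> on \<open>F\<close>, a bound \<open>A\<close> for its norm gives
  \<open>\<kappa>\<^sup>p |F| \<le> A\<^sup>p |E|\<close>, so the ratio of measures is at most \<open>(A / \<kappa>)\<^sup>p\<close>.
\<close>

lemma unbounded_on_LpI:
  fixes T :: "('a::euclidean_space \<Rightarrow> complex) \<Rightarrow> 'a \<Rightarrow> ennreal"
  assumes p: "1 \<le> p" and \<kappa>: "0 < \<kappa>"
    and sets: "\<And>\<Lambda>. 0 < \<Lambda> \<Longrightarrow> \<exists>E F. E \<in> lmeasurable \<and> F \<in> lmeasurable \<and> adm (indicator E) \<and>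
      ennreal \<Lambda> * emeasure lebesgue E < emeasure lebesgue F \<and> (\<forall>x\<in>F. ennreal \<kappa> \<le> T (indicator E) x)"
  shows "unbounded_on_Lp adm T p"
  unfolding unbounded_on_Lp_def
proof (rule notI, elim exE conjE)
  fix A :: real assume A: "0 \<le> A"
    and bound: "\<forall>f. adm f \<and> in_Lp p f \<longrightarrow> Lp_norm p (T f) \<le> ennreal A * Lp_norm p (\<lambda>x. ennreal (cmod (f x)))"
  define \<Lambda> where "\<Lambda> = (A / \<kappa>) powr p + 1"
  have "0 < \<Lambda>" by (simp add: \<Lambda>_def add_nonneg_pos)
  then obtain E F where EF: "E \<in> lmeasurable" "F \<in> lmeasurable" "adm (indicator E)"
    "ennreal \<Lambda> * emeasure lebesgue E < emeasure lebesgue F" "\<And>x. x \<in> F \<Longrightarrow> ennreal \<kappa> \<le> T (indicator E) x"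
    using sets[OF \<open>0 < \<Lambda>\<close>] by blast
  define e f where "e = measure lebesgue E" and "f = measure lebesgue F"
  have e: "emeasure lebesgue E = ennreal e" and f: "emeasure lebesgue F = ennreal f"
    unfolding e_def f_def by (rule emeasure_eq_measure2[OF EF(1)] emeasure_eq_measure2[OF EF(2)])+
  have ef0: "0 \<le> e" "0 \<le> f" by (simp_all add: e_def f_def)
  have setsE: "E \<in> sets lebesgue" "F \<in> sets lebesgue" using EF(1,2) by (blast dest: fmeasurableD)+
  have norm_E: "Lp_norm p (\<lambda>x. ennreal (cmod (indicator E x))) = ennreal (e powr (1 / p))"
    using Lp_norm_indicator[OF p setsE(1)] e ef0 by (simp add: ennpowr_ennreal)
  have "in_Lp p (indicator E)"
    using norm_E setsE by (simp add: in_Lp_def borel_measurable_indicator)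
  hence "Lp_norm p (T (indicator E)) \<le> ennreal A * ennreal (e powr (1 / p))"
    using bound EF(3) norm_E by metis
  moreover have "ennreal ((\<kappa> powr p * f) powr (1 / p)) \<le> Lp_norm p (T (indicator E))"
  proof -
    have "ennreal (\<kappa> powr p * f) = (\<integral>\<^sup>+x. ennreal (\<kappa> powr p) * indicator F x \<partial>lebesgue)"
      using setsE f ef0 by (simp add: nn_integral_cmult ennreal_mult)
    also have "\<dots> \<le> (\<integral>\<^sup>+x. ennpowr (T (indicator E) x) p \<partial>lebesgue)"
    proof (rule nn_integral_mono)
      fix x
      show "ennreal (\<kappa> powr p) * indicator F x \<le> ennpowr (T (indicator E) x) p"
        using ennpowr_mono[OF EF(5), of x p] p \<kappa> by (cases "x \<in> F") (auto simp: ennpowr_ennreal)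
    qed
    finally show ?thesis
      unfolding Lp_norm_def using p ef0 by (subst ennpowr_ennreal[symmetric]) (auto intro: ennpowr_mono)
  qed
  ultimately have "ennreal ((\<kappa> powr p * f) powr (1 / p)) \<le> ennreal (A * e powr (1 / p))"
    using A by (metis ennreal_mult order_trans powr_ge_zero)
  hence "(\<kappa> powr p * f) powr (1 / p) \<le> A * e powr (1 / p)"
    using A by (simp add: ennreal_le_iff)
  hence "((\<kappa> powr p * f) powr (1 / p)) powr p \<le> (A * e powr (1 / p)) powr p"
    using p by (intro powr_mono2) auto
  hence "\<kappa> powr p * f \<le> A powr p * e"
    using p A ef0 \<kappa> by (simp add: powr_powr powr_mult)
  hence "f \<le> (A / \<kappa>) powr p * e"
    using \<kappa> A by (simp add: powr_divide field_simps)
  also have "\<dots> \<le> \<Lambda> * e" using ef0 by (simp add: \<Lambda>_def distrib_right)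
  finally show False
    using EF(4) \<open>0 < \<Lambda>\<close> ef0 by (simp add: e f ennreal_mult[symmetric] ennreal_less_iff)
qed

lemma absolutely_integrable_indicator:
  assumes "S \<inter> K \<in> lmeasurable"
  shows "(\<lambda>x. indicator S x :: complex) absolutely_integrable_on K"
proof -
  have "integrable lebesgue (\<lambda>x. complex_of_real (indicat_real (S \<inter> K) x))"
    using assms by (intro integrable_of_real) (auto simp: fmeasurable_def)
  also have "(\<lambda>x. complex_of_real (indicat_real (S \<inter> K) x)) = (\<lambda>x. indicat_real K x *\<^sub>R indicator S x)"
    by (auto simp: indicator_def)
  finally show ?thesis unfolding set_integrable_def .
qed

lemma locally_integrable_indicator: "closed E \<Longrightarrow> locally_integrable (indicator E)"
  unfolding locally_integrable_def
  by (auto intro!: absolutely_integrable_indicator lmeasurable_compact closed_Int_compact)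

lemma locally_integrable_along_lines_indicator:
  assumes "closed E"
  shows "locally_integrable_along_lines (indicator E)"
  unfolding locally_integrable_along_lines_def
proof (intro allI impI)
  fix x u :: 'a and a b :: real
  have "closed ((\<lambda>t. x + t *\<^sub>R u) -` E)"
    by (intro closed_vimage assms continuous_intros)
  hence "(\<lambda>t. indicator ((\<lambda>t. x + t *\<^sub>R u) -` E) t :: complex) absolutely_integrable_on {a..b}"
    by (intro absolutely_integrable_indicator lmeasurable_compact closed_Int_compact) auto
  thus "(\<lambda>t. indicator E (x + t *\<^sub>R u) :: complex) absolutely_integrable_on {a..b}"
    by (simp add: indicator_def vimage_def)
qed

text \<open>
  The line through \<open>x\<close> parallel to the axis stays in the long tube and crosses the short one in a segment
  of length one, that is, for a set of parameters \<open>t\<close> of measure \<open>1 / norm \<omega>\<close>.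
\<close>

lemma directional_maximal_ge:
  fixes P :: "('a::euclidean_space \<times> 'a) set"
  assumes n: "1 \<le> n" and \<omega>: "\<And>\<omega>. \<omega> \<in> \<Omega> \<Longrightarrow> 1 \<le> norm \<omega> \<and> norm \<omega> \<le> R"
    and P: "\<forall>(x, \<omega>)\<in>P. \<omega> \<in> \<Omega>" and x: "x \<in> tube_union P (real n) \<delta>"
  shows "ennreal (1 / (2 * R * n)) \<le> directional_maximal \<Omega> (indicator (tube_union P 1 \<delta>)) x"
proof -
  obtain z \<omega> where z: "(z, \<omega>) \<in> P" "x \<in> tube z \<omega> (real n) \<delta>" using x by (auto simp: tube_union_def)
  then obtain s v where s: "x = z + s *\<^sub>R sgn \<omega> + v" "\<bar>s\<bar> \<le> real n / 2" "v \<bullet> \<omega> = 0" "norm v \<le> \<delta>"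
    unfolding tube_def by blast
  have w: "\<omega> \<in> \<Omega>" using P z by auto
  define r where "r = norm \<omega>"
  have r: "1 \<le> r" "r \<le> R" using \<omega>[OF w] by (simp_all add: r_def)
  define a b where "a = (- s - 1 / 2) / r" and "b = (- s + 1 / 2) / r"
  have ab: "a \<le> b" "b - a = 1 / r" using r by (simp_all add: a_def b_def divide_right_mono diff_divide_distrib[symmetric])
  have sub: "{a..b} \<subseteq> {- real n..real n}"
  proof -
    have le: "y / r \<le> real n" if "y \<le> real n" for y
      using that r mult_left_mono[of 1 r "real n"] by (simp add: divide_le_eq)
    have "b \<le> real n" unfolding b_def using s(2) n by (intro le) linarith
    moreover have "- a \<le> real n"
    proof -
      have "- a = (s + 1 / 2) / r" using r by (simp add: a_def field_simps)
      thus ?thesis using s(2) n by (simp only:) (intro le, linarith)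
    qed
    ultimately show ?thesis by auto
  qed
  have E: "x + t *\<^sub>R \<omega> \<in> tube_union P 1 \<delta>" if t: "t \<in> {a..b}" for t
  proof -
    have o: "r *\<^sub>R sgn \<omega> = \<omega>" using r by (cases "\<omega> = 0") (auto simp: r_def sgn_div_norm)
    have "x + t *\<^sub>R \<omega> = z + (s + t * r) *\<^sub>R sgn \<omega> + v"
      by (simp add: s scaleR_add_left scaleR_scaleR[symmetric] o del: scaleR_scaleR)
    moreover have "\<bar>s + t * r\<bar> \<le> 1 / 2"
    proof -
      have "a * r \<le> t * r" "t * r \<le> b * r" using t r by (auto intro!: mult_right_mono)
      moreover have "a * r = - s - 1 / 2" "b * r = - s + 1 / 2" using r by (simp_all add: a_def b_def)
      ultimately show ?thesis unfolding abs_le_iff by linarith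
    qed
    ultimately have "x + t *\<^sub>R \<omega> \<in> tube z \<omega> 1 \<delta>" using s by (intro tubeI) auto
    thus ?thesis using z(1) by (auto simp: tube_union_def)
  qed
  have "ennreal (1 / R) \<le> ennreal (b - a)" using ab r by (intro ennreal_leI) (simp add: frac_le)
  also have "\<dots> = (\<integral>\<^sup>+t. indicator {a..b} t \<partial>lebesgue)" using ab by simp
  also have "\<dots> \<le> (\<integral>\<^sup>+t\<in>{- real n..real n}. ennreal (cmod (indicator (tube_union P 1 \<delta>) (x + t *\<^sub>R \<omega>))) \<partial>lebesgue)"
    by (rule nn_integral_mono) (use sub E in \<open>auto simp: indicator_def\<close>)
  finally have "ennreal (1 / R) / ennreal (2 * real n) \<le>
     (\<integral>\<^sup>+t\<in>{- real n..real n}. ennreal (cmod (indicator (tube_union P 1 \<delta>) (x + t *\<^sub>R \<omega>))) \<partial>lebesgue) / ennreal (2 * real n)"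
    by (rule divide_right_mono_ennreal)
  also have "\<dots> \<le> directional_maximal \<Omega> (indicator (tube_union P 1 \<delta>)) x"
    unfolding directional_maximal_def
    by (rule SUP_upper2[OF w], rule SUP_upper2[of "real n"]) (use n in simp_all)
  finally show ?thesis using n r by (simp add: divide_ennreal ac_simps)
qed

text \<open>
  The long tube is itself a competitor in the supremum, and the short tube is at least its \<open>n\<close>-th part.
\<close>

lemma kakeya_nikodym_maximal_ge:
  fixes P :: "('a::euclidean_space \<times> 'a) set"
  assumes n: "1 \<le> n" and \<omega>: "\<And>\<omega>. \<omega> \<in> \<Omega> \<Longrightarrow> \<omega> \<noteq> 0" and \<delta>: "0 < \<delta>" "\<delta> \<le> 1"
    and P: "\<forall>(x, \<omega>)\<in>P. \<omega> \<in> \<Omega>" and x: "x \<in> tube_union P (real n) \<delta>"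
  shows "ennreal (1 / n) \<le> kakeya_nikodym_maximal \<Omega> (indicator (tube_union P 1 \<delta>)) x"
proof -
  obtain z \<omega> where z: "(z, \<omega>) \<in> P" "x \<in> tube z \<omega> (real n) \<delta>" using x by (auto simp: tube_union_def)
  have w: "\<omega> \<in> \<Omega>" using P z by auto
  define t where "t = emeasure lebesgue (tube z \<omega> 1 \<delta>)"
  define t' where "t' = emeasure lebesgue (tube z \<omega> (real n) \<delta>)"
  have t: "0 < t" "t < \<infinity>" "t' < \<infinity>" "t' \<le> of_nat n * t"
    unfolding t_def t'_def by (rule tube_measure_pos[OF \<omega>[OF w] _ \<delta>(1)] tube_measure_finite tube_measure_le[OF n] | simp)+
  have t': "0 < t'"
    unfolding t'_def by (rule tube_measure_pos[OF \<omega>[OF w] _ \<delta>(1)]) (use n in simp)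
  have sub: "tube z \<omega> 1 \<delta> \<subseteq> tube z \<omega> (real n) \<delta>" using n by (fastforce simp: tube_def)
  have sub': "tube z \<omega> 1 \<delta> \<subseteq> tube_union P 1 \<delta>" using z(1) by (auto simp: tube_union_def)
  have "t = (\<integral>\<^sup>+y. indicator (tube z \<omega> 1 \<delta>) y \<partial>lebesgue)" by (simp add: t_def compact_tube borel_compact)
  also have "\<dots> \<le> (\<integral>\<^sup>+y\<in>tube z \<omega> (real n) \<delta>. ennreal (cmod (indicator (tube_union P 1 \<delta>) y)) \<partial>lebesgue)"
    by (rule nn_integral_mono) (use sub sub' in \<open>auto simp: indicator_def\<close>)
  finally have "t / t' \<le> (\<integral>\<^sup>+y\<in>tube z \<omega> (real n) \<delta>. ennreal (cmod (indicator (tube_union P 1 \<delta>) y)) \<partial>lebesgue) / t'"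
    by (rule divide_right_mono_ennreal)
  also have "\<dots> \<le> kakeya_nikodym_maximal \<Omega> (indicator (tube_union P 1 \<delta>)) x"
    unfolding kakeya_nikodym_maximal_def t'_def
    by (rule SUP_upper2[OF w], rule SUP_upper2[of "(z, real n, \<delta>)"]) (use z n \<delta> in simp_all)
  finally have "t / t' \<le> kakeya_nikodym_maximal \<Omega> (indicator (tube_union P 1 \<delta>)) x" .
  moreover have "ennreal (1 / n) \<le> t / t'"
  proof -
    obtain a where a: "t = ennreal a" "0 < a" using t by (cases t) auto
    obtain a' where a': "t' = ennreal a'" "0 < a'" using t t' by (cases t') auto
    have "a' \<le> n * a" using t(4) a a' n by (simp add: ennreal_of_nat_eq_real_of_nat ennreal_mult[symmetric] ennreal_le_iff)
    hence "1 / n \<le> a / a'" using a a' n by (simp add: field_simps)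
    thus ?thesis using a a' by (simp add: divide_ennreal ennreal_leI)
  qed
  ultimately show ?thesis by (rule order_trans[rotated])
qed

lemma concentrating_imp_unbounded:
  fixes \<Omega> :: "'a::euclidean_space set"
  assumes n: "1 \<le> n" and \<omega>: "\<And>\<omega>. \<omega> \<in> \<Omega> \<Longrightarrow> 1 \<le> norm \<omega> \<and> norm \<omega> \<le> R" and R: "0 < R"
    and T: "concentrating_tubes \<Omega> n" and p: "1 \<le> p"
  shows "unbounded_on_Lp locally_integrable_along_lines (directional_maximal \<Omega>) p"
    and "unbounded_on_Lp locally_integrable (kakeya_nikodym_maximal \<Omega>) p"
proof -
  have ex: "\<exists>\<delta> P. 0 < \<delta> \<and> \<delta> < 1 \<and> finite P \<and> (\<forall>(x, \<omega>)\<in>P. \<omega> \<in> \<Omega>) \<and>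
     ennreal \<Lambda> * emeasure lebesgue (tube_union P 1 \<delta>) < emeasure lebesgue (tube_union P (real n) \<delta>)" if "0 < \<Lambda>" for \<Lambda>
    using T that unfolding concentrating_tubes_def by (meson zero_less_one)
  show "unbounded_on_Lp locally_integrable_along_lines (directional_maximal \<Omega>) p"
  proof (rule unbounded_on_LpI[OF p])
    show "0 < 1 / (2 * R * n)" using R n by simp
    fix \<Lambda> :: real assume "0 < \<Lambda>"
    then obtain \<delta> P where P: "0 < \<delta>" "\<delta> < 1" "finite P" "\<forall>(x, \<omega>)\<in>P. \<omega> \<in> \<Omega>"
      "ennreal \<Lambda> * emeasure lebesgue (tube_union P 1 \<delta>) < emeasure lebesgue (tube_union P (real n) \<delta>)" using ex by blast
    show "\<exists>E F. E \<in> lmeasurable \<and> F \<in> lmeasurable \<and> locally_integrable_along_lines (indicator E) \<and>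
      ennreal \<Lambda> * emeasure lebesgue E < emeasure lebesgue F \<and>
      (\<forall>x\<in>F. ennreal (1 / (2 * R * n)) \<le> directional_maximal \<Omega> (indicator E) x)"
      using P directional_maximal_ge[OF n \<omega> P(4)]
      by (intro exI[of _ "tube_union P 1 \<delta>"] exI[of _ "tube_union P (real n) \<delta>"] conjI ballI)
        (auto intro!: lmeasurable_compact compact_tube_union locally_integrable_along_lines_indicator compact_imp_closed)
  qed
  show "unbounded_on_Lp locally_integrable (kakeya_nikodym_maximal \<Omega>) p"
  proof (rule unbounded_on_LpI[OF p])
    show "0 < 1 / real n" using n by simp
    fix \<Lambda> :: real assume "0 < \<Lambda>"
    then obtain \<delta> P where P: "0 < \<delta>" "\<delta> < 1" "finite P" "\<forall>(x, \<omega>)\<in>P. \<omega> \<in> \<Omega>"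
      "ennreal \<Lambda> * emeasure lebesgue (tube_union P 1 \<delta>) < emeasure lebesgue (tube_union P (real n) \<delta>)" using ex by blast
    have nz: "\<omega> \<noteq> 0" if "\<omega> \<in> \<Omega>" for \<omega> using \<omega>[OF that] by auto
    show "\<exists>E F. E \<in> lmeasurable \<and> F \<in> lmeasurable \<and> locally_integrable (indicator E) \<and>
      ennreal \<Lambda> * emeasure lebesgue E < emeasure lebesgue F \<and>
      (\<forall>x\<in>F. ennreal (1 / n) \<le> kakeya_nikodym_maximal \<Omega> (indicator E) x)"
      using P kakeya_nikodym_maximal_ge[OF n nz P(1) less_imp_le[OF P(2)] P(4)]
      by (intro exI[of _ "tube_union P 1 \<delta>"] exI[of _ "tube_union P (real n) \<delta>"] conjI ballI)
        (auto intro!: lmeasurable_compact compact_tube_union locally_integrable_indicator compact_imp_closed)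
  qed
qed


context cantor_slopes begin

section \<open>Tubes along the lines of a sticky map\<close>

lemma norm_direction: "s \<in> J N \<Longrightarrow> 1 \<le> norm (1 :: real, g N s) \<and> norm (1 :: real, g N s) \<le> 1 + real CARD('d)"
proof -
  assume s: "s \<in> J N"
  have "norm (1 :: real, g N s) \<le> norm (1 :: real) + norm (g N s)" by (rule norm_Pair_le)
  moreover have "norm (1 :: real) \<le> norm (1 :: real, g N s)" by (metis fst_conv norm_fst_le)
  ultimately show ?thesis using norm_slope_le[OF s] by simp
qed

definition sticky_tubes :: "nat \<Rightarrow> real \<Rightarrow> (('d \<Rightarrow> nat) \<Rightarrow> nat) \<Rightarrow> ((real \<times> (real ^ 'd)) \<times> (real \<times> (real ^ 'd))) set" where
  "sticky_tubes N H \<sigma> = (\<lambda>z. ((H, pos N z + H *\<^sub>R g N (\<sigma> z)), (1, g N (\<sigma> z)))) ` grid N"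

text \<open>
  Directions have norm at least one, so a tube of unit length and radius at most one half stays within
  height one of its centre. The radius is measured orthogonally to the axis; measured at
  constant height, the cross-section is larger by a factor of at most \<open>1 + norm (g N s)\<close>.
\<close>

lemma short_tubes_subset:
  assumes \<sigma>: "\<sigma> \<in> sticky_maps N" and N: "1 \<le> N"
  shows "tube_union (sticky_tubes N H \<sigma>) 1 (1 / real M ^ N) \<subseteq> swept N (1 + real CARD('d)) {H - 1..H + 1} \<sigma>"
proof
  fix p assume "p \<in> tube_union (sticky_tubes N H \<sigma>) 1 (1 / real M ^ N)"
  then obtain z where z: "z \<in> grid N"
    and p: "p \<in> tube (H, pos N z + H *\<^sub>R g N (\<sigma> z)) (1, g N (\<sigma> z)) 1 (1 / real M ^ N)"
    by (auto simp: tube_union_def sticky_tubes_def)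
  define u where "u = g N (\<sigma> z)"
  define \<omega> where "\<omega> = (1 :: real, u)"
  define \<delta> where "\<delta> = 1 / real M ^ N"
  have s: "\<sigma> z \<in> J N" by (rule sticky_maps_in_J[OF \<sigma> z])
  obtain t v where tv: "p = (H, pos N z + H *\<^sub>R u) + t *\<^sub>R sgn \<omega> + v" "\<bar>t\<bar> \<le> 1 / 2" "norm v \<le> \<delta>"
    using p unfolding tube_def \<omega>_def u_def \<delta>_def by blast
  have n: "1 \<le> norm \<omega>" "norm u \<le> CARD('d)"
    using norm_direction[OF s] norm_slope_le[OF s] by (simp_all add: \<omega>_def u_def)
  have \<delta>: "\<delta> \<le> 1 / 2"
  proof -
    have "real M \<le> real M ^ N" using power_increasing[of 1 N "real M"] N M2 by (simp del: of_nat_power)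
    moreover have "2 \<le> real M" using M2 by simp
    ultimately have "2 \<le> real M ^ N" by (rule order_trans[rotated])
    thus ?thesis by (simp add: \<delta>_def divide_simps)
  qed
  define h where "h = H + t / norm \<omega> + fst v"
  define y where "y = pos N z + H *\<^sub>R u + (t / norm \<omega>) *\<^sub>R u + snd v"
  have sg: "t *\<^sub>R sgn \<omega> = (t / norm \<omega>, (t / norm \<omega>) *\<^sub>R u)"
    by (simp add: sgn_div_norm \<omega>_def divide_inverse)
  have pe: "p = (h, y)" unfolding tv(1) sg h_def y_def by (cases v) simp
  have v: "\<bar>fst v\<bar> \<le> \<delta>" "norm (snd v) \<le> \<delta>"
    using norm_fst_le[of "fst v" "snd v"] norm_snd_le[of "snd v" "fst v"] tv(3) by simp_all
  have "\<bar>t / norm \<omega>\<bar> \<le> 1 / 2"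
  proof -
    have "\<bar>t\<bar> / norm \<omega> \<le> (1 / 2) / 1" using tv(2) n(1) by (intro frac_le) auto
    thus ?thesis by (simp add: abs_divide)
  qed
  hence h: "h \<in> {H - 1..H + 1}" using v(1) \<delta> unfolding h_def atLeastAtMost_iff abs_le_iff by linarith
  have "y - (pos N z + h *\<^sub>R u) = snd v - fst v *\<^sub>R u" by (simp add: y_def h_def algebra_simps)
  hence "norm (y - (pos N z + h *\<^sub>R u)) \<le> norm (snd v) + \<bar>fst v\<bar> * norm u"
    using norm_triangle_ineq4[of "snd v" "fst v *\<^sub>R u"] by simp
  also have "\<dots> \<le> \<delta> + \<delta> * CARD('d)" using v n by (intro add_mono mult_mono) auto
  finally have "hit N (1 + real CARD('d)) h y z (\<sigma> z)" by (simp add: hit_def u_def \<delta>_def add_divide_distrib)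
  thus "p \<in> swept N (1 + real CARD('d)) {H - 1..H + 1} \<sigma>" using h z by (auto simp: swept_def pe)
qed

text \<open>
  A horizontal displacement \<open>w\<close> from the axis splits into an axial part, which the length of the tube
  absorbs, and an orthogonal part, which is no longer than \<open>w\<close>.
\<close>

lemma long_tubes_superset:
  fixes H l :: real
  assumes \<sigma>: "\<sigma> \<in> sticky_maps N" and H: "1 \<le> H" and l: "2 * (H + 1) * (1 + real CARD('d)) \<le> l"
  shows "swept N 1 {0..1} \<sigma> \<subseteq> tube_union (sticky_tubes N H \<sigma>) l (1 / real M ^ N)"
proof
  fix p assume "p \<in> swept N 1 {0..1} \<sigma>"
  then obtain h y z where p: "p = (h, y)" "0 \<le> h" "h \<le> 1" "z \<in> grid N" "hit N 1 h y z (\<sigma> z)"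
    by (auto simp: swept_def)
  define u where "u = g N (\<sigma> z)"
  define \<omega> where "\<omega> = (1 :: real, u)"
  define w where "w = (0 :: real, y - (pos N z + h *\<^sub>R u))"
  have s: "\<sigma> z \<in> J N" by (rule sticky_maps_in_J[OF \<sigma> p(4)])
  have n: "1 \<le> norm \<omega>" "norm \<omega> \<le> 1 + real CARD('d)" using norm_direction[OF s] by (simp_all add: \<omega>_def u_def)
  have nz: "\<omega> \<noteq> 0" using n(1) by auto
  have w: "norm w \<le> 1 / real M ^ N" using p(5) by (simp add: w_def hit_def u_def norm_Pair)
  have w1: "norm w \<le> 1"
  proof -
    have "1 / real M ^ N \<le> 1" using M2 by simp
    thus ?thesis using w by linarith
  qed
  note o = orthogonal_split[OF nz, of w]
  define t where "t = (h - H) * norm \<omega> + w \<bullet> sgn \<omega>"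
  have "(h, y) = (H, pos N z + H *\<^sub>R u) + (h - H) *\<^sub>R \<omega> + w"
    by (simp add: \<omega>_def w_def algebra_simps)
  also have "(h - H) *\<^sub>R \<omega> = ((h - H) * norm \<omega>) *\<^sub>R sgn \<omega>"
    using nz by (simp add: sgn_div_norm)
  also have "(H, pos N z + H *\<^sub>R u) + ((h - H) * norm \<omega>) *\<^sub>R sgn \<omega> + w =
      (H, pos N z + H *\<^sub>R u) + t *\<^sub>R sgn \<omega> + (w - (w \<bullet> sgn \<omega>) *\<^sub>R sgn \<omega>)"
    by (simp add: t_def scaleR_add_left)
  finally have eq: "p = (H, pos N z + H *\<^sub>R u) + t *\<^sub>R sgn \<omega> + (w - (w \<bullet> sgn \<omega>) *\<^sub>R sgn \<omega>)"
    using p(1) by simp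
  have "\<bar>(h - H) * norm \<omega>\<bar> \<le> H * (1 + real CARD('d))"
    unfolding abs_mult using p H n by (intro mult_mono) auto
  hence "\<bar>t\<bar> \<le> H * (1 + real CARD('d)) + 1" using o(2) w1 unfolding t_def by linarith
  also have "\<dots> \<le> H * (1 + real CARD('d)) + (1 + real CARD('d))" by simp
  also have "\<dots> = (2 * (H + 1) * (1 + real CARD('d))) / 2" by (simp add: algebra_simps)
  also have "\<dots> \<le> l / 2" using l by (rule divide_right_mono) simp
  finally have "p \<in> tube (H, pos N z + H *\<^sub>R u) \<omega> l (1 / real M ^ N)"
    by (rule tubeI[OF eq _ o(1) order_trans[OF o(3) w]])
  thus "p \<in> tube_union (sticky_tubes N H \<sigma>) l (1 / real M ^ N)"
    using p(4) by (auto simp: tube_union_def sticky_tubes_def u_def \<omega>_def)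
qed

text \<open>
  \<open>H\<close> has to be large enough for sibling slopes to exclude each other at all heights \<open>h \<ge> H - 1\<close>, and \<open>n\<close>
  large enough for the tubes centred at height \<open>H\<close> to reach height zero.
\<close>

lemma concentrating_tubes_exist:
  fixes \<Omega> :: "(real \<times> (real ^ 'd)) set"
  assumes dirs: "\<And>N s. s \<in> J N \<Longrightarrow> (1, g N s) \<in> \<Omega>"
  obtains n where "1 \<le> n" "concentrating_tubes \<Omega> n"
proof -
  define \<rho> where "\<rho> = 1 + real CARD('d)"
  define H where "H = 2 + (CARD('d) + 2 * \<rho>) / c"
  have \<rho>: "0 \<le> \<rho>" by (simp add: \<rho>_def)
  have cH: "c * (H - 1) = c + (CARD('d) + 2 * \<rho>)"
  proof -
    define X where "X = CARD('d) + 2 * \<rho>"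
    show ?thesis unfolding H_def X_def[symmetric] using c0 by (simp add: right_diff_distrib distrib_left)
  qed
  have H: "real CARD('d) + 2 * \<rho> < c * (H - 1)" unfolding cH using c0 by simp
  have H1: "1 \<le> H" using c0 \<rho> by (simp add: H_def add_increasing2)
  obtain n0 :: nat where n0: "2 * (H + 1) * (1 + real CARD('d)) \<le> n0" using real_arch_simple by blast
  define n where "n = Suc n0"
  have n: "2 * (H + 1) * (1 + real CARD('d)) \<le> real n" using n0 by (simp add: n_def)
  have "concentrating_tubes \<Omega> n" unfolding concentrating_tubes_def
  proof (intro allI impI)
    fix \<Lambda> \<epsilon> :: real assume \<Lambda>: "0 < \<Lambda>" and \<epsilon>: "0 < \<epsilon>"
    obtain N0 where N0: "\<And>N. N0 \<le> N \<Longrightarrow> \<exists>\<sigma>\<in>sticky_maps N.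
      ennreal \<Lambda> * emeasure lborel (swept N \<rho> {H - 1..H + 1} \<sigma>) < emeasure lborel (swept N 1 {0..1} \<sigma>)"
      using exists_concentrating_sticky_map[OF \<rho> H \<Lambda>] by blast
    have "1 < real M" using M2 by simp
    then obtain N1 where N1: "1 / \<epsilon> < real M ^ N1" using real_arch_pow by blast
    define N where "N = max (max N0 N1) 1"
    have N: "N0 \<le> N" "N1 \<le> N" "1 \<le> N" by (auto simp: N_def)
    obtain \<sigma> where \<sigma>: "\<sigma> \<in> sticky_maps N"
      "ennreal \<Lambda> * emeasure lborel (swept N \<rho> {H - 1..H + 1} \<sigma>) < emeasure lborel (swept N 1 {0..1} \<sigma>)"
      using N0[OF N(1)] by blast
    define \<delta> where "\<delta> = 1 / real M ^ N"
    define P where "P = sticky_tubes N H \<sigma>"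
    have fin: "finite P" unfolding P_def sticky_tubes_def by (intro finite_imageI finite_grid)
    have "real M ^ N1 \<le> real M ^ N" using N M2 by (intro power_increasing) auto
    hence "1 / \<epsilon> < real M ^ N" using N1 by linarith
    hence \<delta>: "0 < \<delta>" "\<delta> < \<epsilon>" using \<epsilon> M_pow_pos[of N] by (auto simp: \<delta>_def field_simps)
    have dir: "\<forall>(x, \<omega>)\<in>P. \<omega> \<in> \<Omega>" using dirs sticky_maps_in_J[OF \<sigma>(1)] by (auto simp: P_def sticky_tubes_def)
    have "emeasure lebesgue (tube_union P 1 \<delta>) \<le> emeasure lebesgue (swept N \<rho> {H - 1..H + 1} \<sigma>)"
      using short_tubes_subset[OF \<sigma>(1) N(3)] unfolding P_def \<delta>_def \<rho>_def
      by (intro emeasure_mono) (simp_all add: closed_swept)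
    hence "ennreal \<Lambda> * emeasure lebesgue (tube_union P 1 \<delta>) \<le> ennreal \<Lambda> * emeasure lebesgue (swept N \<rho> {H - 1..H + 1} \<sigma>)"
      by (rule mult_left_mono) simp
    also have "\<dots> < emeasure lebesgue (swept N 1 {0..1} \<sigma>)"
      using \<sigma>(2) by (simp add: closed_swept)
    also have "\<dots> \<le> emeasure lebesgue (tube_union P (real n) \<delta>)"
      using long_tubes_superset[OF \<sigma>(1) H1 n] fin unfolding P_def \<delta>_def
      by (intro emeasure_mono) (simp_all add: compact_tube_union borel_compact)
    finally show "\<exists>\<delta> P. 0 < \<delta> \<and> \<delta> < \<epsilon> \<and> finite P \<and> (\<forall>(x, \<omega>)\<in>P. \<omega> \<in> \<Omega>) \<and>
     ennreal \<Lambda> * emeasure lebesgue (tube_union P 1 \<delta>) < emeasure lebesgue (tube_union P (real n) \<delta>)"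
      using \<delta> fin dir by blast
  qed
  thus ?thesis by (intro that[of n]) (auto simp: n_def)
qed

end

section \<open>Slopes from a generalized Cantor set\<close>

lemma cantor_stages_step:
  assumes "cantor_stages M J"
  obtains a b where "\<forall>j\<in>J k. a j < M \<and> b j < M \<and> a j + 1 < b j"
    "J (Suc k) = (\<Union>j\<in>J k. {M * j + a j, M * j + b j})"
proof -
  have "\<exists>a b. (\<forall>j\<in>J k. a j < M \<and> b j < M \<and> a j + 1 < b j) \<and> J (Suc k) = (\<Union>j\<in>J k. {M * j + a j, M * j + b j})"
    by (rule assms[unfolded cantor_stages_def, THEN conjunct2, THEN spec])
  thus ?thesis using that by (elim exE conjE) blast
qed

lemma cantor_stages_parent:
  assumes "cantor_stages M J" "j \<in> J (Suc k)"
  shows "j div M \<in> J k"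
proof -
  obtain a b where ab: "\<forall>j\<in>J k. a j < M \<and> b j < M \<and> a j + 1 < b j"
    "J (Suc k) = (\<Union>j\<in>J k. {M * j + a j, M * j + b j})"
    by (rule cantor_stages_step[OF assms(1), of k])
  from assms(2) obtain i where i: "i \<in> J k" "j = M * i + a i \<or> j = M * i + b i"
    unfolding ab(2) by blast
  have "a i < M" "b i < M" using bspec[OF ab(1) i(1)] by simp_all
  thus ?thesis using i by auto
qed

lemma cantor_stages_children:
  assumes "cantor_stages M J" "j \<in> J k"
  obtains p q where "p + 1 < q" "p < M" "q < M" "{j' \<in> J (Suc k). j' div M = j} = {M * j + p, M * j + q}"
proof -
  obtain a b where ab: "\<forall>j\<in>J k. a j < M \<and> b j < M \<and> a j + 1 < b j"
    "J (Suc k) = (\<Union>j\<in>J k. {M * j + a j, M * j + b j})"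
    by (rule cantor_stages_step[OF assms(1), of k])
  have "(M * i + a i) div M = i" "(M * i + b i) div M = i" if i: "i \<in> J k" for i
  proof -
    have "a i < M" "b i < M" using bspec[OF ab(1) i] by simp_all
    thus "(M * i + a i) div M = i" "(M * i + b i) div M = i" by simp_all
  qed
  hence "{j' \<in> J (Suc k). j' div M = j} = {M * j + a j, M * j + b j}" unfolding ab(2) using assms(2) by auto
  moreover have "a j < M" "b j < M" "a j + 1 < b j" using bspec[OF ab(1) assms(2)] by simp_all
  ultimately show ?thesis by (intro that[of "a j" "b j"])
qed

lemma cantor_stages_ancestor:
  assumes "cantor_stages M J" "j \<in> J (k + m)"
  shows "j div M ^ m \<in> J k"
  using assms(2)
proof (induction m arbitrary: j)
  case (Suc m)
  have "j div M \<in> J (k + m)" using Suc.prems cantor_stages_parent[OF assms(1)] by simp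
  thus ?case using Suc.IH[of "j div M"] by (simp add: div_mult2_eq)
qed simp

lemma cantor_stages_finite: "cantor_stages M J \<Longrightarrow> finite (J k)"
proof (induction k)
  case (Suc k)
  obtain a b where "J (Suc k) = (\<Union>j\<in>J k. {M * j + a j, M * j + b j})"
    by (rule cantor_stages_step[OF Suc.prems, of k])
  thus ?case using Suc by simp
qed (simp add: cantor_stages_def)

lemma basic_interval_parent:
  assumes M: "0 < M"
  shows "basic_interval M (k + m) j \<subseteq> basic_interval M k (j div M ^ m)"
proof -
  have "real (j div M ^ m) \<le> real j / real M ^ m" using real_div_bounds(1)[of "M ^ m" j] M by simp
  moreover have "real j + 1 \<le> (real (j div M ^ m) + 1) * real M ^ m"
  proof -
    have "j < M ^ m * (j div M ^ m) + M ^ m" using M dividend_less_times_div[of "M ^ m" j] by (simp add: add.commute)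
    hence "j + 1 \<le> (j div M ^ m + 1) * M ^ m" by (simp add: algebra_simps)
    hence "real (j + 1) \<le> real ((j div M ^ m + 1) * M ^ m)" by (simp only: of_nat_le_iff)
    thus ?thesis by (simp add: distrib_right)
  qed
  ultimately have "real (j div M ^ m) / real M ^ k \<le> real j / real M ^ m / real M ^ k"
    "(real j + 1) / real M ^ m \<le> real (j div M ^ m) + 1"
    using M by (simp_all add: divide_right_mono divide_le_eq)
  moreover from this(2) have "(real j + 1) / real M ^ m / real M ^ k \<le> (real (j div M ^ m) + 1) / real M ^ k"
    by (rule divide_right_mono) simp
  ultimately show ?thesis unfolding basic_interval_def
    by (simp add: power_add mult.commute)
qed

text \<open>
  Follow one child of each interval; the nested intervals have a common point by compactness.
\<close>

lemma cantor_point_exists: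
  assumes cs: "cantor_stages M J" and M: "0 < M" and j: "j \<in> J k"
  shows "\<exists>x. x \<in> basic_interval M k j \<and> x \<in> (\<Inter>l\<in>{1..}. \<Union>j\<in>J l. basic_interval M l j)"
proof -
  have "\<exists>f. f 0 = j \<and> (\<forall>i. f i \<in> J (k + i) \<and> f (Suc i) div M = f i)"
  proof -
    have "\<exists>f. \<forall>i. (f i \<in> J (k + i) \<and> (i = 0 \<longrightarrow> f i = j)) \<and> f (Suc i) div M = f i"
    proof (rule dependent_nat_choice)
      fix x i assume "x \<in> J (k + i) \<and> (i = 0 \<longrightarrow> x = j)"
      hence x: "x \<in> J (k + i)" by simp
      from cantor_stages_children[OF cs x] obtain p q where
        "{j' \<in> J (Suc (k + i)). j' div M = x} = {M * x + p, M * x + q}" by metis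
      hence "M * x + p \<in> J (Suc (k + i)) \<and> (M * x + p) div M = x" by blast
      thus "\<exists>y. (y \<in> J (k + Suc i) \<and> (Suc i = 0 \<longrightarrow> y = j)) \<and> y div M = x" by auto
    qed (use j in auto)
    thus ?thesis by blast
  qed
  then obtain f where f: "f 0 = j" "\<And>i. f i \<in> J (k + i)" "\<And>i. f (Suc i) div M = f i" by blast
  define B where "B = (\<lambda>i. basic_interval M (k + i) (f i))"
  have dec: "B n \<subseteq> B m" if "m \<le> n" for m n
  proof -
    have "B (Suc i) \<subseteq> B i" for i
      unfolding B_def using basic_interval_parent[OF M, of "k + i" 1 "f (Suc i)"] f(3)[of i] by simp
    thus ?thesis by (rule lift_Suc_antimono_le) (use that in auto)
  qed
  have ne: "B i \<noteq> {}" for i using M by (simp add: B_def basic_interval_def divide_right_mono)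
  have "(\<Inter>i. B i) \<noteq> {}"
    by (rule compact_nest) (use dec ne in \<open>auto simp: B_def basic_interval_def\<close>)
  then obtain x where x: "\<And>i. x \<in> B i" by blast
  have "x \<in> (\<Union>j\<in>J l. basic_interval M l j)" for l
  proof (cases "k \<le> l")
    case True
    thus ?thesis using x[of "l - k"] f(2)[of "l - k"] by (auto simp: B_def)
  next
    case False
    hence k: "k = l + (k - l)" by simp
    have "x \<in> basic_interval M l (j div M ^ (k - l))"
      using x[of 0] basic_interval_parent[OF M, of l "k - l" j] k by (auto simp: B_def f(1))
    moreover have "j div M ^ (k - l) \<in> J l" using cantor_stages_ancestor[OF cs, of j l "k - l"] j k by simp
    ultimately show ?thesis by blast
  qed
  thus ?thesis using x[of 0] by (auto simp: B_def f(1))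
qed

lemma generalized_cantor_set_compact:
  assumes M: "0 < M" and C: "generalized_cantor_set M \<C>"
  shows "compact \<C>" "\<C> \<subseteq> {0..1}"
proof -
  obtain J where J: "cantor_stages M J" "\<C> = (\<Inter>k\<in>{1..}. \<Union>j\<in>J k. basic_interval M k j)"
    using C unfolding generalized_cantor_set_def by blast
  have c: "compact (\<Union>j\<in>J k. basic_interval M k j)" for k
    by (intro compact_UN cantor_stages_finite[OF J(1)]) (simp add: basic_interval_def)
  have sub: "\<C> \<subseteq> (\<Union>j\<in>J 1. basic_interval M 1 j)" unfolding J(2) by (rule INF_lower) simp
  have "closed \<C>" unfolding J(2) using c by (intro closed_INT) (auto intro: compact_imp_closed)
  thus "compact \<C>" using sub c[of 1] by (metis compact_Int_closed inf.absorb_iff2)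
  have "basic_interval M 1 j \<subseteq> {0..1}" if "j \<in> J 1" for j
  proof -
    have "j div M \<in> J 0" using cantor_stages_parent[OF J(1), of j 0] that by simp
    hence "j div M = 0" using J(1) by (simp add: cantor_stages_def)
    thus ?thesis using basic_interval_parent[OF M, of 0 1 j] by (simp add: basic_interval_def)
  qed
  thus "\<C> \<subseteq> {0..1}" using sub by blast
qed

text \<open>
  Intervals of stage \<open>k + 1\<close> with the same parent are not adjacent, so they are at distance
  at least \<open>M\<^sup>-\<^sup>(\<^sup>k\<^sup>+\<^sup>1\<^sup>)\<close>, the length of an interval of that stage.
\<close>

lemma cantor_slopes_on_curve:
  fixes \<gamma> :: "real \<Rightarrow> real \<times> (real ^ 'd)"
  assumes M: "M \<ge> 3" and cs: "cantor_stages M J"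
    and \<gamma>: "\<gamma> \<in> {0..1} \<rightarrow> {1} \<times> {v. \<forall>i. v $ i \<in> {-1..1}}"
    and c: "0 < c" and C: "0 < C"
    and bilip: "\<forall>x\<in>{0..1}. \<forall>y\<in>{0..1}. c * \<bar>x - y\<bar> \<le> norm (\<gamma> x - \<gamma> y) \<and> norm (\<gamma> x - \<gamma> y) \<le> C * \<bar>x - y\<bar>"
    and t01: "\<And>N s. s \<in> J N \<Longrightarrow> t N s \<in> {0..1}"
    and t: "\<And>N s. s \<in> J N \<Longrightarrow> t N s \<in> basic_interval M N s"
  shows "cantor_slopes M J (\<lambda>N s. snd (\<gamma> (t N s))) c C"
proof
  have M0: "0 < M" using M by simp
  have \<gamma>1: "fst (\<gamma> x) = 1" if "x \<in> {0..1}" for x using \<gamma> that by (auto simp: Pi_iff mem_Times_iff)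
  have nrm: "norm (\<gamma> x - \<gamma> y) = norm (snd (\<gamma> x) - snd (\<gamma> y))" if "x \<in> {0..1}" "y \<in> {0..1}" for x y
  proof -
    have "\<gamma> x - \<gamma> y = (0, snd (\<gamma> x) - snd (\<gamma> y))" using \<gamma>1 that by (simp add: prod_eq_iff)
    thus ?thesis by (simp add: norm_Pair)
  qed
  have anc: "t N s \<in> basic_interval M (N - m) (s div M ^ m)" if "s \<in> J N" "m \<le> N" for N s m
    using basic_interval_parent[OF M0, of "N - m" m s] t[OF that(1)] that(2) by auto
  have scale: "real M ^ m / real M ^ N = 1 / real M ^ (N - m)" if "m \<le> N" for m N
    using that M0 by (simp add: power_diff)
  show "2 \<le> M" "0 < c" "0 < C" using M c C by simp_all
  show "finite (J k)" for k by (rule cantor_stages_finite[OF cs])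
  show "J 0 = {0}" using cs by (simp add: cantor_stages_def)
  show "s div M \<in> J k" if "s \<in> J (Suc k)" for s k by (rule cantor_stages_parent[OF cs that])
  show "card {s' \<in> J (Suc k). s' div M = s} = 2" if s: "s \<in> J k" for s k
  proof -
    obtain p q where "p + 1 < q" "{s' \<in> J (Suc k). s' div M = s} = {M * s + p, M * s + q}"
      by (rule cantor_stages_children[OF cs s])
    thus ?thesis by simp
  qed
  show "norm (snd (\<gamma> (t N s)) - snd (\<gamma> (t N s'))) \<le> C * (M ^ m / M ^ N)"
    if s: "s \<in> J N" "s' \<in> J N" and m: "m \<le> N" and eq: "s div M ^ m = s' div M ^ m" for s s' N m
  proof -
    have "\<bar>t N s - t N s'\<bar> \<le> 1 / real M ^ (N - m)"
      using anc[OF s(1) m] anc[OF s(2) m] unfolding basic_interval_def eq add_divide_distrib by auto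
    hence "C * \<bar>t N s - t N s'\<bar> \<le> C * (1 / real M ^ (N - m))" using C by (intro mult_left_mono) auto
    moreover have "norm (\<gamma> (t N s) - \<gamma> (t N s')) \<le> C * \<bar>t N s - t N s'\<bar>" using bilip t01 s by blast
    ultimately show ?thesis using scale[OF m] nrm t01 s by simp
  qed
  show "c * (M ^ m / M ^ N) \<le> norm (snd (\<gamma> (t N s)) - snd (\<gamma> (t N s')))"
    if s: "s \<in> J N" "s' \<in> J N" and m: "m < N" and ne: "s div M ^ m \<noteq> s' div M ^ m"
      and eq: "s div M ^ Suc m = s' div M ^ Suc m" for s s' N m
  proof -
    define k where "k = N - Suc m"
    have N: "N = Suc k + m" using m by (simp add: k_def)
    define i where "i = s div M ^ Suc m"
    have J: "s div M ^ m \<in> J (Suc k)" "s' div M ^ m \<in> J (Suc k)"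
      using cantor_stages_ancestor[OF cs, of _ "Suc k" m] s N by simp_all
    have par: "s div M ^ m div M = i" "s' div M ^ m div M = i"
      using eq by (simp_all add: i_def div_mult2_eq[symmetric] mult.commute)
    have "i \<in> J k" using cantor_stages_ancestor[OF cs, of s k "Suc m"] s N by (simp add: i_def)
    then obtain p q where pq: "p + 1 < q" "{j' \<in> J (Suc k). j' div M = i} = {M * i + p, M * i + q}"
      by (rule cantor_stages_children[OF cs])
    have "s div M ^ m \<in> {M * i + p, M * i + q}" "s' div M ^ m \<in> {M * i + p, M * i + q}"
      unfolding pq(2)[symmetric] using J par by simp_all
    hence two: "s div M ^ m + 2 \<le> s' div M ^ m \<or> s' div M ^ m + 2 \<le> s div M ^ m" using ne pq(1) by auto
    have gap: "1 / real M ^ Suc k \<le> y - x" if xy: "x \<in> basic_interval M (Suc k) u" "y \<in> basic_interval M (Suc k) v" "u + 2 \<le> v" for x y u v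
    proof -
      have "real u + 2 \<le> real v" using xy(3) by linarith
      hence "(real u + 2) / real M ^ Suc k \<le> real v / real M ^ Suc k" by (intro divide_right_mono) auto
      moreover have "x \<le> (real u + 1) / real M ^ Suc k" "real v / real M ^ Suc k \<le> y"
        using xy by (auto simp: basic_interval_def)
      moreover have "(real u + 2) / real M ^ Suc k = (real u + 1) / real M ^ Suc k + 1 / real M ^ Suc k"
        by (simp add: add_divide_distrib[symmetric])
      ultimately show ?thesis by linarith
    qed
    have Nm: "N - m = Suc k" using N by simp
    have "1 / real M ^ Suc k \<le> \<bar>t N s - t N s'\<bar>"
      using two gap[of "t N s" "s div M ^ m" "t N s'" "s' div M ^ m"] gap[of "t N s'" "s' div M ^ m" "t N s" "s div M ^ m"]
        anc[OF s(1) less_imp_le[OF m]] anc[OF s(2) less_imp_le[OF m]] unfolding Nm by linarith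
    hence "c * (1 / real M ^ Suc k) \<le> c * \<bar>t N s - t N s'\<bar>" using c by (intro mult_left_mono) auto
    moreover have "c * \<bar>t N s - t N s'\<bar> \<le> norm (\<gamma> (t N s) - \<gamma> (t N s'))" using bilip t01 s by blast
    ultimately have "c * (real M ^ m / real M ^ N) \<le> norm (\<gamma> (t N s) - \<gamma> (t N s'))"
      unfolding scale[OF less_imp_le[OF m]] Nm by linarith
    thus ?thesis using nrm[OF t01[OF s(1)] t01[OF s(2)]] by simp
  qed
  show "\<bar>snd (\<gamma> (t N s)) $ i\<bar> \<le> 1" if "s \<in> J N" for N s i
  proof -
    have "\<gamma> (t N s) \<in> {1} \<times> {v. \<forall>i. v $ i \<in> {-1..1}}" using \<gamma> t01[OF that] by blast
    hence "snd (\<gamma> (t N s)) $ i \<in> {-1..1}" by (auto simp: mem_Times_iff)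
    thus ?thesis by (simp add: abs_le_iff)
  qed
qed

theorem theorem1p2:
  fixes M :: nat and \<C> :: "real set" and \<gamma> :: "real \<Rightarrow> real \<times> (real ^ 'd)"
    and c C :: real and \<Omega> :: "(real \<times> (real ^ 'd)) set"
  assumes "M \<ge> 3"
    and "generalized_cantor_set M \<C>"
    and "\<gamma> \<in> {0..1} \<rightarrow> {1} \<times> {v. \<forall>i. v $ i \<in> {-1..1}}"
    and "inj_on \<gamma> {0..1}"
    and "0 < c" and "c < 1" and "1 < C"
    and "\<forall>x\<in>{0..1}. \<forall>y\<in>{0..1}.
           c * \<bar>x - y\<bar> \<le> norm (\<gamma> x - \<gamma> y) \<and> norm (\<gamma> x - \<gamma> y) \<le> C * \<bar>x - y\<bar>"
    and "\<Omega> = \<gamma> ` \<C>"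
  shows "admits_kakeya_type_sets \<Omega> \<and>
    (\<forall>p\<ge>1::real. unbounded_on_Lp locally_integrable_along_lines (directional_maximal \<Omega>) p \<and>
            unbounded_on_Lp locally_integrable (kakeya_nikodym_maximal \<Omega>) p)"
proof -
  have M0: "0 < M" using assms(1) by simp
  have C0: "0 < C" using assms(7) by simp
  obtain J where J: "cantor_stages M J" "\<C> = (\<Inter>k\<in>{1..}. \<Union>j\<in>J k. basic_interval M k j)"
    using assms(2) unfolding generalized_cantor_set_def by blast
  note \<C> = generalized_cantor_set_compact[OF M0 assms(2)]
  have "\<forall>N s. \<exists>x. s \<in> J N \<longrightarrow> x \<in> basic_interval M N s \<and> x \<in> \<C>"
    using cantor_point_exists[OF J(1) M0] unfolding J(2) by blast
  then obtain t where t: "\<And>N s. s \<in> J N \<Longrightarrow> t N s \<in> basic_interval M N s \<and> t N s \<in> \<C>" by metis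
  have t01: "t N s \<in> {0..1}" if "s \<in> J N" for N s using t[OF that] \<C>(2) by blast
  interpret cantor_slopes M J "\<lambda>N s. snd (\<gamma> (t N s))" c C
    by (rule cantor_slopes_on_curve[OF assms(1) J(1) assms(3) assms(5) C0 assms(8) t01]) (use t in auto)
  have \<gamma>: "fst (\<gamma> x) = 1" "\<bar>snd (\<gamma> x) $ i\<bar> \<le> 1" if "x \<in> {0..1}" for x i
  proof -
    have "\<gamma> x \<in> {1} \<times> {v. \<forall>i. v $ i \<in> {-1..1}}" using assms(3) that by blast
    thus "fst (\<gamma> x) = 1" "\<bar>snd (\<gamma> x) $ i\<bar> \<le> 1" by (auto simp: mem_Times_iff abs_le_iff minus_le_iff)
  qed
  have dir: "(1, snd (\<gamma> (t N s))) \<in> \<Omega>" if "s \<in> J N" for N s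
  proof -
    have "\<gamma> (t N s) = (1, snd (\<gamma> (t N s)))" using \<gamma>(1)[OF t01[OF that]] by (simp add: prod_eq_iff)
    thus ?thesis using t[OF that] assms(9) by (metis image_eqI)
  qed
  obtain n where n: "1 \<le> n" "concentrating_tubes \<Omega> n" using concentrating_tubes_exist[OF dir] by blast
  have "C-lipschitz_on {0..1} \<gamma>"
    using assms(8) C0 by (intro lipschitz_onI) (auto simp: dist_norm)
  hence "continuous_on {0..1} \<gamma>" by (rule lipschitz_on_continuous_on)
  hence "compact \<Omega>" unfolding assms(9)
    using \<C> by (intro compact_continuous_image) (auto intro: continuous_on_subset)
  moreover have "1 \<le> norm \<omega> \<and> norm \<omega> \<le> 1 + real CARD('d)" if w: "\<omega> \<in> \<Omega>" for \<omega>
  proof -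
    obtain x where x: "x \<in> {0..1}" "\<omega> = \<gamma> x" using w \<C>(2) assms(9) by blast
    have \<omega>: "\<omega> = (1, snd \<omega>)" using \<gamma>(1)[OF x(1)] x(2) by (simp add: prod_eq_iff)
    have "norm (snd \<omega>) \<le> (\<Sum>i\<in>UNIV. \<bar>snd \<omega> $ i\<bar>)" by (rule norm_le_l1_cart)
    also have "\<dots> \<le> (\<Sum>i\<in>(UNIV :: 'd set). 1)" using \<gamma>(2)[OF x(1)] x(2) by (intro sum_mono) auto
    finally have "norm (snd \<omega>) \<le> real CARD('d)" by simp
    moreover have "norm \<omega> \<le> norm (1 :: real) + norm (snd \<omega>)" using norm_Pair_le[of "1 :: real" "snd \<omega>"] \<omega> by simp
    moreover have "norm (1 :: real) \<le> norm \<omega>" using norm_fst_le[of "1 :: real" "snd \<omega>"] \<omega> by simp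
    ultimately show ?thesis by simp
  qed
  ultimately show ?thesis
    using concentrating_imp_kakeya[OF _ n] concentrating_imp_unbounded[OF n(1) _ _ n(2), of "1 + real CARD('d)"]
    by (auto simp: add_pos_nonneg)
qed

end
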